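(* Let $\mathcal{H}=(C,F,D,G)$ be a hybrid system on $\mathbb{R}^n$ satisfying the Basic Assumptions, and consider $l$ sets $\Gamma_1\subset\cdots\subset\Gamma_l\subset\Gamma_{l+1}:=\mathbb{R}^n$, with $\Gamma_1$ compact and all $\Gamma_i$ closed. If (i) $\Gamma_i$ is asymptotically stable relative to $\Gamma_{i+1}$ for $i=1,\ldots,l$, then $\Gamma_1$ is asymptotically stable for $\mathcal{H}$. On the other hand, if (i') $\Gamma_i$ is globally asymptotically stable relative to $\Gamma_{i+1}$ for $i=1,\ldots,l$, and (ii') all solutions $x\in\mathcal{S}_{\mathcal{H}}$ of $\mathcal{H}$ are bounded, then $\Gamma_1$ is globally asymptotically stable for $\mathcal{H}$.
   Context: Notation: $|x|_\Gamma=\inf_{y\in\Gamma}|x-y|$ and, for $c>0$, $B_c(\Gamma)=\{x\in\mathbb{R}^n:|x|_\Gamma<c\}$. Hybrid system: a 4-tuple $\mathcal{H}=(C,F,D,G)$ satisfying the Basic Assumptions: (A1) $C,D$ are closed subsets of $\mathbb{R}^n$; (A2) $F:\mathbb{R}^n\rightrightarrows\mathbb{R}^n$ is a set-valued map that is outer semicontinuous, locally bounded on $C$, with $F(x)$ nonempty and convex for each $x\in C$; (A3) $G:\mathbb{R}^n\rightrightarrows\mathbb{R}^n$ is outer semicontinuous, locally bounded on $D$, with $G(x)$ nonempty for each $x\in D$. Solutions: a hybrid time domain is a subset of $\mathbb{R}_{\ge0}\times\mathbb{N}$ that is a union of infinitely many sets $[t_j,t_{j+1}]\times\{j\}$, $j\in\mathbb{N}$,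 or of finitely many such sets with the last one of the form $[t_j,t_{j+1}]\times\{j\}$, $[t_j,t_{j+1})\times\{j\}$ or $[t_j,\infty)\times\{j\}$, where $0=t_0\le t_1\le\cdots$. A hybrid arc is a function $x:\mathrm{dom}(x)\to\mathbb{R}^n$ on a hybrid time domain such that for each $j$ the map $t\mapsto x(t,j)$ is locally absolutely continuous on $I_j=\{t:(t,j)\in\mathrm{dom}(x)\}$. A solution of $\mathcal{H}$ is a hybrid arc such that: for each $j$ for which $I_j$ has nonempty interior, $\dot x(t,j)\in F(x(t,j))$ for almost all $t\in I_j$ and $x(t,j)\in C$ for all $t\in[\min I_j,\sup I_j)$; and whenever $(t,j),(t,j+1)\in\mathrm{dom}(x)$, $x(t,j)\in D$ and $x(t,j+1)\in G(x(t,j))$. (From a point outside $C\cup D$ the only solution is the trivial one with domain $\{(0,0)\}$.) All solutions considered are maximal (cannot be extended). A solution is complete if its domain is unbounded, and bounded if its range is bounded. $\mathcal{S}_{\mathcal{H}}(x_0)$ is the set of maximal solutions with $x(0,0)=x_0$, $\mathcal{S}_{\mathcal{H}}(U)=\bigcup_{x_0\in U}\mathcal{S}_{\mathcal{H}}(x_0)$, $\mathcal{S}_{\mathcal{H}}=\mathcal{S}_{\mathcal{H}}(\mathbb{R}^n)$, and $\mathrm{rge}(\mathcal{S}_{\mathcal{H}}(U))$ is the union of the ranges of the solutions in $\mathcal{S}_{\mathcal{H}}(U)$. Compact $\Gamma$: $\Gamma$ is stable for $\mathcal{H}$ if for every $\varepsilon>0$ there is $\delta>0$ with $\mathrm{rge}(\mathcal{S}_{\mathcal{H}}(B_\delta(\Gamma)))\subset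 B_\varepsilon(\Gamma)$. The basin of attraction of $\Gamma$ is the set of points $p\in\mathbb{R}^n$ such that each $x\in\mathcal{S}_{\mathcal{H}}(p)$ is bounded and, if $x$ is complete, $|x(t,j)|_\Gamma\to0$ as $t+j\to\infty$, $(t,j)\in\mathrm{dom}(x)$. Closed $\Gamma$: $\Gamma$ is stable for $\mathcal{H}$ if for every $\varepsilon>0$ there is an open set $U\supset\Gamma$ with $\mathrm{rge}(\mathcal{S}_{\mathcal{H}}(U))\subset B_\varepsilon(\Gamma)$. The basin of attraction of $\Gamma$ is the set of $p\in\mathbb{R}^n$ such that for each $x\in\mathcal{S}_{\mathcal{H}}(p)$, $|x|_\Gamma$ is bounded and, if $x$ is complete, $|x(t,j)|_\Gamma\to0$ as $t+j\to\infty$. In both cases, $\Gamma$ is attractive if its basin of attraction contains $\Gamma$ in its interior; globally attractive if its basin of attraction is $\mathbb{R}^n$; (globally) asymptotically stable if stable and (globally) attractive. Relative properties: for a closed set $\Gamma'$, the restriction of $\mathcal{H}$ to $\Gamma'$ is $\mathcal{H}|_{\Gamma'}=(C\cap\Gamma',F,D\cap\Gamma',G)$. A closed set $\Gamma\subset\Gamma'$ has a property relative to $\Gamma'$ if it has that property for $\mathcal{H}|_{\Gamma'}$. *)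

theory Defs
  imports "HOL-Analysis.Analysis"
begin

(* Unlike infdist, this is infinity (not 0) when the set is empty. *)
definition set_distance :: "'a::metric_space set \<Rightarrow> 'a \<Rightarrow> ereal" where
  "set_distance \<Gamma> x = (INF y\<in>\<Gamma>. ereal (dist x y))"

definition set_ball :: "real \<Rightarrow> 'a::metric_space set \<Rightarrow> 'a set" where
  "set_ball c \<Gamma> = {x. set_distance \<Gamma> x < ereal c}"

section \<open>Hybrid systems\<close>

record 'a hybrid_system =
  flow_set :: "'a set"
  flow_map :: "'a \<Rightarrow> 'a set"
  jump_set :: "'a set"
  jump_map :: "'a \<Rightarrow> 'a set"

definition outer_semicontinuous :: "('a::metric_space \<Rightarrow> 'b::metric_space set) \<Rightarrow> bool" where
  "outer_semicontinuous M \<longleftrightarrow>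
     (\<forall>x y X Y. (\<forall>n. Y n \<in> M (X n)) \<and> X \<longlonglongrightarrow> x \<and> Y \<longlonglongrightarrow> y \<longrightarrow> y \<in> M x)"

(* Local boundedness relative to S: values of M outside S are not constrained. *)
definition locally_bounded_on :: "'a::metric_space set \<Rightarrow> ('a \<Rightarrow> 'b::metric_space set) \<Rightarrow> bool" where
  "locally_bounded_on S M \<longleftrightarrow>
     (\<forall>x\<in>S. \<exists>U. open U \<and> x \<in> U \<and> bounded (\<Union>y\<in>U \<inter> S. M y))"

definition basic_assumptions :: "'a::euclidean_space hybrid_system \<Rightarrow> bool" where
  "basic_assumptions H \<longleftrightarrow>
     closed (flow_set H) \<and> closed (jump_set H) \<and>
     outer_semicontinuous (flow_map H) \<and> locally_bounded_on (flow_set H) (flow_map H) \<and>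
     (\<forall>x\<in>flow_set H. flow_map H x \<noteq> {} \<and> convex (flow_map H x)) \<and>
     outer_semicontinuous (jump_map H) \<and> locally_bounded_on (jump_set H) (jump_map H) \<and>
     (\<forall>x\<in>jump_set H. jump_map H x \<noteq> {})"

definition restrict_system :: "'a hybrid_system \<Rightarrow> 'a set \<Rightarrow> 'a hybrid_system" where
  "restrict_system H \<Gamma>' =
     H\<lparr>flow_set := flow_set H \<inter> \<Gamma>', jump_set := jump_set H \<inter> \<Gamma>'\<rparr>"

section \<open>Hybrid arcs and solutions\<close>

(* In the finite case the last interval has index J. The half-open form may be empty; for
   J = 0 this gives the empty domain, which max_solutions_from excludes. *)
definition hybrid_time_domain :: "(real \<times> nat) set \<Rightarrow> bool" where
  "hybrid_time_domain E \<longleftrightarrow>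
     (\<exists>t :: nat \<Rightarrow> real. t 0 = 0 \<and> (\<forall>j. t j \<le> t (Suc j)) \<and>
        (E = (\<Union>j. {t j..t (Suc j)} \<times> {j}) \<or>
         (\<exists>J L. L \<in> {{t J..t (Suc J)}, {t J..<t (Suc J)}, {t J..}} \<and>
                E = (\<Union>j<J. {t j..t (Suc j)} \<times> {j}) \<union> L \<times> {J})))"

(* P is a finite family of non-overlapping intervals [u,v] contained in [a,b]. *)
definition absolutely_continuous_on_interval ::
    "real \<Rightarrow> real \<Rightarrow> (real \<Rightarrow> 'a::real_normed_vector) \<Rightarrow> bool" where
  "absolutely_continuous_on_interval a b f \<longleftrightarrow>
     (\<forall>\<epsilon>>0. \<exists>\<delta>>0. \<forall>P :: (real \<times> real) set.
        finite P \<and> (\<forall>(u, v)\<in>P. a \<le> u \<and> u \<le> v \<and> v \<le> b) \<and>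
        disjoint_family_on (\<lambda>(u, v). {u<..<v}) P \<and>
        (\<Sum>(u, v)\<in>P. v - u) < \<delta>
        \<longrightarrow> (\<Sum>(u, v)\<in>P. norm (f v - f u)) < \<epsilon>)"

definition locally_absolutely_continuous_on ::
    "real set \<Rightarrow> (real \<Rightarrow> 'a::real_normed_vector) \<Rightarrow> bool" where
  "locally_absolutely_continuous_on I f \<longleftrightarrow>
     (\<forall>a b. a \<le> b \<and> {a..b} \<subseteq> I \<longrightarrow> absolutely_continuous_on_interval a b f)"

(* Arcs are partial maps: domain, range and extension are dom, ran and map_le. *)
type_synonym 'a arc = "real \<times> nat \<rightharpoonup> 'a"

abbreviation arc_val :: "'a arc \<Rightarrow> nat \<Rightarrow> real \<Rightarrow> 'a" where
  "arc_val x j t \<equiv> the (x (t, j))"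

definition arc_interval :: "'a arc \<Rightarrow> nat \<Rightarrow> real set" where
  "arc_interval x j = {t. (t, j) \<in> dom x}"

definition hybrid_arc :: "'a::real_normed_vector arc \<Rightarrow> bool" where
  "hybrid_arc x \<longleftrightarrow>
     hybrid_time_domain (dom x) \<and>
     (\<forall>j. locally_absolutely_continuous_on (arc_interval x j) (arc_val x j))"

(* The condition (\<exists>s\<in>I. t < s) on t \<in> I says t < sup I, where sup I may be infinite. *)
definition solution :: "'a::euclidean_space hybrid_system \<Rightarrow> 'a arc \<Rightarrow> bool" where
  "solution H x \<longleftrightarrow>
     hybrid_arc x \<and>
     (\<forall>j. let I = arc_interval x j in interior I \<noteq> {} \<longrightarrow>
        (AE t in lebesgue. t \<in> I \<longrightarrow>
           (\<exists>v\<in>flow_map H (arc_val x j t).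
              (arc_val x j has_vector_derivative v) (at t within I))) \<and>
        (\<forall>t\<in>I. (\<exists>s\<in>I. t < s) \<longrightarrow> arc_val x j t \<in> flow_set H)) \<and>
     (\<forall>t j. (t, j) \<in> dom x \<and> (t, Suc j) \<in> dom x \<longrightarrow>
        arc_val x j t \<in> jump_set H \<and> arc_val x (Suc j) t \<in> jump_map H (arc_val x j t))"

definition maximal_solution :: "'a::euclidean_space hybrid_system \<Rightarrow> 'a arc \<Rightarrow> bool" where
  "maximal_solution H x \<longleftrightarrow>
     solution H x \<and> (\<forall>y. solution H y \<and> x \<subseteq>\<^sub>m y \<longrightarrow> y = x)"

definition complete_arc :: "'a arc \<Rightarrow> bool" where
  "complete_arc x \<longleftrightarrow> \<not> bounded ((\<lambda>(t, j). (t, real j)) ` dom x)"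

definition bounded_arc :: "'a::metric_space arc \<Rightarrow> bool" where
  "bounded_arc x \<longleftrightarrow> bounded (ran x)"

definition max_solutions_from :: "'a::euclidean_space hybrid_system \<Rightarrow> 'a set \<Rightarrow> 'a arc set" where
  "max_solutions_from H U = {x. maximal_solution H x \<and> (\<exists>p\<in>U. x (0, 0) = Some p)}"

definition reachable_range :: "'a::euclidean_space hybrid_system \<Rightarrow> 'a set \<Rightarrow> 'a set" where
  "reachable_range H U = (\<Union>x\<in>max_solutions_from H U. ran x)"

section \<open>Stability and attractivity\<close>

definition converges_to_set :: "'a::metric_space arc \<Rightarrow> 'a set \<Rightarrow> bool" where
  "converges_to_set x \<Gamma> \<longleftrightarrow>
     ((\<lambda>p. set_distance \<Gamma> (the (x p))) \<longlongrightarrow> 0)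
       (inf (filtercomap (\<lambda>(t, j). t + real j) at_top) (principal (dom x)))"

definition stable_compact :: "'a::euclidean_space hybrid_system \<Rightarrow> 'a set \<Rightarrow> bool" where
  "stable_compact H \<Gamma> \<longleftrightarrow>
     (\<forall>\<epsilon>>0. \<exists>\<delta>>0. reachable_range H (set_ball \<delta> \<Gamma>) \<subseteq> set_ball \<epsilon> \<Gamma>)"

definition stable_closed :: "'a::euclidean_space hybrid_system \<Rightarrow> 'a set \<Rightarrow> bool" where
  "stable_closed H \<Gamma> \<longleftrightarrow>
     (\<forall>\<epsilon>>0. \<exists>U. open U \<and> \<Gamma> \<subseteq> U \<and> reachable_range H U \<subseteq> set_ball \<epsilon> \<Gamma>)"

definition basin_compact :: "'a::euclidean_space hybrid_system \<Rightarrow> 'a set \<Rightarrow> 'a set" where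
  "basin_compact H \<Gamma> = {p. \<forall>x\<in>max_solutions_from H {p}.
     bounded_arc x \<and> (complete_arc x \<longrightarrow> converges_to_set x \<Gamma>)}"

definition basin_closed :: "'a::euclidean_space hybrid_system \<Rightarrow> 'a set \<Rightarrow> 'a set" where
  "basin_closed H \<Gamma> = {p. \<forall>x\<in>max_solutions_from H {p}.
     (\<exists>c::real. \<forall>q\<in>ran x. set_distance \<Gamma> q \<le> ereal c) \<and>
     (complete_arc x \<longrightarrow> converges_to_set x \<Gamma>)}"

(* The two versions agree on nonempty compact sets. *)
definition stable_set :: "'a::euclidean_space hybrid_system \<Rightarrow> 'a set \<Rightarrow> bool" where
  "stable_set H \<Gamma> \<longleftrightarrow> (if compact \<Gamma> then stable_compact H \<Gamma> else stable_closed H \<Gamma>)"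

definition basin_of_attraction :: "'a::euclidean_space hybrid_system \<Rightarrow> 'a set \<Rightarrow> 'a set" where
  "basin_of_attraction H \<Gamma> = (if compact \<Gamma> then basin_compact H \<Gamma> else basin_closed H \<Gamma>)"

definition attractive :: "'a::euclidean_space hybrid_system \<Rightarrow> 'a set \<Rightarrow> bool" where
  "attractive H \<Gamma> \<longleftrightarrow> \<Gamma> \<subseteq> interior (basin_of_attraction H \<Gamma>)"

definition globally_attractive :: "'a::euclidean_space hybrid_system \<Rightarrow> 'a set \<Rightarrow> bool" where
  "globally_attractive H \<Gamma> \<longleftrightarrow> basin_of_attraction H \<Gamma> = UNIV"

definition asymptotically_stable :: "'a::euclidean_space hybrid_system \<Rightarrow> 'a set \<Rightarrow> bool" where
  "asymptotically_stable H \<Gamma> \<longleftrightarrow> stable_set H \<Gamma> \<and> attractive H \<Gamma>"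

definition globally_asymptotically_stable ::
    "'a::euclidean_space hybrid_system \<Rightarrow> 'a set \<Rightarrow> bool" where
  "globally_asymptotically_stable H \<Gamma> \<longleftrightarrow> stable_set H \<Gamma> \<and> globally_attractive H \<Gamma>"

definition asymptotically_stable_relative ::
    "'a::euclidean_space hybrid_system \<Rightarrow> 'a set \<Rightarrow> 'a set \<Rightarrow> bool" where
  "asymptotically_stable_relative H \<Gamma> \<Gamma>' \<longleftrightarrow>
     asymptotically_stable (restrict_system H \<Gamma>') \<Gamma>"

definition globally_asymptotically_stable_relative ::
    "'a::euclidean_space hybrid_system \<Rightarrow> 'a set \<Rightarrow> 'a set \<Rightarrow> bool" where
  "globally_asymptotically_stable_relative H \<Gamma> \<Gamma>' \<longleftrightarrow>
     globally_asymptotically_stable (restrict_system H \<Gamma>') \<Gamma>"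

end

(* By induction on i it suffices to treat two sets: if Gamma_1 is asymptotically stable relative to a
   closed set Gamma that is itself asymptotically stable, then Gamma_1 is asymptotically stable.
   Solutions of H that stay close to Gamma have limits that are solutions of the restriction of H to
   Gamma, because bounded sequences of solutions are graphically precompact. Failure of stability or of
   attractivity of Gamma_1 for H thus produces a solution of the restriction that leaves a neighbourhood
   of Gamma_1 or never comes close to it, contradicting the relative hypothesis. *)
theory Submission
  imports Defs "HOL-Library.Diagonal_Subsequence"
begin

section \<open>Lipschitz curves are differentiable almost everywhere\<close>

text \<open>The obstacle is that limits are taken along arcs whose domains vary and whose flow
  condition holds only almost everywhere. Domains are therefore stored as extended-real phase times,
  and the a.e. condition is used through mean value estimates for absolutely continuous curves:
  these control difference quotients uniformly and survive limits, whose derivatives exist because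
  the limits are Lipschitz. Two further gaps have to be closed. Precompactness needs boundedness: up
  to the exit from a bounded neighbourhood of \<open>\<Gamma>\<^sub>1\<close> it is automatic, and
  the exit point itself, possibly reached by a jump, is controlled by local boundedness of the jump
  map; in the global case it is assumption (ii'). Moreover, limits of segments need not be maximal,
  while the stability notions speak of maximal solutions; hence an extension result by Zorn's lemma.
  The set \<open>\<Gamma>\<close> may be unbounded, but its stability is applied only near the
  compact \<open>\<Gamma>\<^sub>1\<close>, where open neighbourhoods contain balls of uniform
  radius.\<close>

lemma lipschitz_mono_measure_ac:
  fixes g :: "real \<Rightarrow> real"
  assumes mono: "\<And>x y. x \<le> y \<Longrightarrow> g x \<le> g y"
    and lip: "\<And>x y. x \<le> y \<Longrightarrow> g y - g x \<le> L * (y - x)"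
  shows "continuous_on UNIV g" "absolutely_continuous lborel (interval_measure g)"
proof -
  have L0: "L \<ge> 0" using mono[of 0 1] lip[of 0 1] by simp
  show cont: "continuous_on UNIV g"
  proof (rule lipschitz_on_continuous_on)
    show "L-lipschitz_on UNIV g"
    proof (rule lipschitz_onI)
      fix x y :: real
      show "dist (g x) (g y) \<le> L * dist x y"
        using mono[of x y] mono[of y x] lip[of x y] lip[of y x]
        by (cases "x \<le> y") (auto simp: dist_real_def abs_if)
    qed (rule L0)
  qed
  \<comment> \<open>\<open>g'\<close> is increasing because \<open>g\<close> has Lipschitz constant
    \<open>L\<close>, and the Stieltjes measures of \<open>g\<close> and \<open>g'\<close> add up to
    \<open>L\<close> times Lebesgue measure. The measure of \<open>g\<close> is thus dominated by it
    and inherits its null sets.\<close>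
  define g' where "g' = (\<lambda>t. L * t - g t)"
  have cont': "continuous_on UNIV g'" unfolding g'_def by (intro continuous_intros cont)
  have mono': "g' x \<le> g' y" if "x \<le> y" for x y
    using lip[OF that] by (simp add: g'_def algebra_simps)
  have rc: "continuous (at_right a) g" "continuous (at_right a) g'" for a
    using cont cont' by (auto simp: continuous_on_eq_continuous_within intro: continuous_within_subset)
  have E: "emeasure (interval_measure g) {a<..b} + emeasure (interval_measure g') {a<..b}
         = ennreal L * emeasure lborel {a<..b}" for a b
  proof (cases "a \<le> b")
    case True
    have "g b - g a + (g' b - g' a) = L * (b - a)" by (simp add: g'_def algebra_simps)
    then show ?thesis
      using mono[OF True] mono'[OF True] True L0
      by (simp add: emeasure_interval_measure_Ioc mono mono' rc flip: ennreal_plus ennreal_mult)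
  qed simp
  \<comment> \<open>The sum is made a measure of its own so that its agreement with the scaled
    Lebesgue measure on half-open intervals extends to all Borel sets.\<close>
  define S where "S = measure_of UNIV (sets borel)
    (\<lambda>A. emeasure (interval_measure g) A + emeasure (interval_measure g') A)"
  have setsS: "sets S = sets (borel :: real measure)" 
    unfolding S_def using sets.sets_measure_of_eq[of "borel :: real measure"] by simp
  have emS: "emeasure S A = emeasure (interval_measure g) A + emeasure (interval_measure g') A"
    if "A \<in> sets borel" for A
    unfolding S_def
  proof (rule emeasure_measure_of_sigma)
    show "sigma_algebra UNIV (sets (borel :: real measure))"
      using sets.sigma_algebra_axioms[of "borel :: real measure"] by simp
    show "countably_additive (sets borel) (\<lambda>A. emeasure (interval_measure g) A + emeasure (interval_measure g') A)"
    proof (rule countably_additiveI)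
      fix X :: "nat \<Rightarrow> real set"
      assume X: "range X \<subseteq> sets borel" "disjoint_family X"
      have "(\<Sum>i. emeasure (interval_measure g) (X i) + emeasure (interval_measure g') (X i))
          = (\<Sum>i. emeasure (interval_measure g) (X i)) + (\<Sum>i. emeasure (interval_measure g') (X i))"
        by (rule suminf_add[symmetric]) auto
      then show "(\<Sum>i. emeasure (interval_measure g) (X i) + emeasure (interval_measure g') (X i))
          = emeasure (interval_measure g) (\<Union>(range X)) + emeasure (interval_measure g') (\<Union>(range X))"
        using X by (simp add: suminf_emeasure)
    qed
  qed (auto simp: positive_def that)
  have SE: "S = scale_measure (ennreal L) lborel"
  proof (rule measure_eqI_generator_eq[where E = "range (\<lambda>(a, b). {a<..b})" and \<Omega> = UNIV
        and A = "\<lambda>n. {- real n <.. real n}"])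
    show "Int_stable (range (\<lambda>(a, b). {a<..b::real}))"
      by (auto simp: Int_stable_def Int_greaterThanAtMost)
    show "sets S = sigma_sets UNIV (range (\<lambda>(a, b). {a<..b::real}))"
      unfolding setsS by (simp add: borel_sigma_sets_Ioc)
    then show "sets (scale_measure (ennreal L) lborel) = sigma_sets UNIV (range (\<lambda>(a, b). {a<..b::real}))"
      using setsS by simp
    show "(\<Union>i. {- real i<..real i}) = UNIV"
    proof safe
      fix x :: real
      obtain n where "\<bar>x\<bar> < real n" using reals_Archimedean2 by blast
      then show "x \<in> (\<Union>i. {- real i<..real i})" by (auto intro!: exI[of _ n])
    qed auto
    show "emeasure S {- real i<..real i} \<noteq> \<infinity>" for i
      by (simp add: emS E ennreal_mult_eq_top_iff)
  qed (auto simp: emS E)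
  show "absolutely_continuous lborel (interval_measure g)"
    unfolding absolutely_continuous_def
  proof
    fix A :: "real set" assume A: "A \<in> null_sets lborel"
    then have "emeasure S A = 0" "A \<in> sets borel" by (auto simp: SE)
    then show "A \<in> null_sets (interval_measure g)"
      using emS[of A] by auto
  qed
qed

text \<open>Radon--Nikodym turns the Lipschitz function into an indefinite integral, to which
  Lebesgue's differentiation theorem applies.\<close>

lemma lipschitz_mono_has_density:
  fixes g :: "real \<Rightarrow> real"
  assumes mono: "\<And>x y. x \<le> y \<Longrightarrow> g x \<le> g y"
    and lip: "\<And>x y. x \<le> y \<Longrightarrow> g y - g x \<le> L * (y - x)"
  obtains h where "\<And>a b. a \<le> b \<Longrightarrow> (h has_integral (g b - g a)) {a..b}"
proof -
  note ac = lipschitz_mono_measure_ac[OF mono lip]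
  have rc: "continuous (at_right a) g" for a
    using ac(1) by (auto simp: continuous_on_eq_continuous_within intro: continuous_within_subset)
  obtain k where k[measurable]: "k \<in> borel_measurable lborel" and dk: "density lborel k = interval_measure g"
    using sigma_finite_measure.Radon_Nikodym[OF lborel.sigma_finite_measure_axioms ac(2)] by auto
  have I: "(\<integral>\<^sup>+ x. k x * indicator {a<..b} x \<partial>lborel) = ennreal (g b - g a)" if "a \<le> b" for a b
  proof -
    have "(\<integral>\<^sup>+ x. k x * indicator {a<..b} x \<partial>lborel) = emeasure (density lborel k) {a<..b}"
      by (simp add: emeasure_density)
    also have "\<dots> = ennreal (g b - g a)"
      unfolding dk by (rule emeasure_interval_measure_Ioc) (auto simp: that mono rc)
    finally show ?thesis .
  qed
  have fin: "AE x in lborel. x \<in> {a<..b} \<longrightarrow> k x \<noteq> \<infinity>" if "a \<le> b" for a b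
  proof -
    have "AE x in lborel. k x * indicator {a<..b} x \<noteq> \<infinity>"
      by (rule nn_integral_PInf_AE) (auto simp: I that)
    then show ?thesis by eventually_elim (auto simp: indicator_def)
  qed
  have hint: "((\<lambda>x. enn2real (k x)) has_integral (g b - g a)) {a..b}" if ab: "a \<le> b" for a b
  proof -
    have "((\<lambda>x. enn2real (k x) * indicator {a<..b} x) has_integral (g b - g a)) UNIV"
    proof (rule nn_integral_has_integral)
      have "(\<integral>\<^sup>+ x. ennreal (enn2real (k x) * indicator {a<..b} x) \<partial>lborel) 
          = (\<integral>\<^sup>+ x. k x * indicator {a<..b} x \<partial>lborel)"
        using fin[OF ab] by (intro nn_integral_cong_AE) (auto elim!: eventually_mono simp: indicator_def less_top)
      then show "(\<integral>\<^sup>+ x. ennreal (enn2real (k x) * indicator {a<..b} x) \<partial>lborel) = ennreal (g b - g a)"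
        using I[OF ab] by simp
    qed (use k mono[OF ab] in \<open>auto\<close>)
    then have "((\<lambda>x. if x \<in> {a<..b} then enn2real (k x) else 0) has_integral (g b - g a)) UNIV"
      by (rule has_integral_eq[rotated]) (auto simp: indicator_def)
    then have "((\<lambda>x. enn2real (k x)) has_integral (g b - g a)) {a<..b}"
      by (simp only: has_integral_restrict_UNIV)
    then show ?thesis
      by (subst has_integral_spike_set_eq[of _ "{a<..b}"]) (auto intro: negligible_subset[of "{a}"])
  qed
  show thesis by (rule that) (rule hint)
qed

lemma negligible_uminus_image:
  fixes N :: "real set"
  assumes "negligible N"
  shows "negligible (uminus ` N)"
  using assms
  by (rule negligible_differentiable_image_negligible[OF order_refl])
     (auto simp: differentiable_on_def intro!: derivative_intros)

text \<open>Lebesgue's differentiation theorem enters in a form that averages only over intervals to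
  the right of the point. Applying it to the reflected density as well gives the left-hand
  quotients, and both together the two-sided derivative.\<close>

lemma indefinite_integral_has_derivative_ae:
  fixes g h :: "real \<Rightarrow> real"
  assumes int: "\<And>a b. a \<le> b \<Longrightarrow> (h has_integral (g b - g a)) {a..b}"
  obtains N where "negligible N" "\<And>x. x \<notin> N \<Longrightarrow> (g has_real_derivative h x) (at x)"
proof -
  have intg: "h integrable_on cbox a b" for a b :: real
    using int[of a b] by (cases "a \<le> b") (auto intro: has_integral_integrable)
  obtain N1 where N1: "negligible N1"
    "\<And>x e. \<lbrakk>x \<notin> N1; 0 < e\<rbrakk> \<Longrightarrow> \<exists>d>0. \<forall>t. 0 < t \<and> t < d \<longrightarrow>
        norm (integral (cbox x (x + t *\<^sub>R One)) h /\<^sub>R t ^ DIM(real) - h x) < e"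
    by (rule integrable_ccontinuous_explicit[of h]) (use intg in auto)
  have int': "((\<lambda>x. h (- x)) has_integral (g (- a) - g (- b))) {a..b}" if "a \<le> b" for a b
    using int[of "- b" "- a"] that by (subst has_integral_reflect_real[symmetric]) auto
  have intg': "(\<lambda>x. h (- x)) integrable_on cbox a b" for a b :: real
    using int'[of a b] by (cases "a \<le> b") (auto intro: has_integral_integrable)
  obtain N2 where N2: "negligible N2"
    "\<And>x e. \<lbrakk>x \<notin> N2; 0 < e\<rbrakk> \<Longrightarrow> \<exists>d>0. \<forall>t. 0 < t \<and> t < d \<longrightarrow>
        norm (integral (cbox x (x + t *\<^sub>R One)) (\<lambda>x. h (- x)) /\<^sub>R t ^ DIM(real) - h (- x)) < e"
    by (rule integrable_ccontinuous_explicit[of "\<lambda>x. h (- x)"]) (use intg' in auto)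
  show thesis
  proof (rule that)
    show "negligible (N1 \<union> uminus ` N2)"
      using N1(1) N2(1) by (intro negligible_Un negligible_uminus_image)
    fix x assume x: "x \<notin> N1 \<union> uminus ` N2"
    then have x2: "- x \<notin> N2" by force
    show "(g has_real_derivative h x) (at x)"
      unfolding has_field_derivative_iff LIM_def
    proof (intro allI impI)
      fix e :: real assume e: "0 < e"
      obtain d1 where d1: "d1 > 0" "\<And>t. 0 < t \<Longrightarrow> t < d1 \<Longrightarrow> \<bar>(g (x + t) - g x) / t - h x\<bar> < e"
      proof -
        obtain d where d: "d > 0" "\<And>t. 0 < t \<Longrightarrow> t < d \<Longrightarrow>
            norm (integral (cbox x (x + t *\<^sub>R One)) h /\<^sub>R t ^ DIM(real) - h x) < e"
          using N1(2)[of x e] x e by blast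
        have "\<bar>(g (x + t) - g x) / t - h x\<bar> < e" if t: "0 < t" "t < d" for t
          using d(2)[OF t] integral_unique[OF int[of x "x + t"]] t
          by (simp add: divide_inverse mult.commute)
        with d(1) show thesis by (rule that)
      qed
      obtain d2 where d2: "d2 > 0" "\<And>t. 0 < t \<Longrightarrow> t < d2 \<Longrightarrow> \<bar>(g x - g (x - t)) / t - h x\<bar> < e"
      proof -
        obtain d where d: "d > 0" "\<And>t. 0 < t \<Longrightarrow> t < d \<Longrightarrow>
            norm (integral (cbox (- x) (- x + t *\<^sub>R One)) (\<lambda>x. h (- x)) /\<^sub>R t ^ DIM(real) - h (- (- x))) < e"
          using N2(2)[of "- x" e] x2 e by blast
        have "\<bar>(g x - g (x - t)) / t - h x\<bar> < e" if t: "0 < t" "t < d" for t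
          using d(2)[OF t] integral_unique[OF int'[of "- x" "- x + t"]] t
          by (simp add: divide_inverse mult.commute)
        with d(1) show thesis by (rule that)
      qed
      show "\<exists>s>0. \<forall>xa. xa \<noteq> x \<and> dist xa x < s \<longrightarrow> dist ((g xa - g x) / (xa - x)) (h x) < e"
      proof (intro exI[of _ "min d1 d2"] conjI allI impI)
        fix y assume y: "y \<noteq> x \<and> dist y x < min d1 d2"
        show "dist ((g y - g x) / (y - x)) (h x) < e"
        proof (cases "x < y")
          case True
          then show ?thesis using d1(2)[of "y - x"] y by (auto simp: dist_real_def)
        next
          case False
          have "(g x - g y) / (x - y) = (g y - g x) / (y - x)"
            by (metis minus_diff_eq minus_divide_divide)
          then show ?thesis using False d2(2)[of "x - y"] y by (auto simp: dist_real_def)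
        qed
      qed (use d1 d2 in auto)
    qed
  qed
qed

text \<open>Adding \<open>L * t\<close> makes an \<open>L\<close>-Lipschitz function increasing and
  \<open>2 * L\<close>-Lipschitz, hence the indefinite integral of a density; subtracting the linear
  term again keeps differentiability.\<close>

lemma lipschitz_differentiable_ae_real:
  fixes f :: "real \<Rightarrow> real"
  assumes lip: "\<And>x y. \<bar>f y - f x\<bar> \<le> L * \<bar>y - x\<bar>"
  obtains N where "negligible N" "\<And>x. x \<notin> N \<Longrightarrow> f differentiable (at x)"
proof -
  define g where "g = (\<lambda>t. f t + L * t)"
  have "g x \<le> g y" if "x \<le> y" for x y
    using lip[of x y] that by (auto simp: g_def algebra_simps abs_if split: if_splits)
  moreover have "g y - g x \<le> (2 * L) * (y - x)" if "x \<le> y" for x y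
    using lip[of x y] that by (auto simp: g_def algebra_simps abs_if split: if_splits)
  ultimately obtain h where h: "\<And>a b. a \<le> b \<Longrightarrow> (h has_integral (g b - g a)) {a..b}"
    using lipschitz_mono_has_density[of g "2 * L"] by metis
  obtain N where N: "negligible N" "\<And>x. x \<notin> N \<Longrightarrow> (g has_real_derivative h x) (at x)"
    using indefinite_integral_has_derivative_ae[OF h] by blast
  have "f differentiable (at x)" if "x \<notin> N" for x
  proof -
    have "((\<lambda>t. g t - L * t) has_real_derivative (h x - L)) (at x)"
      by (auto intro!: derivative_eq_intros N(2)[OF that])
    then show ?thesis
      by (auto simp: g_def real_differentiable_def)
  qed
  with N(1) show thesis by (rule that)
qed

text \<open>A limit of solution phases is known only to be Lipschitz; this supplies the derivatives
  that the flow inclusion asks for. Coordinates are treated separately, and finitely many null sets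
  are united.\<close>

lemma lipschitz_differentiable_ae:
  fixes f :: "real \<Rightarrow> 'a::euclidean_space"
  assumes lip: "\<And>x y. norm (f y - f x) \<le> L * \<bar>y - x\<bar>"
  shows "AE t in lebesgue. \<exists>v. (f has_vector_derivative v) (at t)"
proof -
  have "\<exists>N. negligible N \<and> (\<forall>t. t \<notin> N \<longrightarrow> (\<lambda>s. f s \<bullet> b) differentiable (at t))" if b: "b \<in> Basis" for b
  proof -
    have "\<bar>f y \<bullet> b - f x \<bullet> b\<bar> \<le> L * \<bar>y - x\<bar>" for x y
      using Basis_le_norm[OF b, of "f y - f x"] lip[where x=x and y=y] by (simp add: inner_diff_left)
    from lipschitz_differentiable_ae_real[OF this] show ?thesis by metis
  qed
  then obtain N where N: "\<And>b. b \<in> Basis \<Longrightarrow> negligible (N b)"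
    "\<And>b t. b \<in> Basis \<Longrightarrow> t \<notin> N b \<Longrightarrow> (\<lambda>s. f s \<bullet> b) differentiable (at t)" by metis
  have "negligible (\<Union>b\<in>Basis. N b)" by (rule negligible_Union) (auto simp: N)
  moreover have "\<exists>v. (f has_vector_derivative v) (at t)" if "t \<notin> (\<Union>b\<in>Basis. N b)" for t
    using that N(2) differentiable_componentwise_within[of f t UNIV]
    by (auto simp: vector_derivative_works)
  ultimately show ?thesis
    by (intro AE_I'[of "\<Union>b\<in>Basis. N b"]) (auto simp: negligible_iff_null_sets)
qed

section \<open>Absolutely continuous curves\<close>

definition short_family :: "real \<Rightarrow> real \<Rightarrow> real \<Rightarrow> (real \<times> real) set \<Rightarrow> bool" where
  "short_family a b \<delta> P \<longleftrightarrow> finite P \<and> (\<forall>(u, v)\<in>P. a \<le> u \<and> u \<le> v \<and> v \<le> b) \<and>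
     disjoint_family_on (\<lambda>(u, v). {u<..<v}) P \<and> (\<Sum>(u, v)\<in>P. v - u) < \<delta>"

lemma ac_iff_short_family:
  "absolutely_continuous_on_interval a b f \<longleftrightarrow>
     (\<forall>\<epsilon>>0. \<exists>\<delta>>0. \<forall>P. short_family a b \<delta> P \<longrightarrow> (\<Sum>(u, v)\<in>P. norm (f v - f u)) < \<epsilon>)"
  by (simp add: absolutely_continuous_on_interval_def short_family_def)

lemma ac_pair:
  assumes "absolutely_continuous_on_interval a b f" "\<epsilon> > 0"
  obtains \<delta> where "\<delta> > 0" "\<And>s t. a \<le> s \<Longrightarrow> s \<le> t \<Longrightarrow> t \<le> b \<Longrightarrow> t - s < \<delta> \<Longrightarrow> norm (f t - f s) < \<epsilon>"
proof -
  obtain \<delta> where d: "\<delta> > 0" "\<And>P. short_family a b \<delta> P \<Longrightarrow> (\<Sum>(u, v)\<in>P. norm (f v - f u)) < \<epsilon>"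
    using assms unfolding ac_iff_short_family by meson
  have "norm (f t - f s) < \<epsilon>" if "a \<le> s" "s \<le> t" "t \<le> b" "t - s < \<delta>" for s t
    using d(2)[of "{(s, t)}"] that by (simp add: short_family_def disjoint_family_on_def)
  with d(1) show thesis by (rule that)
qed

lemma ac_imp_continuous_on:
  assumes "absolutely_continuous_on_interval a b f"
  shows "continuous_on {a..b} f"
  unfolding continuous_on_iff
proof (intro ballI allI impI)
  fix x e :: real assume x: "x \<in> {a..b}" and e: "0 < e"
  obtain d where d: "d > 0" "\<And>s t. a \<le> s \<Longrightarrow> s \<le> t \<Longrightarrow> t \<le> b \<Longrightarrow> t - s < d \<Longrightarrow> norm (f t - f s) < e"
    using ac_pair[OF assms e] by blast
  have "dist (f y) (f x) < e" if "y \<in> {a..b}" "dist y x < d" for y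
    using d(2)[of x y] d(2)[of y x] that x
    by (cases "x \<le> y") (auto simp: dist_norm norm_minus_commute)
  with d(1) show "\<exists>d>0. \<forall>x'\<in>{a..b}. dist x' x < d \<longrightarrow> dist (f x') (f x) < e" by blast
qed

lemma lipschitz_imp_ac:
  fixes f :: "real \<Rightarrow> 'a::real_normed_vector"
  assumes lip: "\<And>s t. a \<le> s \<Longrightarrow> s \<le> t \<Longrightarrow> t \<le> b \<Longrightarrow> norm (f t - f s) \<le> M * (t - s)"
  shows "absolutely_continuous_on_interval a b f"
  unfolding ac_iff_short_family
proof (intro allI impI)
  fix e :: real assume e: "e > 0"
  define d where "d = e / (\<bar>M\<bar> + 1)"
  have "d > 0" using e by (simp add: d_def)
  moreover have "(\<Sum>(u, v)\<in>P. norm (f v - f u)) < e"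
    if P: "finite P" "\<forall>(u, v)\<in>P. a \<le> u \<and> u \<le> v \<and> v \<le> b" "(\<Sum>(u, v)\<in>P. v - u) < d"
    for P
  proof -
    have le: "norm (f v - f u) \<le> (\<bar>M\<bar> + 1) * (v - u)" if "(u, v) \<in> P" for u v
    proof -
      have "norm (f v - f u) \<le> M * (v - u)" "u \<le> v" using lip[of u v] P(2) that by auto
      moreover have "M * (v - u) \<le> (\<bar>M\<bar> + 1) * (v - u)" using \<open>u \<le> v\<close> by (intro mult_right_mono) auto
      ultimately show ?thesis by linarith
    qed
    have "(\<Sum>(u, v)\<in>P. norm (f v - f u)) \<le> (\<Sum>(u, v)\<in>P. (\<bar>M\<bar> + 1) * (v - u))"
      by (intro sum_mono) (use le in auto)
    also have "\<dots> = (\<bar>M\<bar> + 1) * (\<Sum>(u, v)\<in>P. v - u)"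
      by (simp add: sum_distrib_left case_prod_unfold)
    also have "\<dots> < (\<bar>M\<bar> + 1) * d" using P(3) by (intro mult_strict_left_mono) auto
    also have "\<dots> = e" by (simp add: d_def)
    finally show ?thesis .
  qed
  ultimately show "\<exists>\<delta>>0. \<forall>P. short_family a b \<delta> P \<longrightarrow> (\<Sum>(u, v)\<in>P. norm (f v - f u)) < e"
    unfolding short_family_def by blast
qed

lemma ac_shift:
  assumes "absolutely_continuous_on_interval (a + c) (b + c) f"
  shows "absolutely_continuous_on_interval a b (\<lambda>t. f (t + c))"
  unfolding ac_iff_short_family
proof (intro allI impI)
  fix e :: real assume "e > 0"
  with assms(1) obtain \<delta> where d: "\<delta> > 0" "\<And>P. short_family (a + c) (b + c) \<delta> P \<Longrightarrow> (\<Sum>(u, v)\<in>P. norm (f v - f u)) < e"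
    unfolding ac_iff_short_family by meson
  have "(\<Sum>(u, v)\<in>P. norm (f (v + c) - f (u + c))) < e"
    if P: "finite P" "\<forall>(u, v)\<in>P. a \<le> u \<and> u \<le> v \<and> v \<le> b"
      "disjoint_family_on (\<lambda>(u, v). {u<..<v}) P" "(\<Sum>(u, v)\<in>P. v - u) < \<delta>" for P
  proof -
    define h where "h = (\<lambda>(u, v). (u + c, v + c))"
    have inj: "inj_on h P" by (auto simp: inj_on_def h_def)
    have "disjoint_family_on (\<lambda>(u, v). {u<..<v}) (h ` P)"
      unfolding disjoint_family_on_def
    proof (intro ballI impI)
      fix p q assume pq: "p \<in> h ` P" "q \<in> h ` P" "p \<noteq> q"
      then obtain u v u' v' where uv: "(u, v) \<in> P" "p = (u + c, v + c)" "(u', v') \<in> P" "q = (u' + c, v' + c)"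
        by (auto simp: h_def)
      with pq P(3) have "{u<..<v} \<inter> {u'<..<v'} = {}"
        unfolding disjoint_family_on_def by fastforce
      then show "(case p of (u, v) \<Rightarrow> {u<..<v}) \<inter> (case q of (u, v) \<Rightarrow> {u<..<v}) = {}"
        unfolding uv by (auto simp: set_eq_iff) (metis add_less_cancel_right diff_add_cancel)
    qed
    moreover have "(\<Sum>(u, v)\<in>h ` P. v - u) = (\<Sum>(u, v)\<in>P. v - u)"
      by (subst sum.reindex[OF inj]) (simp add: h_def case_prod_unfold)
    moreover have "\<forall>(u, v)\<in>h ` P. a + c \<le> u \<and> u \<le> v \<and> v \<le> b + c"
      using P(2) by (auto simp: h_def)
    ultimately have "(\<Sum>(u, v)\<in>h ` P. norm (f v - f u)) < e"
      using P by (intro d(2)) (simp add: short_family_def)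
    then show ?thesis using inj by (simp add: sum.reindex h_def case_prod_unfold)
  qed
  with d(1) show "\<exists>\<delta>>0. \<forall>P. short_family a b \<delta> P \<longrightarrow> (\<Sum>(u, v)\<in>P. norm (f (v + c) - f (u + c))) < e"
    unfolding short_family_def by blast
qed

text \<open>The term with \<open>D\<close> admits a Lipschitz function of time added to a transform
  of \<open>f\<close>, as in the tilted function of the mean value estimate below. It is absorbed by
  also keeping the total length of the intervals below \<open>e / (2 * D)\<close>.\<close>

lemma ac_compose_lipschitz:
  assumes ac: "absolutely_continuous_on_interval a b f"
    and h: "\<And>s t. a \<le> s \<Longrightarrow> s \<le> t \<Longrightarrow> t \<le> b \<Longrightarrow> norm (g t - g s) \<le> C * norm (f t - f s) + D * (t - s)"
    and CD: "C > 0" "D > 0"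
  shows "absolutely_continuous_on_interval a b g"
  unfolding ac_iff_short_family
proof (intro allI impI)
  fix e :: real assume e: "e > 0"
  with CD have "e / (2 * C) > 0" by simp
  with ac obtain \<delta> where d: "\<delta> > 0" "\<And>P. short_family a b \<delta> P \<Longrightarrow> (\<Sum>(u, v)\<in>P. norm (f v - f u)) < e / (2 * C)"
    unfolding ac_iff_short_family by meson
  define \<eta> where "\<eta> = min \<delta> (e / (2 * D))"
  have "\<eta> > 0" using d(1) e CD by (simp add: \<eta>_def)
  moreover have "(\<Sum>(u, v)\<in>P. norm (g v - g u)) < e"
    if P: "finite P" "\<forall>(u, v)\<in>P. a \<le> u \<and> u \<le> v \<and> v \<le> b"
      "disjoint_family_on (\<lambda>(u, v). {u<..<v}) P" "(\<Sum>(u, v)\<in>P. v - u) < \<eta>" for P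
  proof -
    have "(\<Sum>(u, v)\<in>P. norm (g v - g u)) \<le> (\<Sum>(u, v)\<in>P. C * norm (f v - f u) + D * (v - u))"
      using P(2) h by (intro sum_mono) force
    also have "\<dots> = C * (\<Sum>(u, v)\<in>P. norm (f v - f u)) + D * (\<Sum>(u, v)\<in>P. v - u)"
      by (simp add: sum_distrib_left case_prod_unfold sum.distrib)
    also have "\<dots> < C * (e / (2 * C)) + D * (e / (2 * D))"
      using P CD d(2)[of P] unfolding short_family_def by (intro add_strict_mono mult_strict_left_mono) (auto simp: \<eta>_def)
    also have "\<dots> = e" using CD by simp
    finally show ?thesis .
  qed
  ultimately show "\<exists>\<delta>>0. \<forall>P. short_family a b \<delta> P \<longrightarrow> (\<Sum>(u, v)\<in>P. norm (g v - g u)) < e"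
    unfolding short_family_def by blast
qed

lemma ac_transform:
  assumes "absolutely_continuous_on_interval a b f"
    and "\<And>t. a \<le> t \<Longrightarrow> t \<le> b \<Longrightarrow> g t = f t"
  shows "absolutely_continuous_on_interval a b g"
  by (rule ac_compose_lipschitz[OF assms(1), of g 1 1]) (auto simp: assms(2))

text \<open>Cover the exceptional null set by an open \<open>U\<close> of small measure; bisection (\<open>Bolzano\<close>)
  splits the interval into pieces inside \<open>U\<close>, controlled by absolute continuity, and pieces on
  which the derivative controls the increment.\<close>

lemma ac_deriv_nonpos_imp_antimono:
  fixes f :: "real \<Rightarrow> real"
  assumes ac: "absolutely_continuous_on_interval a b f" and ab: "a \<le> b"
    and der: "AE t in lebesgue. a < t \<and> t < b \<longrightarrow> (\<exists>v\<le>0. (f has_real_derivative v) (at t))"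
  shows "f b \<le> f a"
proof -
  have key: "f b - f a \<le> \<epsilon> * (b - a) + \<epsilon>" if e: "\<epsilon> > 0" for \<epsilon>
  proof -
    obtain \<delta> where d: "\<delta> > 0" "\<And>P. short_family a b \<delta> P \<Longrightarrow> (\<Sum>(u, v)\<in>P. norm (f v - f u)) < \<epsilon>"
      using ac e unfolding ac_iff_short_family by meson
    obtain N where N: "{t \<in> space lebesgue. \<not> (a < t \<and> t < b \<longrightarrow> (\<exists>v\<le>0. (f has_real_derivative v) (at t)))} \<subseteq> N"
      "N \<in> null_sets lebesgue"
      using der unfolding eventually_ae_filter by blast
    \<comment> \<open>The endpoints join the exceptional set because a two-sided derivative is
      assumed only inside the open interval.\<close>
    define N' where "N' = N \<union> {a, b}"
    have "{a, b} \<in> null_sets lebesgue"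
      by (simp add: negligible_iff_null_sets[symmetric] negligible_finite)
    then have N'0: "N' \<in> null_sets lebesgue"
      unfolding N'_def using N(2) by (rule null_sets.Un[rotated])
    have N'1: "\<exists>v\<le>0. (f has_real_derivative v) (at t)" if "a \<le> t" "t \<le> b" "t \<notin> N'" for t
    proof -
      have "a < t" "t < b" "t \<notin> N" using that by (auto simp: N'_def less_le)
      with N(1) show ?thesis by auto
    qed
    note N' = N'0 N'1
    obtain U where U: "open U" "N' \<subseteq> U" "emeasure lebesgue (U - N') < ennreal \<delta>"
      using sets_lebesgue_outer_open[of N' \<delta>] N'(1) d(1) by (metis null_setsD2)
    have Us[measurable]: "U \<in> sets lebesgue" using U(1) by auto
    have "emeasure lebesgue U = emeasure lebesgue (U - N')"
      using N'(1) by (simp add: emeasure_Diff_null_set)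
    with U have Um: "emeasure lebesgue U < ennreal \<delta>" by simp
    \<comment> \<open>\<open>P\<close> lists the pieces of a subdivision of \<open>[u, v]\<close>
      whose increments are charged to \<open>U\<close>; all other pieces are charged to the slope
      \<open>\<epsilon>\<close>. Requiring \<open>u' < v'\<close> makes the families of two adjacent
      intervals disjoint as sets, so that their sums add up.\<close>
    define Q where "Q u v P \<longleftrightarrow> finite P \<and> (\<forall>(u', v')\<in>P. u \<le> u' \<and> u' < v' \<and> v' \<le> v \<and> {u'..v'} \<subseteq> U) \<and>
        disjoint_family_on (\<lambda>(u, v). {u<..<v}) P \<and>
        f v - f u \<le> \<epsilon> * (v - u) + (\<Sum>(u, v)\<in>P. \<bar>f v - f u\<bar>)" for u v P
    define R where "R u v \<longleftrightarrow> (a \<le> u \<and> v \<le> b \<and> u \<le> v \<longrightarrow> (\<exists>P. Q u v P))" for u v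
    have "R a b" using ab
    proof (induct rule: Bolzano)
      case (trans x y z)
      show ?case unfolding R_def
      proof (intro impI)
        assume h: "a \<le> x \<and> z \<le> b \<and> x \<le> z"
        obtain P1 P2 where P: "Q x y P1" "Q y z P2"
          using trans h unfolding R_def by auto
        have disj: "P1 \<inter> P2 = {}"
        proof safe
          fix u v assume "(u, v) \<in> P1" "(u, v) \<in> P2"
          then have "v \<le> y" "y \<le> u" "u < v" using P unfolding Q_def by fastforce+
          then show "(u, v) \<in> {}" by simp
        qed
        have "Q x z (P1 \<union> P2)"
          unfolding Q_def
        proof (intro conjI)
          show "finite (P1 \<union> P2)" using P by (auto simp: Q_def)
          show "\<forall>(u', v')\<in>P1 \<union> P2. x \<le> u' \<and> u' < v' \<and> v' \<le> z \<and> {u'..v'} \<subseteq> U"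
            using P trans(3,4) unfolding Q_def by fastforce
          show "disjoint_family_on (\<lambda>(u, v). {u<..<v}) (P1 \<union> P2)"
            unfolding disjoint_family_on_def
          proof (intro ballI impI)
            fix p q assume pq: "p \<in> P1 \<union> P2" "q \<in> P1 \<union> P2" "p \<noteq> q"
            have A: "fst p < snd p" "snd p \<le> y" if "p \<in> P1" for p using P(1) that unfolding Q_def by force+
            have B: "y \<le> fst p" if "p \<in> P2" for p using P(2) that unfolding Q_def by force
            have D: "disjoint_family_on (\<lambda>(u, v). {u<..<v}) P1" "disjoint_family_on (\<lambda>(u, v). {u<..<v}) P2"
              using P unfolding Q_def by auto
            consider "p \<in> P1" "q \<in> P1" | "p \<in> P2" "q \<in> P2" | "p \<in> P1" "q \<in> P2" | "p \<in> P2" "q \<in> P1"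
              using pq by blast
            then show "(case p of (u, v) \<Rightarrow> {u<..<v}) \<inter> (case q of (u, v) \<Rightarrow> {u<..<v}) = {}"
            proof cases
              case 1 then show ?thesis using D(1) pq(3) unfolding disjoint_family_on_def by blast
            next
              case 2 then show ?thesis using D(2) pq(3) unfolding disjoint_family_on_def by blast
            next
              case 3 then show ?thesis using A[of p] B[of q] by (auto split: prod.splits)
            next
              case 4 then show ?thesis using A[of q] B[of p] by (auto split: prod.splits)
            qed
          qed
          have "f z - f x = (f z - f y) + (f y - f x)" by simp
          also have "\<dots> \<le> (\<epsilon> * (z - y) + (\<Sum>(u, v)\<in>P2. \<bar>f v - f u\<bar>)) + (\<epsilon> * (y - x) + (\<Sum>(u, v)\<in>P1. \<bar>f v - f u\<bar>))"
            using P unfolding Q_def by (intro add_mono) auto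
          also have "\<dots> = \<epsilon> * (z - x) + (\<Sum>(u, v)\<in>P1 \<union> P2. \<bar>f v - f u\<bar>)"
            using P disj unfolding Q_def by (subst sum.union_disjoint) (auto simp: algebra_simps)
          finally show "f z - f x \<le> \<epsilon> * (z - x) + (\<Sum>(u, v)\<in>P1 \<union> P2. \<bar>f v - f u\<bar>)" .
        qed
        then show "\<exists>P. Q x z P" by blast
      qed
    next
      case (local x)
      show ?case
      proof (cases "x \<in> N'")
        case True
        then obtain d where d: "d > 0" "ball x d \<subseteq> U" using U by (meson openE subsetD)
        have "R u v" if "u \<le> x" "x \<le> v" "v - u < d" for u v
        proof (cases "u = v")
          case True
          then have "Q u v {}" by (auto simp: Q_def disjoint_family_on_def)
          then show ?thesis unfolding R_def by blast
        next
          case False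
          have "{u..v} \<subseteq> ball x d" using that by (auto simp: dist_real_def)
          moreover have "f v - f u \<le> \<epsilon> * (v - u) + \<bar>f v - f u\<bar>"
            using that e mult_nonneg_nonneg[of \<epsilon> "v - u"] by linarith
          ultimately have "Q u v {(u, v)}" using d False that by (auto simp: Q_def disjoint_family_on_def)
          then show ?thesis unfolding R_def by blast
        qed
        then show ?thesis by (intro exI[of _ d] conjI d(1) allI impI) auto
      next
        case False
        then obtain D where D: "D \<le> 0" "(f has_real_derivative D) (at x)" using N'(2)[OF local(1,2) False] by auto
        then have "((\<lambda>h. (f (x + h) - f x) / h) \<longlongrightarrow> D) (at 0)" by (simp add: DERIV_def)
        from LIM_D[OF this e] obtain d where d: "d > 0"
          "\<And>h. h \<noteq> 0 \<Longrightarrow> \<bar>h\<bar> < d \<Longrightarrow> \<bar>(f (x + h) - f x) / h - D\<bar> < \<epsilon>"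
          by (metis diff_zero real_norm_def)
        have q: "(f (x + h) - f x) / h \<le> \<epsilon>" if "h \<noteq> 0" "\<bar>h\<bar> < d" for h
          using d(2)[OF that] D(1) by linarith
        have "R u v" if "u \<le> x" "x \<le> v" "v - u < d" for u v
        proof -
          have "f v - f x \<le> \<epsilon> * (v - x)"
            using q[of "v - x"] that by (cases "x = v") (auto simp: field_simps)
          moreover have "f x - f u \<le> \<epsilon> * (x - u)"
            using q[of "u - x"] that by (cases "x = u") (auto simp: field_simps)
          ultimately have "Q u v {}" by (auto simp: Q_def disjoint_family_on_def algebra_simps)
          then show ?thesis unfolding R_def by blast
        qed
        then show ?thesis by (intro exI[of _ d] conjI d(1) allI impI) auto
      qed
    qed
    then obtain P where P: "Q a b P" using ab unfolding R_def by auto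
    have fin: "finite P" and dis: "disjoint_family_on (\<lambda>p. {fst p<..<snd p}) P"
      using P unfolding Q_def by (auto simp: case_prod_unfold)
    have lt: "a \<le> fst p" "fst p < snd p" "snd p \<le> b" "{fst p..snd p} \<subseteq> U" if "p \<in> P" for p
      using P that unfolding Q_def by (auto simp: case_prod_unfold)
    \<comment> \<open>The pieces are non-overlapping and lie in \<open>U\<close>, so their total
      length is below \<open>\<delta>\<close>, and absolute continuity applies to them as one
      family.\<close>
    have "ennreal (\<Sum>p\<in>P. snd p - fst p) = (\<Sum>p\<in>P. ennreal (snd p - fst p))"
      by (rule sum_ennreal[symmetric]) (use lt in \<open>auto intro: less_imp_le\<close>)
    also have "\<dots> = (\<Sum>p\<in>P. emeasure lebesgue {fst p<..<snd p})"
      by (rule sum.cong) (simp_all add: less_imp_le[OF lt(2)])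
    also have "\<dots> = emeasure lebesgue (\<Union>p\<in>P. {fst p<..<snd p})"
      by (rule sum_emeasure) (auto simp: dis fin)
    also have "\<dots> \<le> emeasure lebesgue U"
    proof (intro emeasure_mono Us UN_least)
      fix p assume "p \<in> P"
      then show "{fst p<..<snd p} \<subseteq> U" using lt(4)[of p] by (auto simp: subset_iff)
    qed
    also have "\<dots> < ennreal \<delta>" by (rule Um)
    finally have "(\<Sum>p\<in>P. snd p - fst p) < \<delta>"
      using d(1) by (simp add: ennreal_less_iff sum_nonneg lt less_imp_le)
    then have "(\<Sum>(u, v)\<in>P. norm (f v - f u)) < \<epsilon>"
      using fin dis lt by (intro d(2)) (auto simp: short_family_def case_prod_unfold less_imp_le)
    with P show ?thesis unfolding Q_def by simp
  qed
  show ?thesis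
  proof (rule field_le_epsilon)
    fix e :: real assume "e > 0"
    with key[of "e / (b - a + 1)"] ab have "f b - f a \<le> e / (b - a + 1) * (b - a) + e / (b - a + 1)" by simp
    also have "\<dots> = e / (b - a + 1) * (b - a + 1)" by (simp only: distrib_left mult_1_right)
    also have "\<dots> = e" using ab by simp
    finally show "f b \<le> f a + e" by simp
  qed
qed

text \<open>The monotonicity result is applied to the tilted function
  \<open>w \<bullet> f t - c * t\<close>, whose derivative is nonpositive almost everywhere.\<close>

lemma ac_mean_value_inner:
  fixes f :: "real \<Rightarrow> 'a::euclidean_space"
  assumes ac: "absolutely_continuous_on_interval a b f" and ab: "a \<le> b"
    and der: "AE t in lebesgue. a < t \<and> t < b \<longrightarrow> (\<exists>v. w \<bullet> v \<le> c \<and> (f has_vector_derivative v) (at t))"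
  shows "w \<bullet> (f b - f a) \<le> c * (b - a)"
proof -
  define g where "g t = w \<bullet> f t - c * t" for t
  have "absolutely_continuous_on_interval a b g"
  proof (rule ac_compose_lipschitz[OF ac])
    fix s t assume st: "a \<le> s" "s \<le> t" "t \<le> b"
    have "norm (g t - g s) = \<bar>w \<bullet> (f t - f s) - c * (t - s)\<bar>"
      by (simp add: g_def inner_diff_right algebra_simps)
    also have "\<dots> \<le> norm w * norm (f t - f s) + \<bar>c\<bar> * (t - s)"
      using Cauchy_Schwarz_ineq2[of w "f t - f s"] st abs_mult[of c "t - s"] by linarith
    also have "\<dots> \<le> (norm w + 1) * norm (f t - f s) + (\<bar>c\<bar> + 1) * (t - s)"
      using st by (intro add_mono mult_right_mono) auto
    finally show "norm (g t - g s) \<le> (norm w + 1) * norm (f t - f s) + (\<bar>c\<bar> + 1) * (t - s)" .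
  qed (simp_all add: add_nonneg_pos)
  moreover have "AE t in lebesgue. a < t \<and> t < b \<longrightarrow> (\<exists>v\<le>0. (g has_real_derivative v) (at t))"
    using der
  proof eventually_elim
    case (elim t)
    show ?case
    proof
      assume "a < t \<and> t < b"
      with elim obtain v where v: "w \<bullet> v \<le> c" "(f has_vector_derivative v) (at t)" by blast
      have "((\<lambda>t. w \<bullet> f t) has_vector_derivative (w \<bullet> v)) (at t)"
        by (rule bounded_linear.has_vector_derivative[OF bounded_linear_inner_right v(2)])
      then have "((\<lambda>t. w \<bullet> f t) has_real_derivative (w \<bullet> v)) (at t)"
        by (simp add: has_real_derivative_iff_has_vector_derivative)
      then have "(g has_real_derivative (w \<bullet> v - c)) (at t)"
        unfolding g_def by (intro DERIV_diff DERIV_cmult_Id)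
      with v(1) show "\<exists>v\<le>0. (g has_real_derivative v) (at t)" by (intro exI[of _ "w \<bullet> v - c"]) auto
    qed
  qed
  ultimately have "g b \<le> g a" by (rule ac_deriv_nonpos_imp_antimono[OF _ ab])
  then show ?thesis by (simp add: g_def inner_diff_right algebra_simps)
qed

text \<open>If the quotient missed \<open>Q\<close>, a strictly separating hyperplane would give a
  functional that contradicts the scalar estimate. In this way a pointwise differential inclusion
  becomes a statement about increments, which passes to limits.\<close>

lemma ac_mean_value_convex:
  fixes f :: "real \<Rightarrow> 'a::euclidean_space"
  assumes ac: "absolutely_continuous_on_interval a b f" and ab: "a < b"
    and Q: "closed Q" "convex Q" 
    and der: "AE t in lebesgue. a < t \<and> t < b \<longrightarrow> (\<exists>v\<in>Q. (f has_vector_derivative v) (at t))"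
  shows "(f b - f a) /\<^sub>R (b - a) \<in> Q"
proof (rule ccontr)
  assume "(f b - f a) /\<^sub>R (b - a) \<notin> Q"
  from separating_hyperplane_closed_point[OF Q(2,1) this]
  obtain w c where w: "w \<bullet> ((f b - f a) /\<^sub>R (b - a)) < c" "\<And>x. x \<in> Q \<Longrightarrow> c < w \<bullet> x" by blast
  have "(- w) \<bullet> (f b - f a) \<le> - c * (b - a)"
  proof (rule ac_mean_value_inner[OF ac])
    show "AE t in lebesgue. a < t \<and> t < b \<longrightarrow> (\<exists>v. - w \<bullet> v \<le> - c \<and> (f has_vector_derivative v) (at t))"
      using der by eventually_elim (metis inner_minus_left less_imp_le neg_le_iff_le w(2))
  qed (use ab in simp)
  then have "c * (b - a) \<le> w \<bullet> (f b - f a)" by simp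
  moreover have "w \<bullet> (f b - f a) < c * (b - a)"
  proof -
    have "(w \<bullet> (f b - f a)) / (b - a) < c"
      using w(1) by (simp only: inner_scaleR_right divide_inverse mult.commute)
    with ab show ?thesis by (simp add: pos_divide_less_eq)
  qed
  ultimately show False by simp
qed

lemma ac_bounded_deriv_lipschitz:
  fixes f :: "real \<Rightarrow> 'a::euclidean_space"
  assumes ac: "absolutely_continuous_on_interval a b f" and st: "a \<le> b"
    and der: "AE t in lebesgue. a < t \<and> t < b \<longrightarrow> (\<exists>v. norm v \<le> M \<and> (f has_vector_derivative v) (at t))"
  shows "norm (f b - f a) \<le> M * (b - a)"
proof (cases "a = b")
  case False
  then have ab: "a < b" using st by simp
  have "(f b - f a) /\<^sub>R (b - a) \<in> cball 0 M"
  proof (rule ac_mean_value_convex[OF ac ab])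
    show "AE t in lebesgue. a < t \<and> t < b \<longrightarrow> (\<exists>v\<in>cball 0 M. (f has_vector_derivative v) (at t))"
      using der by eventually_elim auto
  qed auto
  then have "norm (f b - f a) / (b - a) \<le> M"
    using ab by (simp add: divide_inverse_commute del: scaleR_diff_right)
  with ab show ?thesis by (simp add: pos_divide_le_eq)
qed simp

section \<open>Hybrid time domains\<close>

text \<open>An intrinsic description of nonempty hybrid time domains that does not mention the
  sequence of jump times. Each clause involves at most two adjacent levels, so the notion is easy to
  verify and is preserved by unions of chains.\<close>

definition local_time_domain :: "(real \<times> nat) set \<Rightarrow> bool" where
  "local_time_domain E \<longleftrightarrow> (0, 0) \<in> E \<and> (\<forall>t. (t, 0) \<in> E \<longrightarrow> 0 \<le> t) \<and>
     (\<forall>j s t u. (s, j) \<in> E \<and> (u, j) \<in> E \<and> s \<le> t \<and> t \<le> u \<longrightarrow> (t, j) \<in> E) \<and>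
     (\<forall>j t. (t, Suc j) \<in> E \<longrightarrow> (\<exists>b. (b, j) \<in> E \<and> (b, Suc j) \<in> E \<and>
        (\<forall>s. (s, j) \<in> E \<longrightarrow> s \<le> b) \<and> (\<forall>s. (s, Suc j) \<in> E \<longrightarrow> b \<le> s)))"

lemma local_time_domainD:
  assumes "local_time_domain E"
  shows "(0, 0) \<in> E" "(t, 0) \<in> E \<Longrightarrow> 0 \<le> t"
    "(s, j) \<in> E \<Longrightarrow> (u, j) \<in> E \<Longrightarrow> s \<le> t \<Longrightarrow> t \<le> u \<Longrightarrow> (t, j) \<in> E"
    "(t, Suc j) \<in> E \<Longrightarrow> \<exists>b. (b, j) \<in> E \<and> (b, Suc j) \<in> E \<and>
        (\<forall>s. (s, j) \<in> E \<longrightarrow> s \<le> b) \<and> (\<forall>s. (s, Suc j) \<in> E \<longrightarrow> b \<le> s)"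
  using assms unfolding local_time_domain_def by blast+

lemma local_time_domain_boundaries:
  assumes E: "local_time_domain E" and J: "\<And>j. j \<le> J \<Longrightarrow> \<exists>t. (t, j) \<in> E"
  obtains b where "\<And>j. j < J \<Longrightarrow> (b j, j) \<in> E" "\<And>j. j < J \<Longrightarrow> (b j, Suc j) \<in> E"
    "\<And>j s. j < J \<Longrightarrow> (s, j) \<in> E \<Longrightarrow> s \<le> b j" "\<And>j s. j < J \<Longrightarrow> (s, Suc j) \<in> E \<Longrightarrow> b j \<le> s"
proof -
  have "\<forall>j<J. \<exists>b. (b, j) \<in> E \<and> (b, Suc j) \<in> E \<and>
        (\<forall>s. (s, j) \<in> E \<longrightarrow> s \<le> b) \<and> (\<forall>s. (s, Suc j) \<in> E \<longrightarrow> b \<le> s)"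
  proof (intro allI impI)
    fix j assume "j < J"
    then obtain t where "(t, Suc j) \<in> E" using J[of "Suc j"] by auto
    from local_time_domainD(4)[OF E this] show "\<exists>b. (b, j) \<in> E \<and> (b, Suc j) \<in> E \<and>
        (\<forall>s. (s, j) \<in> E \<longrightarrow> s \<le> b) \<and> (\<forall>s. (s, Suc j) \<in> E \<longrightarrow> b \<le> s)" .
  qed
  then show thesis using that by metis
qed

lemma local_time_domain_levels:
  assumes "local_time_domain E" "(t, j) \<in> E" "i \<le> j"
  shows "\<exists>s. (s, i) \<in> E"
  using assms(3,2)
proof (induction j arbitrary: t rule: dec_induct)
  case (step n)
  then show ?case using local_time_domainD(4)[OF assms(1)] by blast
qed auto

text \<open>The jump times are recovered as the times common to two adjacent levels. Only the last
  level, if there is one, has to be classified: it is an interval with a minimum, and its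
  boundedness and the membership of its supremum decide among the three admissible forms.\<close>

lemma local_time_domain_imp_hybrid:
  assumes E: "local_time_domain E"
  shows "hybrid_time_domain E"
proof (cases "\<forall>j. \<exists>t. (t, j) \<in> E")
  case True
  have "\<forall>j. \<exists>b. (b, j) \<in> E \<and> (b, Suc j) \<in> E \<and>
        (\<forall>s. (s, j) \<in> E \<longrightarrow> s \<le> b) \<and> (\<forall>s. (s, Suc j) \<in> E \<longrightarrow> b \<le> s)"
    using local_time_domainD(4)[OF E] True by blast
  then obtain b where b: "\<And>j. (b j, j) \<in> E" "\<And>j. (b j, Suc j) \<in> E" 
    "\<And>j s. (s, j) \<in> E \<Longrightarrow> s \<le> b j" "\<And>j s. (s, Suc j) \<in> E \<Longrightarrow> b j \<le> s" by metis
  define t where "t = case_nat 0 b"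
  have mem: "(t j, j) \<in> E" "\<And>s. (s, j) \<in> E \<Longrightarrow> t j \<le> s" for j
    using b local_time_domainD(1,2)[OF E] by (cases j; auto simp: t_def)+
  have lev: "(s, j) \<in> E \<longleftrightarrow> t j \<le> s \<and> s \<le> t (Suc j)" for s j
    using b(1)[of j] mem(1)[of j] mem(2)[of s j] b(3)[of s j] local_time_domainD(3)[OF E, of "t j" j "b j" s]
    by (auto simp: t_def)
  have "E = (\<Union>j. {t j..t (Suc j)} \<times> {j})" using lev by auto
  moreover have "t 0 = 0" "\<forall>j. t j \<le> t (Suc j)" using mem b by (auto simp: t_def)
  ultimately show ?thesis unfolding hybrid_time_domain_def by blast
next
  case False
  define J where "J = (LEAST j. \<nexists>t. (t, Suc j) \<in> E)"
  have "\<exists>j. \<nexists>t. (t, Suc j) \<in> E"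
  proof -
    obtain j where "\<nexists>t. (t, j) \<in> E" using False by blast
    moreover have "(0, 0) \<in> E" by (rule local_time_domainD(1)[OF E])
    ultimately show ?thesis by (metis not0_implies_Suc)
  qed
  then have J1: "\<nexists>t. (t, Suc J) \<in> E" unfolding J_def by (rule LeastI_ex)
  have J2: "\<exists>t. (t, j) \<in> E" if "j \<le> J" for j
  proof (cases j)
    case 0 then show ?thesis using local_time_domainD(1)[OF E] by blast
  next
    case (Suc i)
    then have "i < J" using that by simp
    then show ?thesis unfolding J_def Suc using not_less_Least by blast
  qed
  have J3: "j \<le> J" if "(s, j) \<in> E" for s j
    using local_time_domain_levels[OF E that, of "Suc J"] J1 by (meson not_less_eq_eq)
  obtain b where b: "\<And>j. j < J \<Longrightarrow> (b j, j) \<in> E" "\<And>j. j < J \<Longrightarrow> (b j, Suc j) \<in> E"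
    "\<And>j s. j < J \<Longrightarrow> (s, j) \<in> E \<Longrightarrow> s \<le> b j" "\<And>j s. j < J \<Longrightarrow> (s, Suc j) \<in> E \<Longrightarrow> b j \<le> s"
    using local_time_domain_boundaries[OF E J2] by metis
  define I where "I = {t. (t, J) \<in> E}"
  define t0 where "t0 j = case_nat 0 b j" for j
  have mem0: "(t0 j, j) \<in> E" "\<And>s. (s, j) \<in> E \<Longrightarrow> t0 j \<le> s" if "j \<le> J" for j
    using b local_time_domainD(1,2)[OF E] that by (cases j; auto simp: t0_def)+
  \<comment> \<open>The right end of the last level. If that level is unbounded, the half-infinite
    form does not mention \<open>e\<close>, and any value that keeps the times nondecreasing will
    do.\<close>
  define e where "e = (if bdd_above I then Sup I else t0 J)"
  have e: "t0 J \<le> e"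
    using mem0[of J] unfolding e_def by (auto simp: I_def intro: cSup_upper)
  define t where "t j = (if j \<le> J then t0 j else e)" for j
  have tSuc: "t (Suc j) = b j" if "j < J" for j using that by (simp add: t_def t0_def)
  have lev: "(s, j) \<in> E \<longleftrightarrow> t j \<le> s \<and> s \<le> t (Suc j)" if "j < J" for s j
    using b(1)[OF that] mem0[of j] b(3)[OF that, of s] that tSuc[OF that]
      local_time_domainD(3)[OF E, of "t0 j" j "b j" s]
    by (auto simp: t_def)
  have Iconv: "t \<in> I" if "s \<in> I" "u \<in> I" "s \<le> t" "t \<le> u" for s t u
    using that local_time_domainD(3)[OF E] unfolding I_def by blast
  have IJ: "t0 J \<in> I" "\<And>s. s \<in> I \<Longrightarrow> t0 J \<le> s" using mem0[of J] by (auto simp: I_def)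
  have "I \<in> {{t J..t (Suc J)}, {t J..<t (Suc J)}, {t J..}}"
  proof (cases "bdd_above I")
    case False
    have "s \<in> I" if "t0 J \<le> s" for s
    proof -
      obtain u where "u \<in> I" "s < u" using False by (meson bdd_above.I not_le)
      then show ?thesis using Iconv[OF IJ(1), of u s] that by simp
    qed
    then have "I = {t J..}" using IJ(2) by (auto simp: t_def)
    then show ?thesis by simp
  next
    case True
    then have tS: "t (Suc J) = Sup I" and tJ: "t J = t0 J" by (simp_all add: t_def e_def)
    have up: "s \<le> Sup I" if "s \<in> I" for s using that True by (rule cSup_upper)
    have lt: "s \<in> I" if "t0 J \<le> s" and "s < Sup I" for s
    proof -
      have "\<exists>u\<in>I. s < u" using that IJ(1) by (intro less_cSupD) auto
      then obtain u where "u \<in> I" "s < u" by blast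
      then show ?thesis using Iconv[OF IJ(1), of u s] that by simp
    qed
    show ?thesis
    proof (cases "Sup I \<in> I")
      case True
      have eq: "s \<in> I \<longleftrightarrow> t0 J \<le> s \<and> s \<le> Sup I" for s
        using \<open>Sup I \<in> I\<close> up[of s] lt[of s] IJ(2)[of s] by (cases "s = Sup I") auto
      have "I = {t J..t (Suc J)}" by (rule set_eqI) (simp only: tS tJ eq atLeastAtMost_iff atLeastLessThan_iff)
      then show ?thesis by simp
    next
      case False
      have eq: "s \<in> I \<longleftrightarrow> t0 J \<le> s \<and> s < Sup I" for s
        using \<open>Sup I \<notin> I\<close> up[of s] lt[of s] IJ(2)[of s] by (cases "s = Sup I") auto
      have "I = {t J..<t (Suc J)}" by (rule set_eqI) (simp only: tS tJ eq atLeastAtMost_iff atLeastLessThan_iff)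
      then show ?thesis by simp
    qed
  qed
  moreover have "E = (\<Union>j<J. {t j..t (Suc j)} \<times> {j}) \<union> I \<times> {J}"
  proof (intro set_eqI iffI)
    fix p assume "p \<in> E"
    moreover obtain s j where "p = (s, j)" by (cases p)
    ultimately show "p \<in> (\<Union>j<J. {t j..t (Suc j)} \<times> {j}) \<union> I \<times> {J}"
      using J3[of s j] lev[of j s] by (cases "j = J") (auto simp: I_def)
  next
    fix p assume "p \<in> (\<Union>j<J. {t j..t (Suc j)} \<times> {j}) \<union> I \<times> {J}"
    then show "p \<in> E" using lev by (auto simp: I_def)
  qed
  moreover have "t 0 = 0" by (simp add: t_def t0_def)
  moreover have "t j \<le> t (Suc j)" for j
  proof -
    consider "j < J" | "j = J" | "j > J" by linarith
    then show ?thesis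
    proof cases
      case 1 then show ?thesis using mem0(2)[of j "b j"] b(1)[of j] by (simp add: tSuc) (simp add: t_def)
    qed (use e in \<open>auto simp: t_def\<close>)
  qed
  ultimately show ?thesis unfolding hybrid_time_domain_def by blast
qed

text \<open>Nonemptiness excludes an empty half-open last interval at level 0. An empty last
  interval at a later level is harmless, since that level is then simply absent.\<close>

lemma hybrid_time_domain_imp_local:
  assumes "hybrid_time_domain E" "E \<noteq> {}"
  shows "local_time_domain E"
proof -
  obtain t :: "nat \<Rightarrow> real" where t: "t 0 = 0" "\<And>j. t j \<le> t (Suc j)"
    and c: "E = (\<Union>j. {t j..t (Suc j)} \<times> {j}) \<or>
         (\<exists>J L. L \<in> {{t J..t (Suc J)}, {t J..<t (Suc J)}, {t J..}} \<and>
                E = (\<Union>j<J. {t j..t (Suc j)} \<times> {j}) \<union> L \<times> {J})"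
    using assms(1) unfolding hybrid_time_domain_def by blast
  from c show ?thesis
  proof (elim disjE exE conjE)
    assume E: "E = (\<Union>j. {t j..t (Suc j)} \<times> {j})"
    then have lev: "(s, j) \<in> E \<longleftrightarrow> t j \<le> s \<and> s \<le> t (Suc j)" for s j by auto
    show ?thesis
      unfolding local_time_domain_def
    proof (intro conjI allI impI)
      show "(0, 0) \<in> E" using t(1) t(2)[of 0] by (simp add: lev)
      show "0 \<le> s" if "(s, 0) \<in> E" for s using that t(1) by (simp add: lev)
      show "(y, j) \<in> E" if "(s, j) \<in> E \<and> (u, j) \<in> E \<and> s \<le> y \<and> y \<le> u" for j s y u
        using that by (auto simp: lev)
      show "\<exists>b. (b, j) \<in> E \<and> (b, Suc j) \<in> E \<and>
        (\<forall>s. (s, j) \<in> E \<longrightarrow> s \<le> b) \<and> (\<forall>s. (s, Suc j) \<in> E \<longrightarrow> b \<le> s)" for j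
        using t(2) by (intro exI[of _ "t (Suc j)"]) (auto simp: lev)
    qed
  next
    fix J L assume L: "L \<in> {{t J..t (Suc J)}, {t J..<t (Suc J)}, {t J..}}"
      and E: "E = (\<Union>j<J. {t j..t (Suc j)} \<times> {j}) \<union> L \<times> {J}"
    have lev: "(s, j) \<in> E \<longleftrightarrow> (j < J \<and> t j \<le> s \<and> s \<le> t (Suc j)) \<or> (j = J \<and> s \<in> L)" for s j
      unfolding E by auto
    have Lc: "y \<in> L" if "s \<in> L" "u \<in> L" "s \<le> y" "y \<le> u" for s y u using L that by auto
    have L1: "t J \<le> s" if "s \<in> L" for s using L that by auto
    have L2: "t J \<in> L" if "s \<in> L" for s using L that by auto
    have 00: "(0, 0) \<in> E"
    proof (cases J)
      case 0
      then have "L \<noteq> {}" using assms(2) E by auto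
      then show ?thesis using L2 0 t by (auto simp: lev)
    next
      case (Suc n) then show ?thesis using t(1) t(2)[of 0] by (auto simp: lev)
    qed
    have bd: "\<exists>b. (b, j) \<in> E \<and> (b, Suc j) \<in> E \<and>
        (\<forall>s. (s, j) \<in> E \<longrightarrow> s \<le> b) \<and> (\<forall>s. (s, Suc j) \<in> E \<longrightarrow> b \<le> s)"
      if "(u, Suc j) \<in> E" for u j
    proof (intro exI[of _ "t (Suc j)"] conjI allI impI)
      show "(t (Suc j), j) \<in> E" using that t(2)[of j] by (auto simp: lev)
      show "(t (Suc j), Suc j) \<in> E" using that t(2)[of "Suc j"] L2 by (auto simp: lev)
      show "s \<le> t (Suc j)" if "(s, j) \<in> E" for s using that \<open>(u, Suc j) \<in> E\<close> by (auto simp: lev)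
      show "t (Suc j) \<le> s" if "(s, Suc j) \<in> E" for s using that L1 by (auto simp: lev)
    qed
    show ?thesis
      unfolding local_time_domain_def
    proof (intro conjI allI impI 00)
      show "0 \<le> s" if "(s, 0) \<in> E" for s using that t L1[of s] by (auto simp: lev)
      show "(y, j) \<in> E" if "(s, j) \<in> E \<and> (u, j) \<in> E \<and> s \<le> y \<and> y \<le> u" for j s y u
        using that Lc[of s u y] unfolding lev by auto
      show "\<exists>b. (b, j) \<in> E \<and> (b, Suc j) \<in> E \<and>
        (\<forall>s. (s, j) \<in> E \<longrightarrow> s \<le> b) \<and> (\<forall>s. (s, Suc j) \<in> E \<longrightarrow> b \<le> s)" if "(s, Suc j) \<in> E" for j s
        by (rule bd[OF that])
    qed
  qed
qed

text \<open>Any two points lie in a common member of the chain, and a time lying in two adjacent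
  levels is necessarily their boundary. The boundary found in one member therefore remains the
  boundary in every larger member.\<close>

lemma local_time_domain_chain_Union:
  assumes ne: "\<E> \<noteq> {}" and loc: "\<And>E. E \<in> \<E> \<Longrightarrow> local_time_domain E"
    and ch: "\<And>E E'. E \<in> \<E> \<Longrightarrow> E' \<in> \<E> \<Longrightarrow> E \<subseteq> E' \<or> E' \<subseteq> E"
  shows "local_time_domain (\<Union>\<E>)"
  unfolding local_time_domain_def
proof (intro conjI allI impI)
  have two: "\<exists>E\<in>\<E>. p \<in> E \<and> q \<in> E" if "p \<in> \<Union>\<E>" "q \<in> \<Union>\<E>" for p q
    using that ch by (meson UnionE subsetD)
  show "(0, 0) \<in> \<Union>\<E>" using ne local_time_domainD(1)[OF loc] by blast
  show "0 \<le> t" if "(t, 0) \<in> \<Union>\<E>" for t using that local_time_domainD(2)[OF loc] by blast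
  show "(t, j) \<in> \<Union>\<E>" if "(s, j) \<in> \<Union>\<E> \<and> (u, j) \<in> \<Union>\<E> \<and> s \<le> t \<and> t \<le> u" for j s t u
    using two[of "(s, j)" "(u, j)"] that local_time_domainD(3)[OF loc] by blast
  fix j t assume "(t, Suc j) \<in> \<Union>\<E>"
  then obtain E where E: "E \<in> \<E>" "(t, Suc j) \<in> E" by blast
  from local_time_domainD(4)[OF loc[OF E(1)] E(2)] 
  obtain b where b: "(b, j) \<in> E" "(b, Suc j) \<in> E" by blast
  have ext: "\<exists>E'\<in>\<E>. p \<in> E' \<and> (b, j) \<in> E' \<and> (b, Suc j) \<in> E'" if "p \<in> \<Union>\<E>" for p
    using that ch[of _ E] E(1) b by blast
  show "\<exists>b. (b, j) \<in> \<Union>\<E> \<and> (b, Suc j) \<in> \<Union>\<E> \<and>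
        (\<forall>s. (s, j) \<in> \<Union>\<E> \<longrightarrow> s \<le> b) \<and> (\<forall>s. (s, Suc j) \<in> \<Union>\<E> \<longrightarrow> b \<le> s)"
  proof (intro exI[of _ b] conjI allI impI)
    fix s assume "(s, j) \<in> \<Union>\<E>"
    then obtain E' where E': "E' \<in> \<E>" "(s, j) \<in> E'" "(b, Suc j) \<in> E'" "(b, j) \<in> E'"
      using ext by blast
    then show "s \<le> b" using local_time_domainD(4)[OF loc E'(3)] by fastforce
  next
    fix s assume "(s, Suc j) \<in> \<Union>\<E>"
    then obtain E' where E': "E' \<in> \<E>" "(s, Suc j) \<in> E'" "(b, Suc j) \<in> E'" "(b, j) \<in> E'"
      using ext by blast
    then show "b \<le> s" using local_time_domainD(4)[OF loc E'(3)] by fastforce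
  qed (use E b in auto)
qed

section \<open>Extension to maximal solutions\<close>

text \<open>The flow condition states derivatives within a level interval. Almost every time of the
  interval is interior, and there these are two-sided derivatives.\<close>

lemma AE_convex_interior:
  fixes I :: "real set"
  assumes "convex I"
  shows "AE t in lebesgue. t \<in> I \<longrightarrow> t \<in> interior I"
proof (rule AE_I')
  show "frontier I \<in> null_sets lebesgue"
    using negligible_convex_frontier[OF assms] by (simp add: negligible_iff_null_sets)
  show "{t \<in> space lebesgue. \<not> (t \<in> I \<longrightarrow> t \<in> interior I)} \<subseteq> frontier I"
    using closure_subset by (auto simp: frontier_def)
qed

lemma AE_lebesgue_translate:
  fixes c :: real
  assumes "AE t in lebesgue. P t"
  shows "AE t in lebesgue. P (t + c)"
proof -
  obtain N where N: "{t. \<not> P t} \<subseteq> N" "N \<in> null_sets lebesgue"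
    using assms unfolding eventually_ae_filter by auto
  have "(+) (- c) ` N \<in> null_sets lebesgue"
    using negligible_translation[of N "- c"] N(2) by (simp add: negligible_iff_null_sets)
  moreover have "{t \<in> space lebesgue. \<not> P (t + c)} \<subseteq> (+) (- c) ` N"
  proof
    fix t assume "t \<in> {t \<in> space lebesgue. \<not> P (t + c)}"
    then have "t + c \<in> N" using N(1) by auto
    moreover have "t = - c + (t + c)" by simp
    ultimately show "t \<in> (+) (- c) ` N" by blast
  qed
  ultimately show ?thesis by (rule AE_I')
qed

lemma solution_local_time_domain:
  "solution H x \<Longrightarrow> dom x \<noteq> {} \<Longrightarrow> local_time_domain (dom x)"
  unfolding solution_def hybrid_arc_def by (auto intro: hybrid_time_domain_imp_local)

lemma local_time_domain_convex_level:
  assumes "local_time_domain (dom x)"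
  shows "convex (arc_interval x j)"
  unfolding is_interval_convex_1[symmetric] is_interval_1 arc_interval_def
  using local_time_domainD(3)[OF assms] by blast

lemma solutionD:
  assumes "solution H x"
  shows "hybrid_time_domain (dom x)"
    "locally_absolutely_continuous_on (arc_interval x j) (arc_val x j)"
    "interior (arc_interval x j) \<noteq> {} \<Longrightarrow> AE t in lebesgue. t \<in> arc_interval x j \<longrightarrow>
           (\<exists>v\<in>flow_map H (arc_val x j t).
              (arc_val x j has_vector_derivative v) (at t within arc_interval x j))"
    "t \<in> arc_interval x j \<Longrightarrow> s \<in> arc_interval x j \<Longrightarrow> t < s \<Longrightarrow> arc_val x j t \<in> flow_set H"
    "(t, j) \<in> dom x \<Longrightarrow> (t, Suc j) \<in> dom x \<Longrightarrow> arc_val x j t \<in> jump_set H"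
    "(t, j) \<in> dom x \<Longrightarrow> (t, Suc j) \<in> dom x \<Longrightarrow> arc_val x (Suc j) t \<in> jump_map H (arc_val x j t)"
proof -
  show "hybrid_time_domain (dom x)"
    "locally_absolutely_continuous_on (arc_interval x j) (arc_val x j)"
    using assms by (auto simp: solution_def hybrid_arc_def)
  show "interior (arc_interval x j) \<noteq> {} \<Longrightarrow> AE t in lebesgue. t \<in> arc_interval x j \<longrightarrow>
           (\<exists>v\<in>flow_map H (arc_val x j t).
              (arc_val x j has_vector_derivative v) (at t within arc_interval x j))"
    using assms unfolding solution_def Let_def by blast
  show "(t, j) \<in> dom x \<Longrightarrow> (t, Suc j) \<in> dom x \<Longrightarrow> arc_val x j t \<in> jump_set H"
    "(t, j) \<in> dom x \<Longrightarrow> (t, Suc j) \<in> dom x \<Longrightarrow> arc_val x (Suc j) t \<in> jump_map H (arc_val x j t)"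
    using assms unfolding solution_def by blast+
  show "arc_val x j t \<in> flow_set H" if ts: "t \<in> arc_interval x j" "s \<in> arc_interval x j" "t < s"
  proof -
    have "local_time_domain (dom x)" 
      by (rule solution_local_time_domain[OF assms]) (use ts(1) in \<open>auto simp: arc_interval_def\<close>)
    have "{t<..<s} \<subseteq> arc_interval x j"
    proof
      fix u assume "u \<in> {t<..<s}"
      with ts local_time_domainD(3)[OF \<open>local_time_domain (dom x)\<close>, of t j s u]
      show "u \<in> arc_interval x j" by (simp add: arc_interval_def)
    qed
    then have "{t<..<s} \<subseteq> interior (arc_interval x j)" by (simp add: interior_maximal)
    moreover have "(t + s) / 2 \<in> {t<..<s}" using ts by auto
    ultimately have "interior (arc_interval x j) \<noteq> {}" by blast
    then show ?thesis using assms ts unfolding solution_def Let_def by blast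
  qed
qed

text \<open>Supplies the upper bounds for Zorn's lemma. The conditions on values, apart from the
  almost-everywhere one, involve two points of the domain or the compact interval between them, so
  each can be checked inside one member of the chain.\<close>

lemma solution_chain_Union:
  assumes C0: "c0 \<in> C" and sol: "\<And>c. c \<in> C \<Longrightarrow> solution H c" and ne: "\<And>c. c \<in> C \<Longrightarrow> dom c \<noteq> {}"
    and chain: "\<And>c c'. c \<in> C \<Longrightarrow> c' \<in> C \<Longrightarrow> c \<subseteq>\<^sub>m c' \<or> c' \<subseteq>\<^sub>m c"
  obtains y where "solution H y" "\<And>c. c \<in> C \<Longrightarrow> c \<subseteq>\<^sub>m y"
proof -
  define y where "y p = (if \<exists>c\<in>C. c p \<noteq> None then (SOME c. c \<in> C \<and> c p \<noteq> None) p else None)" for p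
  have yv: "y p = c p" if "c \<in> C" "c p \<noteq> None" for c p
  proof -
    define d where "d = (SOME c. c \<in> C \<and> c p \<noteq> None)"
    have d: "d \<in> C \<and> d p \<noteq> None" unfolding d_def by (rule someI[of _ c]) (use that in auto)
    have "y p = d p" unfolding y_def d_def using that by auto
    moreover have "p \<in> dom c" "p \<in> dom d" using that d by auto
    then have "d p = c p"
      using chain[OF that(1) conjunct1[OF d]] unfolding map_le_def by (elim disjE) simp_all
    ultimately show ?thesis by simp
  qed
  have le: "c \<subseteq>\<^sub>m y" if "c \<in> C" for c
    unfolding map_le_def using yv[OF that] by (metis domIff)
  have domy: "dom y = \<Union>(dom ` C)"
  proof
    show "dom y \<subseteq> \<Union>(dom ` C)"
    proof
      fix p assume "p \<in> dom y"
      then have "\<exists>c\<in>C. c p \<noteq> None" unfolding y_def domIff by presburger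
      then show "p \<in> \<Union>(dom ` C)" by blast
    qed
    show "\<Union>(dom ` C) \<subseteq> dom y" using map_le_implies_dom_le[OF le] by blast
  qed
  have two: "\<exists>c\<in>C. p \<in> dom c \<and> q \<in> dom c" if pq: "p \<in> dom y" "q \<in> dom y" for p q
  proof -
    obtain c d where "c \<in> C" "p \<in> dom c" "d \<in> C" "q \<in> dom d" using pq domy by blast
    then show ?thesis using chain[of c d] map_le_implies_dom_le by blast
  qed
  have val: "arc_val y j t = arc_val c j t" if "c \<in> C" "(t, j) \<in> dom c" for c j t
    using yv[OF that(1), of "(t, j)"] that(2) by auto
  have loc: "local_time_domain (dom y)" unfolding domy
  proof (rule local_time_domain_chain_Union)
    show "local_time_domain E" if "E \<in> dom ` C" for E
      using that solution_local_time_domain[OF sol ne] by blast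
    show "E \<subseteq> E' \<or> E' \<subseteq> E" if "E \<in> dom ` C" "E' \<in> dom ` C" for E E'
      using that chain by (metis imageE map_le_implies_dom_le)
  qed (use C0 in auto)
  have int: "(t, j) \<in> dom c" if "c \<in> C" "(a, j) \<in> dom c" "(b, j) \<in> dom c" "a \<le> t" "t \<le> b" for c j a b t
    using local_time_domainD(3)[OF solution_local_time_domain[OF sol[OF that(1)] ne[OF that(1)]]] that by blast
  have "solution H y"
    unfolding solution_def hybrid_arc_def Let_def
  proof (intro conjI allI impI ballI)
    show "hybrid_time_domain (dom y)" using loc by (rule local_time_domain_imp_hybrid)
    show "locally_absolutely_continuous_on (arc_interval y j) (arc_val y j)" for j
      unfolding locally_absolutely_continuous_on_def
    proof (intro allI impI)
      fix a b assume ab: "a \<le> b \<and> {a..b} \<subseteq> arc_interval y j"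
      then have "(a, j) \<in> dom y" "(b, j) \<in> dom y"
        by (simp_all add: arc_interval_def subset_iff domIff)
      then obtain c where c: "c \<in> C" "(a, j) \<in> dom c" "(b, j) \<in> dom c"
        using two by blast
      have "{a..b} \<subseteq> arc_interval c j" using int[OF c] unfolding arc_interval_def by (intro subsetI) simp
      then have "absolutely_continuous_on_interval a b (arc_val c j)"
        using solutionD(2)[OF sol[OF c(1)], of j] ab unfolding locally_absolutely_continuous_on_def by blast
      then show "absolutely_continuous_on_interval a b (arc_val y j)"
        by (rule ac_transform) (rule val[OF c(1) int[OF c]])
    qed
    show "arc_val y j t \<in> flow_set H" if t: "t \<in> arc_interval y j" "\<exists>s\<in>arc_interval y j. t < s" for j t
    proof -
      obtain s where s: "s \<in> arc_interval y j" "t < s" using t by blast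
      then obtain c where c: "c \<in> C" "(t, j) \<in> dom c" "(s, j) \<in> dom c"
        using two[of "(t, j)" "(s, j)"] t unfolding arc_interval_def by blast
      then show ?thesis using solutionD(4)[OF sol[OF c(1)], of t j s] s(2) val[OF c(1,2)]
        by (simp add: arc_interval_def)
    qed
    show "arc_val y j t \<in> jump_set H" "arc_val y (Suc j) t \<in> jump_map H (arc_val y j t)"
      if tj: "(t, j) \<in> dom y \<and> (t, Suc j) \<in> dom y" for t j
    proof -
      obtain c where c: "c \<in> C" "(t, j) \<in> dom c" "(t, Suc j) \<in> dom c"
        using two[of "(t, j)" "(t, Suc j)"] tj by blast
      show "arc_val y j t \<in> jump_set H" "arc_val y (Suc j) t \<in> jump_map H (arc_val y j t)"
        using solutionD(5,6)[OF sol[OF c(1)] c(2,3)] val[OF c(1,2)] val[OF c(1,3)] by simp_all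
    qed
    fix j
    let ?I = "arc_interval y j"
    \<comment> \<open>The chain may be uncountable, so the exceptional null sets of all members
      cannot simply be united. Every interior time of the level lies between two rational times of
      the level, and one member per rational pair leaves only countably many null sets.\<close>
    define K where "K = {(p, q). p \<in> \<rat> \<and> q \<in> \<rat> \<and> p < q \<and> p \<in> ?I \<and> q \<in> ?I}"
    have "countable K"
      by (rule countable_subset[of _ "\<rat> \<times> \<rat>"]) (auto simp: K_def countable_rat)
    have "\<forall>k\<in>K. \<exists>c\<in>C. (fst k, j) \<in> dom c \<and> (snd k, j) \<in> dom c"
    proof
      fix k assume "k \<in> K"
      then have "fst k \<in> ?I" "snd k \<in> ?I" by (simp_all add: K_def case_prod_unfold)
      then show "\<exists>c\<in>C. (fst k, j) \<in> dom c \<and> (snd k, j) \<in> dom c"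
        unfolding arc_interval_def mem_Collect_eq by (rule two)
    qed
    then obtain c where c: "\<And>k. k \<in> K \<Longrightarrow> c k \<in> C" "\<And>k. k \<in> K \<Longrightarrow> (fst k, j) \<in> dom (c k)"
      "\<And>k. k \<in> K \<Longrightarrow> (snd k, j) \<in> dom (c k)" by metis
    have sub: "{fst k<..<snd k} \<subseteq> interior (arc_interval (c k) j)" if "k \<in> K" for k
      using int[OF c(1)[OF that] c(2)[OF that] c(3)[OF that]]
      unfolding arc_interval_def by (intro interior_maximal subsetI) (simp_all add: less_imp_le)
    have "AE t in lebesgue. t \<in> arc_interval (c k) j \<longrightarrow>
           (\<exists>v\<in>flow_map H (arc_val (c k) j t).
              (arc_val (c k) j has_vector_derivative v) (at t within arc_interval (c k) j))" if k: "k \<in> K" for k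
    proof (rule solutionD(3)[OF sol[OF c(1)[OF k]]])
      have "(fst k + snd k) / 2 \<in> {fst k<..<snd k}" using k by (auto simp: K_def)
      with sub[OF k] show "interior (arc_interval (c k) j) \<noteq> {}" by blast
    qed
    then have "AE t in lebesgue. \<forall>k\<in>K. t \<in> arc_interval (c k) j \<longrightarrow>
           (\<exists>v\<in>flow_map H (arc_val (c k) j t).
              (arc_val (c k) j has_vector_derivative v) (at t within arc_interval (c k) j))"
      using \<open>countable K\<close> by (simp add: AE_ball_countable)
    then show "AE t in lebesgue. t \<in> ?I \<longrightarrow> (\<exists>v\<in>flow_map H (arc_val y j t).
              (arc_val y j has_vector_derivative v) (at t within ?I))"
      using AE_convex_interior[OF local_time_domain_convex_level[OF loc, of j]]
    proof eventually_elim
      case (elim t)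
      show ?case
      proof
        assume "t \<in> ?I"
        with elim have "t \<in> interior ?I" by blast
        then obtain e where e: "e > 0" "ball t e \<subseteq> ?I" by (meson mem_interior)
        obtain p where p: "p \<in> \<rat>" "t - e < p" "p < t" using Rats_dense_in_real[of "t - e" t] e(1) by auto
        obtain q where q: "q \<in> \<rat>" "t < q" "q < t + e" using Rats_dense_in_real[of t "t + e"] e(1) by auto
        have k: "(p, q) \<in> K" using p q e(2) by (auto simp: K_def dist_real_def subset_iff)
        have ti: "t \<in> interior (arc_interval (c (p, q)) j)" using sub[OF k] p q by auto
        then have tc: "t \<in> arc_interval (c (p, q)) j" using interior_subset by blast
        with elim k obtain v where v: "v \<in> flow_map H (arc_val (c (p, q)) j t)"
          "(arc_val (c (p, q)) j has_vector_derivative v) (at t within arc_interval (c (p, q)) j)" by blast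
        then have "(arc_val (c (p, q)) j has_vector_derivative v) (at t)"
          using at_within_interior[OF ti] by simp
        then have "(arc_val y j has_vector_derivative v) (at t)"
        proof (rule has_vector_derivative_transform_within_open)
          show "open {p<..<q}" "t \<in> {p<..<q}" using p q by auto
          show "arc_val (c (p, q)) j s = arc_val y j s" if "s \<in> {p<..<q}" for s
          proof (rule val[symmetric])
            show "c (p, q) \<in> C" by (rule c(1)[OF k])
            have "s \<in> arc_interval (c (p, q)) j"
              using sub[OF k] that interior_subset[of "arc_interval (c (p, q)) j"] by (simp add: subset_iff)
            then show "(s, j) \<in> dom (c (p, q))" unfolding arc_interval_def by blast
          qed
        qed
        moreover have "v \<in> flow_map H (arc_val y j t)"
          using v(1) val[OF c(1)[OF k], of t j] tc unfolding arc_interval_def by simp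
        ultimately show "\<exists>v\<in>flow_map H (arc_val y j t). (arc_val y j has_vector_derivative v) (at t within ?I)"
          by (blast intro: has_vector_derivative_at_within)
      qed
    qed
  qed
  then show thesis by (rule that) (rule le)
qed

text \<open>Zorn's lemma on the extensions of \<open>x\<close>. Stability and attractivity are
  stated for maximal solutions, while cut-out segments and their limits need not be maximal; this
  lemma makes the hypotheses applicable to them.\<close>

lemma solution_extends_to_maximal:
  assumes sol: "solution H x" and ne: "dom x \<noteq> {}"
  obtains y where "maximal_solution H y" "x \<subseteq>\<^sub>m y"
proof -
  define A where "A = {y. solution H y \<and> x \<subseteq>\<^sub>m y}"
  have xA: "x \<in> A" using sol by (simp add: A_def)
  have "\<exists>m\<in>A. \<forall>a\<in>A. m \<subseteq>\<^sub>m a \<longrightarrow> a = m"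
  proof (rule predicate_Zorn)
    show "partial_order_on A (relation_of (\<subseteq>\<^sub>m) A)"
      by (rule partial_order_on_relation_ofI) (auto intro: map_le_trans map_le_antisym)
    fix C assume C: "C \<in> Chains (relation_of (\<subseteq>\<^sub>m) A)"
    then have CA: "C \<subseteq> A" and ch: "\<And>c d. c \<in> C \<Longrightarrow> d \<in> C \<Longrightarrow> c \<subseteq>\<^sub>m d \<or> d \<subseteq>\<^sub>m c"
      unfolding Chains_def relation_of_def by auto
    show "\<exists>u\<in>A. \<forall>a\<in>C. a \<subseteq>\<^sub>m u"
    proof (cases "C = {}")
      case True then show ?thesis using xA by blast
    next
      case False
      then obtain c0 where c0: "c0 \<in> C" by blast
      obtain y where y: "solution H y" "\<And>c. c \<in> C \<Longrightarrow> c \<subseteq>\<^sub>m y"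
      proof (rule solution_chain_Union[OF c0])
        show "solution H c" if "c \<in> C" for c using that CA by (auto simp: A_def)
        show "dom c \<noteq> {}" if "c \<in> C" for c 
          using that CA ne map_le_implies_dom_le unfolding A_def by blast
      qed (use ch in auto)
      have "x \<subseteq>\<^sub>m y" using y(2)[OF c0] CA c0 by (auto simp: A_def intro: map_le_trans)
      with y show ?thesis by (auto simp: A_def)
    qed
  qed
  then obtain m where m: "m \<in> A" "\<forall>a\<in>A. m \<subseteq>\<^sub>m a \<longrightarrow> a = m" by blast
  have "maximal_solution H m"
    unfolding maximal_solution_def
  proof (intro conjI allI impI)
    fix y assume y: "solution H y \<and> m \<subseteq>\<^sub>m y"
    moreover have "y \<in> A" using y m(1) by (auto simp: A_def intro: map_le_trans)
    ultimately show "y = m" using m(2) by blast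
  qed (use m in \<open>auto simp: A_def\<close>)
  then show thesis using that m(1) by (auto simp: A_def)
qed

section \<open>Solutions as sequences of phases\<close>

text \<open>A solution is stored as the start and end times of its phases, with
  \<open>\<tau> j = \<infinity>\<close> for phases that do not occur, together with one curve per phase. In this form
  domains have limits in a compact space.\<close>

definition phase :: "(nat \<Rightarrow> ereal) \<Rightarrow> (nat \<Rightarrow> ereal) \<Rightarrow> nat \<Rightarrow> real set" where
  "phase \<tau> \<sigma> j = {t. \<tau> j \<le> ereal t \<and> ereal t \<le> \<sigma> j}"

text \<open>A phase ends either with a jump, \<open>\<tau> (Suc j) = \<sigma> j\<close>, or without
  a successor, \<open>\<tau> (Suc j) = \<infinity>\<close>. In the latter case
  \<open>\<tau> j \<le> \<sigma> j\<close> forces all later times to be infinite, so all later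
  phases are empty. Phases are closed on the right, hence half-open last intervals are not
  represented; compact segments and their limits are all that is stored.\<close>

definition phase_times :: "(nat \<Rightarrow> ereal) \<Rightarrow> (nat \<Rightarrow> ereal) \<Rightarrow> bool" where
  "phase_times \<tau> \<sigma> \<longleftrightarrow> \<tau> 0 = 0 \<and> (\<forall>j. \<tau> j \<le> \<sigma> j \<and> (\<tau> (Suc j) = \<sigma> j \<or> \<tau> (Suc j) = \<infinity>))"

definition phase_solution ::
    "'a::euclidean_space hybrid_system \<Rightarrow> (nat \<Rightarrow> ereal) \<Rightarrow> (nat \<Rightarrow> ereal) \<Rightarrow> (nat \<Rightarrow> real \<Rightarrow> 'a) \<Rightarrow> bool" where
  "phase_solution H \<tau> \<sigma> \<phi> \<longleftrightarrow> phase_times \<tau> \<sigma> \<and>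
     (\<forall>j. locally_absolutely_continuous_on (phase \<tau> \<sigma> j) (\<phi> j) \<and>
       (AE t in lebesgue. \<tau> j < ereal t \<and> ereal t < \<sigma> j \<longrightarrow>
          (\<exists>v\<in>flow_map H (\<phi> j t). (\<phi> j has_vector_derivative v) (at t))) \<and>
       (\<forall>t. \<tau> j \<le> ereal t \<and> ereal t < \<sigma> j \<longrightarrow> \<phi> j t \<in> flow_set H) \<and>
       (\<forall>t. \<tau> (Suc j) = ereal t \<longrightarrow> \<phi> j t \<in> jump_set H \<and> \<phi> (Suc j) t \<in> jump_map H (\<phi> j t)))"

definition phase_arc :: "(nat \<Rightarrow> ereal) \<Rightarrow> (nat \<Rightarrow> ereal) \<Rightarrow> (nat \<Rightarrow> real \<Rightarrow> 'a) \<Rightarrow> 'a arc" where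
  "phase_arc \<tau> \<sigma> \<phi> = (\<lambda>(t, j). if t \<in> phase \<tau> \<sigma> j then Some (\<phi> j t) else None)"

lemma mem_dom_phase_arc: "(t, j) \<in> dom (phase_arc \<tau> \<sigma> \<phi>) \<longleftrightarrow> t \<in> phase \<tau> \<sigma> j"
  by (simp add: phase_arc_def dom_def)

lemma phase_arc_val: "t \<in> phase \<tau> \<sigma> j \<Longrightarrow> phase_arc \<tau> \<sigma> \<phi> (t, j) = Some (\<phi> j t)"
  by (simp add: phase_arc_def)

lemma arc_interval_phase_arc: "arc_interval (phase_arc \<tau> \<sigma> \<phi>) j = phase \<tau> \<sigma> j"
  by (simp add: arc_interval_def mem_dom_phase_arc)

lemma phase_times_nonneg:
  assumes "phase_times \<tau> \<sigma>"
  shows "0 \<le> \<tau> j"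
proof (induction j)
  case 0 then show ?case using assms by (simp add: phase_times_def)
next
  case (Suc j)
  then show ?case using assms unfolding phase_times_def by (metis ereal_infty_less_eq2(1) order_trans ereal_less_eq(1))
qed

lemma phase_times_Suc_real:
  assumes "phase_times \<tau> \<sigma>" "t \<in> phase \<tau> \<sigma> (Suc j)"
  obtains b where "\<tau> (Suc j) = ereal b" "\<sigma> j = ereal b" "b \<le> t" "b \<in> phase \<tau> \<sigma> j" "b \<in> phase \<tau> \<sigma> (Suc j)"
proof -
  have le: "\<tau> (Suc j) \<le> ereal t" using assms(2) by (simp add: phase_def)
  moreover have "0 \<le> \<tau> (Suc j)" by (rule phase_times_nonneg[OF assms(1)])
  ultimately obtain b where b: "\<tau> (Suc j) = ereal b" by (cases "\<tau> (Suc j)") auto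
  with assms(1) have s: "\<sigma> j = ereal b" "\<tau> j \<le> \<sigma> j" "\<tau> (Suc j) \<le> \<sigma> (Suc j)" unfolding phase_times_def by (metis PInfty_neq_ereal(1))+
  show thesis using that[OF b s(1)] b s le by (simp add: phase_def)
qed

lemma phase_arc_local_time_domain:
  assumes "phase_times \<tau> \<sigma>"
  shows "local_time_domain (dom (phase_arc \<tau> \<sigma> \<phi>))"
  unfolding local_time_domain_def mem_dom_phase_arc
proof (intro conjI allI impI)
  have t0: "\<tau> 0 = 0" "0 \<le> \<sigma> 0" using assms unfolding phase_times_def by metis+
  then show "0 \<in> phase \<tau> \<sigma> 0" by (simp add: phase_def flip: zero_ereal_def)
  show "0 \<le> t" if "t \<in> phase \<tau> \<sigma> 0" for t using that t0 by (simp add: phase_def)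
  show "t \<in> phase \<tau> \<sigma> j" if "s \<in> phase \<tau> \<sigma> j \<and> u \<in> phase \<tau> \<sigma> j \<and> s \<le> t \<and> t \<le> u" for j s t u
    using that unfolding phase_def by (auto intro: order_trans[of _ "ereal s"] order_trans[of _ "ereal u"])
  fix j t assume t: "t \<in> phase \<tau> \<sigma> (Suc j)"
  obtain b where b: "\<tau> (Suc j) = ereal b" "\<sigma> j = ereal b" "b \<in> phase \<tau> \<sigma> j" "b \<in> phase \<tau> \<sigma> (Suc j)"
    using phase_times_Suc_real[OF assms t] by metis
  show "\<exists>b. b \<in> phase \<tau> \<sigma> j \<and> b \<in> phase \<tau> \<sigma> (Suc j) \<and> (\<forall>s. s \<in> phase \<tau> \<sigma> j \<longrightarrow> s \<le> b) \<and>
        (\<forall>s. s \<in> phase \<tau> \<sigma> (Suc j) \<longrightarrow> b \<le> s)"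
    by (rule exI[of _ b]) (use b in \<open>auto simp: phase_def\<close>)
qed

lemma phase_solution_imp_solution:
  assumes sol: "phase_solution H \<tau> \<sigma> \<phi>"
  shows "solution H (phase_arc \<tau> \<sigma> \<phi>)"
proof -
  let ?x = "phase_arc \<tau> \<sigma> \<phi>"
  have pt: "phase_times \<tau> \<sigma>" using sol by (simp add: phase_solution_def)
  have loc: "local_time_domain (dom ?x)" by (rule phase_arc_local_time_domain[OF pt])
  have val: "arc_val ?x j t = \<phi> j t" if "t \<in> phase \<tau> \<sigma> j" for j t
    by (simp add: phase_arc_val[OF that])
  show ?thesis
    unfolding solution_def hybrid_arc_def Let_def arc_interval_phase_arc mem_dom_phase_arc
  proof (intro conjI allI impI ballI)
    show "hybrid_time_domain (dom ?x)" using loc by (rule local_time_domain_imp_hybrid)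
    show "locally_absolutely_continuous_on (phase \<tau> \<sigma> j) (arc_val ?x j)" for j
      unfolding locally_absolutely_continuous_on_def
    proof (intro allI impI)
      fix a b assume ab: "a \<le> b \<and> {a..b} \<subseteq> phase \<tau> \<sigma> j"
      then have "absolutely_continuous_on_interval a b (\<phi> j)"
        using sol unfolding phase_solution_def locally_absolutely_continuous_on_def by blast
      then show "absolutely_continuous_on_interval a b (arc_val ?x j)"
        by (rule ac_transform) (use ab val in auto)
    qed
    show "arc_val ?x j t \<in> flow_set H" if t: "t \<in> phase \<tau> \<sigma> j" "\<exists>s\<in>phase \<tau> \<sigma> j. t < s" for j t
    proof -
      have "\<tau> j \<le> ereal t \<and> ereal t < \<sigma> j"
        using t by (auto simp: phase_def intro: less_le_trans[of _ "ereal _"])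
      then show ?thesis using sol val[OF t(1)] unfolding phase_solution_def by auto
    qed
    show "arc_val ?x j t \<in> jump_set H" "arc_val ?x (Suc j) t \<in> jump_map H (arc_val ?x j t)"
      if t: "t \<in> phase \<tau> \<sigma> j \<and> t \<in> phase \<tau> \<sigma> (Suc j)" for t j
    proof -
      obtain b where b: "\<tau> (Suc j) = ereal b" "\<sigma> j = ereal b" "b \<le> t"
        using phase_times_Suc_real[OF pt conjunct2[OF t]] by metis
      with t have "b = t" by (auto simp: phase_def)
      with b sol have "\<phi> j t \<in> jump_set H \<and> \<phi> (Suc j) t \<in> jump_map H (\<phi> j t)"
        unfolding phase_solution_def by blast
      then show "arc_val ?x j t \<in> jump_set H" "arc_val ?x (Suc j) t \<in> jump_map H (arc_val ?x j t)"
        using val t by auto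
    qed
    fix j
    have "AE t in lebesgue. \<tau> j < ereal t \<and> ereal t < \<sigma> j \<longrightarrow>
          (\<exists>v\<in>flow_map H (\<phi> j t). (\<phi> j has_vector_derivative v) (at t))"
      using sol unfolding phase_solution_def by blast
    moreover have "AE t in lebesgue. t \<in> phase \<tau> \<sigma> j \<longrightarrow> t \<in> interior (phase \<tau> \<sigma> j)"
      using AE_convex_interior[OF local_time_domain_convex_level[OF loc, of j]]
      by (simp add: arc_interval_phase_arc)
    ultimately show "AE t in lebesgue. t \<in> phase \<tau> \<sigma> j \<longrightarrow> (\<exists>v\<in>flow_map H (arc_val ?x j t).
              (arc_val ?x j has_vector_derivative v) (at t within phase \<tau> \<sigma> j))"
    proof eventually_elim
      case (elim t)
      show ?case
      proof
        assume t: "t \<in> phase \<tau> \<sigma> j"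
        with elim obtain e where e: "e > 0" "ball t e \<subseteq> phase \<tau> \<sigma> j" by (meson mem_interior)
        have "t - e/2 \<in> phase \<tau> \<sigma> j" "t + e/2 \<in> phase \<tau> \<sigma> j"
          using e by (auto simp: dist_real_def subset_iff)
        then have "\<tau> j \<le> ereal (t - e/2)" "ereal (t + e/2) \<le> \<sigma> j" by (auto simp: phase_def)
        then have "\<tau> j < ereal t \<and> ereal t < \<sigma> j"
          using e(1) by (auto intro: le_less_trans[of _ "ereal (t - e/2)"] less_le_trans[of _ "ereal (t + e/2)"])
        with elim obtain v where v: "v \<in> flow_map H (\<phi> j t)" "(\<phi> j has_vector_derivative v) (at t)" by blast
        have "(arc_val ?x j has_vector_derivative v) (at t)"
          by (rule has_vector_derivative_transform_within_open[OF v(2), of "ball t e"])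
             (use e val in auto)
        then show "\<exists>v\<in>flow_map H (arc_val ?x j t).
              (arc_val ?x j has_vector_derivative v) (at t within phase \<tau> \<sigma> j)"
          using v(1) val[OF t] by (auto intro: has_vector_derivative_at_within)
      qed
    qed
  qed
qed

text \<open>The conditions on a solution do not depend on absolute time or on the number of past
  jumps, so the segment between two hybrid times can be cut out and its clock reset to
  \<open>(0, 0)\<close>. The four facts about \<open>x\<close> let every property of
  \<open>x\<close> on the segment be read off from \<open>\<phi>\<close>.\<close>

lemma solution_segment_phases:
  assumes sol: "solution H x" and si: "(s, i) \<in> dom x" and tj: "(t, j) \<in> dom x" 
    and le: "s \<le> t" "i \<le> j"
  obtains \<tau> \<sigma> \<phi> where "phase_solution H \<tau> \<sigma> \<phi>"
    "\<And>m r. r \<in> phase \<tau> \<sigma> m \<Longrightarrow> x (s + r, i + m) = Some (\<phi> m r) \<and> 0 \<le> r \<and> s + r \<le> t \<and> i + m \<le> j"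
    "0 \<in> phase \<tau> \<sigma> 0" "t - s \<in> phase \<tau> \<sigma> (j - i)"
proof -
  have loc: "local_time_domain (dom x)" 
    by (rule solution_local_time_domain[OF sol]) (use si in blast)
  obtain b where b: "\<And>k. k < j \<Longrightarrow> (b k, k) \<in> dom x" "\<And>k. k < j \<Longrightarrow> (b k, Suc k) \<in> dom x"
    "\<And>k s. k < j \<Longrightarrow> (s, k) \<in> dom x \<Longrightarrow> s \<le> b k" "\<And>k s. k < j \<Longrightarrow> (s, Suc k) \<in> dom x \<Longrightarrow> b k \<le> s"
    using local_time_domain_boundaries[OF loc local_time_domain_levels[OF loc tj]] by blast
  define n where "n = j - i"
  have jn: "j = i + n" using le by (simp add: n_def)
  \<comment> \<open>\<open>e m\<close> and \<open>a m\<close> are the end and the start of the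
    \<open>m\<close>-th phase of the segment on the old clock: the switching times of
    \<open>x\<close>, except that the last end is \<open>t\<close> and the first start is
    \<open>s\<close>.\<close>
  define e where "e m = (if m < n then b (i + m) else t)" for m
  define a where "a m = (case m of 0 \<Rightarrow> s | Suc k \<Rightarrow> e k)" for m
  have a_dom: "(a m, i + m) \<in> dom x" if "m \<le> n" for m
    using that b(2) si by (cases m) (auto simp: a_def e_def jn)
  have e_dom: "(e m, i + m) \<in> dom x" if "m \<le> n" for m
    using that b(1) tj by (cases "m = n") (auto simp: e_def jn)
  have ae: "a m \<le> e m" if "m \<le> n" for m
  proof (cases "m < n")
    case True then show ?thesis using b(3)[of "i + m" "a m"] a_dom[of m] by (simp add: e_def jn)
  next
    case False
    then have "m = n" using that by simp
    then show ?thesis using le b(4)[of "i + (n - 1)" t] tj 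
      by (cases m) (auto simp: a_def e_def jn)
  qed
  have sa: "s \<le> a m" if "m \<le> n" for m
    using that
  proof (induction m)
    case (Suc m) then show ?case using ae[of m] by (simp add: a_def)
  qed (simp add: a_def)
  have et: "e m \<le> t" if "m \<le> n" for m
  proof -
    \<comment> \<open>The induction runs backwards from the last phase: each end is the next start
      and hence at most the next end.\<close>
    have "e (n - k) \<le> t" if "k \<le> n" for k
      using that
    proof (induction k)
      case (Suc k)
      then have "e (n - Suc k) = a (n - k)" by (auto simp: a_def split: nat.split)
        (metis Suc_diff_Suc Suc_le_lessD diff_Suc_Suc diff_is_0_eq nat.inject not_less_eq_eq old.nat.distinct(2))
      then show ?case using ae[of "n - k"] Suc by simp
    qed (simp add: e_def)
    from this[of "n - m"] that show ?thesis by simp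
  qed
  define \<tau> where "\<tau> m = (if m \<le> n then ereal (a m - s) else \<infinity>)" for m
  define \<sigma> where "\<sigma> m = (if m \<le> n then ereal (e m - s) else \<infinity>)" for m
  define \<phi> where "\<phi> m r = arc_val x (i + m) (r + s)" for m r
  have ph: "r \<in> phase \<tau> \<sigma> m \<longleftrightarrow> m \<le> n \<and> a m \<le> r + s \<and> r + s \<le> e m" for r m
    by (auto simp: phase_def \<tau>_def \<sigma>_def)
  have ph_dom: "(r + s, i + m) \<in> dom x" if "r \<in> phase \<tau> \<sigma> m" for r m
    using that local_time_domainD(3)[OF loc a_dom e_dom] unfolding ph by blast
  have "phase_solution H \<tau> \<sigma> \<phi>"
    unfolding phase_solution_def
  proof (intro conjI allI impI)
    show "phase_times \<tau> \<sigma>"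
      unfolding phase_times_def using ae by (auto simp: \<tau>_def \<sigma>_def a_def zero_ereal_def)
    fix m
    show "locally_absolutely_continuous_on (phase \<tau> \<sigma> m) (\<phi> m)"
      unfolding locally_absolutely_continuous_on_def
    proof (intro allI impI)
      fix c d assume cd: "c \<le> d \<and> {c..d} \<subseteq> phase \<tau> \<sigma> m"
      have "u \<in> arc_interval x (i + m)" if "u \<in> {c + s..d + s}" for u
      proof -
        have "u - s \<in> phase \<tau> \<sigma> m" using cd that by (auto simp: subset_iff)
        from ph_dom[OF this] show ?thesis by (simp add: arc_interval_def)
      qed
      then have "absolutely_continuous_on_interval (c + s) (d + s) (arc_val x (i + m))"
        using solutionD(2)[OF sol, of "i + m"] cd unfolding locally_absolutely_continuous_on_def
        by (simp add: subset_iff)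
      then show "absolutely_continuous_on_interval c d (\<phi> m)"
        unfolding \<phi>_def by (rule ac_shift)
    qed
    show "\<phi> m r \<in> flow_set H" if r: "\<tau> m \<le> ereal r \<and> ereal r < \<sigma> m" for r
    proof -
      have m: "m \<le> n" using r by (auto simp: \<tau>_def split: if_splits)
      have "r \<in> phase \<tau> \<sigma> m" using r by (simp add: phase_def less_imp_le)
      from ph_dom[OF this] e_dom[OF m] r m show ?thesis
        unfolding \<phi>_def by (intro solutionD(4)[OF sol, of _ _ "e m"]) (auto simp: arc_interval_def \<sigma>_def)
    qed
    show "\<phi> m r \<in> jump_set H" "\<phi> (Suc m) r \<in> jump_map H (\<phi> m r)" if r: "\<tau> (Suc m) = ereal r" for r
    proof -
      have m: "Suc m \<le> n" "r + s = a (Suc m)" using r by (auto simp: \<tau>_def split: if_splits)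
      then have "(r + s, Suc (i + m)) \<in> dom x" "(r + s, i + m) \<in> dom x"
        using a_dom[of "Suc m"] e_dom[of m] by (auto simp: a_def)
      then show "\<phi> m r \<in> jump_set H" "\<phi> (Suc m) r \<in> jump_map H (\<phi> m r)"
        using solutionD(5,6)[OF sol, of "r + s" "i + m"] by (auto simp: \<phi>_def)
    qed
    show "AE r in lebesgue. \<tau> m < ereal r \<and> ereal r < \<sigma> m \<longrightarrow>
          (\<exists>v\<in>flow_map H (\<phi> m r). (\<phi> m has_vector_derivative v) (at r))"
    proof (cases "m \<le> n \<and> a m < e m")
      case False
      then have "\<not> (\<tau> m < ereal r \<and> ereal r < \<sigma> m)" for r by (auto simp: \<tau>_def \<sigma>_def)
      then show ?thesis by auto
    next
      case True
      let ?I = "arc_interval x (i + m)"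
      have sub: "{a m<..<e m} \<subseteq> interior ?I"
        using local_time_domainD(3)[OF loc a_dom[of m] e_dom[of m]] True
        unfolding arc_interval_def by (intro interior_maximal subsetI) (simp_all add: less_imp_le)
      have "(a m + e m) / 2 \<in> {a m<..<e m}" using True by auto
      with sub have "interior ?I \<noteq> {}" by blast
      from AE_lebesgue_translate[OF solutionD(3)[OF sol this], of s] show ?thesis
      proof eventually_elim
        case (elim r)
        show ?case
        proof
          assume "\<tau> m < ereal r \<and> ereal r < \<sigma> m"
          then have "r + s \<in> {a m<..<e m}" using True by (auto simp: \<tau>_def \<sigma>_def)
          with sub have i: "r + s \<in> interior ?I" by blast
          then have "r + s \<in> ?I" using interior_subset by blast
          with elim obtain v where v: "v \<in> flow_map H (\<phi> m r)" 
            "(arc_val x (i + m) has_vector_derivative v) (at (r + s) within ?I)"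
            unfolding \<phi>_def by blast
          have "(arc_val x (i + m) has_vector_derivative v) (at (r + s))"
            using v(2) at_within_interior[OF i] by simp
          moreover have "((\<lambda>r. r + s) has_vector_derivative 1) (at r)"
            by (auto intro!: derivative_eq_intros)
          ultimately have "(\<phi> m has_vector_derivative v) (at r)"
            using vector_diff_chain_at[of "\<lambda>r. r + s" 1 r "arc_val x (i + m)" v]
            unfolding \<phi>_def comp_def by simp
          with v(1) show "\<exists>v\<in>flow_map H (\<phi> m r). (\<phi> m has_vector_derivative v) (at r)" by blast
        qed
      qed
    qed
  qed
  moreover have "x (s + r, i + m) = Some (\<phi> m r) \<and> 0 \<le> r \<and> s + r \<le> t \<and> i + m \<le> j" if r: "r \<in> phase \<tau> \<sigma> m" for m r
  proof -
    have "m \<le> n" "a m \<le> r + s" "r + s \<le> e m" using r unfolding ph by auto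
    moreover have "x (s + r, i + m) = Some (\<phi> m r)"
      using ph_dom[OF r] unfolding \<phi>_def by (auto simp: add.commute)
    ultimately show ?thesis using sa[of m] et[of m] by (auto simp: jn)
  qed
  moreover have "0 \<in> phase \<tau> \<sigma> 0" using ae[of 0] by (simp add: ph) (simp add: a_def)
  moreover have "t - s \<in> phase \<tau> \<sigma> (j - i)" using ae[of n] unfolding ph n_def[symmetric] by (simp add: e_def)
  ultimately show thesis by (rule that)
qed

section \<open>Compactness of the solution space\<close>

lemma locally_bounded_on_compact:
  assumes lb: "locally_bounded_on S M" and K: "compact K" "K \<subseteq> S"
  shows "bounded (\<Union>x\<in>K. M x)"
proof -
  have "\<forall>x\<in>S. \<exists>U. open U \<and> x \<in> U \<and> bounded (\<Union>y\<in>U \<inter> S. M y)"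
    using lb unfolding locally_bounded_on_def .
  then obtain U where U: "\<And>x. x \<in> S \<Longrightarrow> open (U x)" "\<And>x. x \<in> S \<Longrightarrow> x \<in> U x"
    "\<And>x. x \<in> S \<Longrightarrow> bounded (\<Union>y\<in>U x \<inter> S. M y)" by metis
  have "open (U x)" if "x \<in> K" for x using that U(1) K(2) by blast
  moreover have "K \<subseteq> (\<Union>x\<in>K. U x)" using U(2) K(2) by blast
  ultimately obtain D where D: "D \<subseteq> K" "finite D" "K \<subseteq> (\<Union>x\<in>D. U x)"
    by (rule compactE_image[OF K(1)])
  have "bounded (\<Union>x\<in>D. \<Union>y\<in>U x \<inter> S. M y)"
    using D(1,2) K(2) U(3) by (intro bounded_UN) auto
  then show ?thesis
    by (rule bounded_subset) (use D(3) K(2) in blast)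
qed

lemma outer_semicontinuous_eventually:
  assumes "outer_semicontinuous M" "\<forall>\<^sub>F n in sequentially. Y n \<in> M (X n)" "X \<longlonglongrightarrow> x" "Y \<longlonglongrightarrow> y"
  shows "y \<in> M x"
proof -
  obtain N where N: "\<And>n. n \<ge> N \<Longrightarrow> Y n \<in> M (X n)" using assms(2) by (auto simp: eventually_sequentially)
  have "\<forall>n. Y (n + N) \<in> M (X (n + N))" using N by simp
  moreover have "(\<lambda>n. X (n + N)) \<longlonglongrightarrow> x" "(\<lambda>n. Y (n + N)) \<longlonglongrightarrow> y"
    using assms(3,4) by (auto intro: LIMSEQ_ignore_initial_segment)
  ultimately show ?thesis
    using assms(1)[unfolded outer_semicontinuous_def, THEN spec, THEN spec, THEN spec, THEN spec,
        of "\<lambda>n. Y (n + N)" "\<lambda>n. X (n + N)" x y] by simp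
qed

lemma outer_semicontinuous_closed:
  assumes "outer_semicontinuous M"
  shows "closed (M x)"
  unfolding closed_sequential_limits
proof (intro allI impI)
  fix Y y assume "(\<forall>n. Y n \<in> M x) \<and> Y \<longlonglongrightarrow> y"
  then show "y \<in> M x"
    by (intro outer_semicontinuous_eventually[OF assms, of Y "\<lambda>_. x"]) auto
qed

text \<open>Local boundedness upgrades outer to upper semicontinuity: values violating the claim at
  points tending to \<open>x\<close> stay bounded, so a subsequence converges, and its limit lies in
  \<open>M x\<close> by outer semicontinuity although it should keep distance \<open>\<eta>\<close>
  from that set.\<close>

lemma outer_semicontinuous_upper:
  fixes M :: "'a::euclidean_space \<Rightarrow> 'b::euclidean_space set"
  assumes osc: "outer_semicontinuous M" and lb: "locally_bounded_on S M" and x: "x \<in> S" and \<eta>: "\<eta> > 0"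
  obtains \<rho> where "\<rho> > 0" "\<And>z w. z \<in> S \<Longrightarrow> dist z x < \<rho> \<Longrightarrow> w \<in> M z \<Longrightarrow> \<exists>a\<in>M x. dist a w < \<eta>"
proof -
  have "\<exists>\<rho>>0. \<forall>z\<in>S. dist z x < \<rho> \<longrightarrow> (\<forall>w\<in>M z. \<exists>a\<in>M x. dist a w < \<eta>)"
  proof (rule ccontr)
    assume "\<not> ?thesis"
    then have neg: "\<exists>z w. z \<in> S \<and> dist z x < inverse (real (Suc n)) \<and> w \<in> M z \<and> (\<forall>a\<in>M x. \<not> dist a w < \<eta>)" for n
      by (meson inverse_positive_iff_positive of_nat_0_less_iff zero_less_Suc)
    then obtain Z W where Z: "\<And>n. Z n \<in> S" "\<And>n. dist (Z n) x < inverse (real (Suc n))"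
      and W: "\<And>n. W n \<in> M (Z n)" "\<And>n a. a \<in> M x \<Longrightarrow> \<not> dist a (W n) < \<eta>" by metis
    have Zx: "Z \<longlonglongrightarrow> x"
    proof (rule metric_tendsto_imp_tendsto[OF LIMSEQ_inverse_real_of_nat])
      show "\<forall>\<^sub>F n in sequentially. dist (Z n) x \<le> dist (inverse (real (Suc n))) 0"
        using Z(2) by (auto intro!: always_eventually less_imp_le simp: dist_real_def)
    qed
    obtain U where U: "open U" "x \<in> U" "bounded (\<Union>y\<in>U \<inter> S. M y)"
      using lb x unfolding locally_bounded_on_def by blast
    obtain N where N: "\<And>n. n \<ge> N \<Longrightarrow> Z n \<in> U"
      using topological_tendstoD[OF Zx U(1,2)] by (auto simp: eventually_sequentially)
    have "bounded (range (\<lambda>n. W (n + N)))"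
      by (rule bounded_subset[OF U(3)]) (use N W(1) Z(1) in fastforce)
    then obtain w r where r: "strict_mono r" "((\<lambda>n. W (n + N)) \<circ> r) \<longlonglongrightarrow> w"
      using bounded_imp_convergent_subsequence by blast
    have "(\<lambda>n. Z (r n + N)) \<longlonglongrightarrow> x"
      using LIMSEQ_subseq_LIMSEQ[OF LIMSEQ_ignore_initial_segment[OF Zx, of N] r(1)] by (simp add: comp_def)
    then have "w \<in> M x"
      using r(2) W(1) by (intro outer_semicontinuous_eventually[OF osc, of "\<lambda>n. W (r n + N)" "\<lambda>n. Z (r n + N)"])
        (auto simp: comp_def)
    moreover have "\<forall>\<^sub>F n in sequentially. dist (W (r n + N)) w < \<eta>"
      using tendstoD[OF r(2) \<eta>] by (simp add: comp_def)
    then obtain n where "dist (W (r n + N)) w < \<eta>" by (auto simp: eventually_sequentially)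
    ultimately show False using W(2)[of w "r n + N"] by (simp add: dist_commute)
  qed
  then show thesis using that by blast
qed

text \<open>The compactness hypothesis concerns sequences drawn from each
  \<open>range (f i)\<close>, which covers both curves with values in a compact set, indexed by
  phase and rational time, and phase times in the compact extended line.\<close>

lemma diagonal_subsequence:
  fixes f :: "'i::countable \<Rightarrow> nat \<Rightarrow> 'b::topological_space"
  assumes "\<And>i X. (\<And>k. X k \<in> range (f i)) \<Longrightarrow> \<exists>l r. strict_mono (r :: nat \<Rightarrow> nat) \<and> (X \<circ> r) \<longlonglongrightarrow> l"
  obtains r :: "nat \<Rightarrow> nat" where "strict_mono r" "\<And>i. \<exists>l. (\<lambda>k. f i (r k)) \<longlonglongrightarrow> l"
proof -
  interpret subseqs "\<lambda>n s. \<forall>i::'i. to_nat i = n \<longrightarrow> (\<exists>l. (\<lambda>k. f i (s k)) \<longlonglongrightarrow> l)"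
  proof
    fix n :: nat and s :: "nat \<Rightarrow> nat" assume "strict_mono s"
    show "\<exists>r'. strict_mono r' \<and> (\<forall>i::'i. to_nat i = n \<longrightarrow> (\<exists>l. (\<lambda>k. f i ((s \<circ> r') k)) \<longlonglongrightarrow> l))"
    proof (cases "\<exists>i::'i. to_nat i = n")
      case True
      then obtain i :: 'i where i: "to_nat i = n" by blast
      obtain l r where r: "strict_mono r" "((\<lambda>k. f i (s k)) \<circ> r) \<longlonglongrightarrow> l"
        using assms[of "\<lambda>k. f i (s k)" i] by blast
      have "\<forall>j::'i. to_nat j = n \<longrightarrow> (\<exists>l. (\<lambda>k. f j ((s \<circ> r) k)) \<longlonglongrightarrow> l)"
      proof (intro allI impI)
        fix j :: 'i assume "to_nat j = n"
        with i have "j = i" by (metis to_nat_split)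
        with r(2) show "\<exists>l. (\<lambda>k. f j ((s \<circ> r) k)) \<longlonglongrightarrow> l" by (auto simp: comp_def)
      qed
      with r(1) show ?thesis by blast
    next
      case False then show ?thesis using strict_mono_id by blast
    qed
  qed
  show thesis
  proof (rule that[OF subseq_diagseq])
    fix i :: 'i
    have "\<forall>i'::'i. to_nat i' = to_nat i \<longrightarrow> (\<exists>l. (\<lambda>k. f i' ((diagseq \<circ> (+) (Suc (to_nat i))) k)) \<longlonglongrightarrow> l)"
    proof (rule diagseq_holds)
      fix r s :: "nat \<Rightarrow> nat" and n :: nat
      assume "strict_mono r" and h: "\<forall>i::'i. to_nat i = n \<longrightarrow> (\<exists>l. (\<lambda>k. f i (s k)) \<longlonglongrightarrow> l)"
      show "\<forall>i::'i. to_nat i = n \<longrightarrow> (\<exists>l. (\<lambda>k. f i ((s \<circ> r) k)) \<longlonglongrightarrow> l)"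
      proof (intro allI impI)
        fix i :: 'i assume "to_nat i = n"
        with h obtain l where "(\<lambda>k. f i (s k)) \<longlonglongrightarrow> l" by blast
        from LIMSEQ_subseq_LIMSEQ[OF this \<open>strict_mono r\<close>]
        show "\<exists>l. (\<lambda>k. f i ((s \<circ> r) k)) \<longlonglongrightarrow> l" by (auto simp: comp_def)
      qed
    qed
    then obtain l where "(\<lambda>k. f i (diagseq (k + Suc (to_nat i)))) \<longlonglongrightarrow> l"
      by (auto simp: comp_def add.commute)
    \<comment> \<open>The diagonal sequence is a subsequence of the one chosen for \<open>i\<close>
      only after \<open>Suc (to_nat i)\<close> terms; the finite offset does not affect the
      limit.\<close>
    then have "(\<lambda>k. f i (diagseq k)) \<longlonglongrightarrow> l" by (rule LIMSEQ_offset)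
    then show "\<exists>l. (\<lambda>k. f i (diagseq k)) \<longlonglongrightarrow> l" by blast
  qed
qed

text \<open>The Arzela-Ascoli argument, with pointwise convergence as its conclusion: a diagonal
  subsequence converges at all rational times, and the common Lipschitz constant makes it Cauchy at
  every real time.\<close>

lemma equilipschitz_convergent_subsequence:
  fixes f :: "nat \<Rightarrow> nat \<Rightarrow> real \<Rightarrow> 'a::euclidean_space"
  assumes lip: "\<And>k j t u. norm (f k j t - f k j u) \<le> L * \<bar>t - u\<bar>"
    and K: "compact K" "\<And>k j t. f k j t \<in> K"
  obtains r g where "strict_mono (r :: nat \<Rightarrow> nat)" "\<And>j t. (\<lambda>k. f (r k) j t) \<longlonglongrightarrow> g j t"
proof -
  define F where "F p k = f k (fst p) (of_rat (snd p))" for p :: "nat \<times> rat" and k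
  obtain r where r: "strict_mono r" "\<And>p. \<exists>l. (\<lambda>k. F p (r k)) \<longlonglongrightarrow> l"
  proof (rule diagonal_subsequence[of F])
    fix p and X :: "nat \<Rightarrow> 'a" assume X: "\<And>k. X k \<in> range (F p)"
    have "range (F p) \<subseteq> K" using K(2) by (auto simp: F_def)
    then have "\<forall>k. X k \<in> K" using X by blast
    with K(1) show "\<exists>l r. strict_mono (r :: nat \<Rightarrow> nat) \<and> (X \<circ> r) \<longlonglongrightarrow> l"
      unfolding compact_def by metis
  qed blast
  have "\<exists>l. (\<lambda>k. f (r k) j t) \<longlonglongrightarrow> l" for j t
  proof -
    have "Cauchy (\<lambda>k. f (r k) j t)"
    proof (rule metric_CauchyI)
      fix e :: real assume e: "0 < e"
      \<comment> \<open>One third of \<open>e\<close> goes into each of the two moves to the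
        rational time \<open>q\<close>, and one into the Cauchy estimate there;
        \<open>\<bar>L\<bar> + 1\<close> is positive whatever \<open>L\<close> is.\<close>
      define d where "d = e / (3 * (\<bar>L\<bar> + 1))"
      have d: "d > 0" using e by (simp add: d_def)
      obtain q where q: "t < of_rat q" "of_rat q < t + d" using of_rat_dense[of t "t + d"] d by auto
      have near: "dist (f k j t) (f k j (of_rat q)) < e / 3" for k
      proof -
        have "dist (f k j t) (f k j (of_rat q)) \<le> L * \<bar>t - of_rat q\<bar>" using lip by (simp add: dist_norm)
        also have "\<dots> \<le> (\<bar>L\<bar> + 1) * \<bar>t - of_rat q\<bar>" by (intro mult_right_mono) auto
        also have "\<dots> < (\<bar>L\<bar> + 1) * d" using q by (intro mult_strict_left_mono) auto
        also have "\<dots> = e / 3" by (simp add: d_def field_simps)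
        finally show ?thesis .
      qed
      have "Cauchy (\<lambda>k. f (r k) j (of_rat q))"
        using r(2)[of "(j, q)"] by (auto simp: F_def intro: LIMSEQ_imp_Cauchy)
      then obtain N where N: "\<And>m n. m \<ge> N \<Longrightarrow> n \<ge> N \<Longrightarrow> dist (f (r m) j (of_rat q)) (f (r n) j (of_rat q)) < e / 3"
        using metric_CauchyD[of "\<lambda>k. f (r k) j (of_rat q)" "e / 3"] e by auto
      have "dist (f (r m) j t) (f (r n) j t) < e" if "m \<ge> N" "n \<ge> N" for m n
        using near[of "r m"] near[of "r n"] N[OF that]
          dist_triangle[of "f (r m) j t" "f (r n) j t" "f (r m) j (of_rat q)"]
          dist_triangle[of "f (r m) j (of_rat q)" "f (r n) j t" "f (r n) j (of_rat q)"]
          dist_commute[of "f (r n) j t" "f (r n) j (of_rat q)"] by linarith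
      then show "\<exists>M. \<forall>m\<ge>M. \<forall>n\<ge>M. dist (f (r m) j t) (f (r n) j t) < e" by blast
    qed
    then show ?thesis by (simp add: Cauchy_convergent_iff convergent_def)
  qed
  then obtain g where "\<And>j t. (\<lambda>k. f (r k) j t) \<longlonglongrightarrow> g j t" by metis
  with r(1) show thesis by (rule that)
qed

text \<open>Phase times may escape to infinity, but the extended line is sequentially compact, so no
  bound on them is required.\<close>

lemma ereal_convergent_subsequence:
  fixes f :: "nat \<Rightarrow> nat \<Rightarrow> ereal"
  obtains r g where "strict_mono (r :: nat \<Rightarrow> nat)" "\<And>j. (\<lambda>k. f (r k) j) \<longlonglongrightarrow> g j"
proof -
  obtain r :: "nat \<Rightarrow> nat" where r: "strict_mono r" "\<And>j::nat. \<exists>l. (\<lambda>k. f (r k) j) \<longlonglongrightarrow> l"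
    by (rule diagonal_subsequence[of "\<lambda>j k. f k j"]) (use compact_complete_linorder in blast)+
  then obtain g where "\<And>j. (\<lambda>k. f (r k) j) \<longlonglongrightarrow> g j" by metis
  with r(1) show thesis by (rule that)
qed

section \<open>Uniform Lipschitz bounds and passage to the limit\<close>

lemma phase_solution_lipschitz:
  assumes sol: "phase_solution H \<tau> \<sigma> \<phi>" 
    and M: "\<And>x v. x \<in> K \<inter> flow_set H \<Longrightarrow> v \<in> flow_map H x \<Longrightarrow> norm v \<le> M"
    and K: "\<And>t. t \<in> phase \<tau> \<sigma> j \<Longrightarrow> \<phi> j t \<in> K"
    and st: "s \<in> phase \<tau> \<sigma> j" "t \<in> phase \<tau> \<sigma> j"
  shows "norm (\<phi> j t - \<phi> j s) \<le> M * \<bar>t - s\<bar>"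
proof -
  have *: "norm (\<phi> j t - \<phi> j s) \<le> M * (t - s)" if st: "s \<in> phase \<tau> \<sigma> j" "t \<in> phase \<tau> \<sigma> j" "s \<le> t" for s t
  proof (rule ac_bounded_deriv_lipschitz)
    have lt: "\<tau> j < ereal u \<and> ereal u < \<sigma> j" if "s < u" "u < t" for u
    proof -
      have "\<tau> j \<le> ereal s" "ereal s < ereal u" "ereal u < ereal t" "ereal t \<le> \<sigma> j"
        using st that by (auto simp: phase_def)
      then show ?thesis by (meson le_less_trans less_le_trans)
    qed
    have "{s..t} \<subseteq> phase \<tau> \<sigma> j"
      using st lt by (fastforce simp: phase_def le_less)
    then show "absolutely_continuous_on_interval s t (\<phi> j)"
      using sol st(3) unfolding phase_solution_def locally_absolutely_continuous_on_def by blast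
    have "AE u in lebesgue. \<tau> j < ereal u \<and> ereal u < \<sigma> j \<longrightarrow>
          (\<exists>v\<in>flow_map H (\<phi> j u). (\<phi> j has_vector_derivative v) (at u))"
      using sol unfolding phase_solution_def by blast
    then show "AE u in lebesgue. s < u \<and> u < t \<longrightarrow> (\<exists>v. norm v \<le> M \<and> (\<phi> j has_vector_derivative v) (at u))"
    proof eventually_elim
      case (elim u)
      show ?case
      proof
        assume "s < u \<and> u < t"
        then have u: "\<tau> j < ereal u \<and> ereal u < \<sigma> j" using lt by blast
        then have "\<phi> j u \<in> K \<inter> flow_set H"
          using K[of u] sol unfolding phase_solution_def phase_def by (auto simp: less_imp_le)
        with elim u M show "\<exists>v. norm v \<le> M \<and> (\<phi> j has_vector_derivative v) (at u)" by blast
      qed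
    qed
  qed (fact st(3))
  show ?thesis
    using *[of s t] *[of t s] st by (cases "s \<le> t") (auto simp: norm_minus_commute abs_if)
qed

lemma closed_convex_phase:
  "closed (phase \<tau> \<sigma> j)" "convex (phase \<tau> \<sigma> j)"
proof -
  have "phase \<tau> \<sigma> j = ereal -` {\<tau> j..\<sigma> j}" by (auto simp: phase_def)
  then show "closed (phase \<tau> \<sigma> j)" 
    by (simp add: closed_vimage continuous_on_ereal[OF continuous_on_id])
  show "convex (phase \<tau> \<sigma> j)"
    unfolding is_interval_convex_1[symmetric] is_interval_1 phase_def
    by (auto intro: order_trans[of _ "ereal _"])
qed

lemma phase_points_converge:
  assumes pt: "\<And>k. phase_times (\<tau> k) (\<sigma> k)"
    and lim: "(\<lambda>k. \<tau> k j) \<longlonglongrightarrow> a" "(\<lambda>k. \<sigma> k j) \<longlonglongrightarrow> b" and t: "a \<le> ereal t" "ereal t \<le> b"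
  obtains u where "\<forall>\<^sub>F k in sequentially. u k \<in> phase (\<tau> k) (\<sigma> k) j" "u \<longlonglongrightarrow> t"
    "ereal t < b \<Longrightarrow> \<forall>\<^sub>F k in sequentially. ereal (u k) < \<sigma> k j"
proof -
  \<comment> \<open>\<open>w k\<close> is \<open>t\<close> clamped to the \<open>k\<close>-th phase
    interval. Clamping is continuous in the end points, so \<open>w\<close> tends to
    \<open>t\<close>; since \<open>t\<close> is finite, \<open>w k\<close> is eventually a real
    number.\<close>
  define w where "w k = max (\<tau> k j) (min (ereal t) (\<sigma> k j))" for k
  have "w \<longlonglongrightarrow> max a (min (ereal t) b)"
    unfolding w_def by (intro tendsto_intros lim)
  then have w: "w \<longlonglongrightarrow> ereal t" using t by (simp add: max_def min_def)
  have "\<forall>\<^sub>F k in sequentially. ereal (t - 1) < w k" "\<forall>\<^sub>F k in sequentially. w k < ereal (t + 1)"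
    using order_tendstoD[OF w] by auto
  then have "\<forall>\<^sub>F k in sequentially. \<bar>w k\<bar> \<noteq> \<infinity>"
    by eventually_elim auto
  then have fin: "\<forall>\<^sub>F k in sequentially. ereal (real_of_ereal (w k)) = w k"
    by eventually_elim (auto simp: ereal_real)
  have le: "\<tau> k j \<le> \<sigma> k j" for k using pt[of k] by (simp add: phase_times_def)
  show thesis
  proof (rule that[of "\<lambda>k. real_of_ereal (w k)"])
    show "\<forall>\<^sub>F k in sequentially. real_of_ereal (w k) \<in> phase (\<tau> k) (\<sigma> k) j"
      using fin by eventually_elim (use le in \<open>simp add: phase_def w_def\<close>)
    show "(\<lambda>k. real_of_ereal (w k)) \<longlonglongrightarrow> t"
      by (rule lim_real_of_ereal[OF w])
    assume tb: "ereal t < b"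
    then obtain c where c: "ereal t < c" "c < b" using dense by blast
    show "\<forall>\<^sub>F k in sequentially. ereal (real_of_ereal (w k)) < \<sigma> k j"
      using fin order_tendstoD(2)[OF w c(1)] order_tendstoD(1)[OF lim(2) c(2)]
      by eventually_elim auto
  qed
qed

lemma phase_solution_value_jump:
  assumes "phase_solution H \<tau> \<sigma> \<phi>" "\<tau> (Suc j) = ereal t"
  shows "t \<in> phase \<tau> \<sigma> j" "t \<in> phase \<tau> \<sigma> (Suc j)" "\<sigma> j = ereal t"
    "\<phi> j t \<in> jump_set H" "\<phi> (Suc j) t \<in> jump_map H (\<phi> j t)"
proof -
  have "phase_times \<tau> \<sigma>" using assms(1) by (simp add: phase_solution_def)
  then have "\<tau> j \<le> \<sigma> j" "\<sigma> j = ereal t" "\<tau> (Suc j) \<le> \<sigma> (Suc j)"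
    using assms(2) unfolding phase_times_def by (metis PInfty_neq_ereal(1))+
  with assms(2) show "t \<in> phase \<tau> \<sigma> j" "t \<in> phase \<tau> \<sigma> (Suc j)" "\<sigma> j = ereal t"
    by (simp_all add: phase_def)
  show "\<phi> j t \<in> jump_set H" "\<phi> (Suc j) t \<in> jump_map H (\<phi> j t)"
    using assms unfolding phase_solution_def by blast+
qed

text \<open>Difference quotients of the approximating curves lie in a closed convex neighbourhood of
  \<open>flow_map H x\<close>; this passes to the limit curve, so no weak compactness argument for the
  derivatives is needed.\<close>

lemma limit_derivative_in_flow_map:
  fixes \<phi> :: "nat \<Rightarrow> real \<Rightarrow> 'a::euclidean_space"
  assumes H: "basic_assumptions H" 
    and h0: "h0 > 0"
    and ac: "\<And>h. 0 < h \<Longrightarrow> h < h0 \<Longrightarrow> \<forall>\<^sub>F k in sequentially. absolutely_continuous_on_interval t (t + h) (\<phi> k) \<and>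
       (AE s in lebesgue. t < s \<and> s < t + h \<longrightarrow> \<phi> k s \<in> flow_set H \<and>
          (\<exists>v\<in>flow_map H (\<phi> k s). (\<phi> k has_vector_derivative v) (at s)))
       \<and> (\<forall>s. t \<le> s \<and> s \<le> t + h \<longrightarrow> norm (\<phi> k s - \<phi> k t) \<le> L * \<bar>s - t\<bar>)"
    and lim: "\<And>s. t \<le> s \<Longrightarrow> s < t + h0 \<Longrightarrow> (\<lambda>k. \<phi> k s) \<longlonglongrightarrow> \<psi> s"
    and x: "\<psi> t \<in> flow_set H"
    and der: "(\<psi> has_vector_derivative v) (at t)"
  shows "v \<in> flow_map H (\<psi> t)"
proof -
  let ?F = "flow_map H (\<psi> t)"
  have osc: "outer_semicontinuous (flow_map H)" and lb: "locally_bounded_on (flow_set H) (flow_map H)"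
    and conv: "convex ?F" using H x by (auto simp: basic_assumptions_def)
  have closedF: "closed ?F" by (rule outer_semicontinuous_closed[OF osc])
  have "\<exists>a\<in>?F. dist a v \<le> \<eta>" if \<eta>: "\<eta> > 0" for \<eta>
  proof -
    obtain \<rho> where \<rho>: "\<rho> > 0" "\<And>z w. z \<in> flow_set H \<Longrightarrow> dist z (\<psi> t) < \<rho> \<Longrightarrow> w \<in> flow_map H z \<Longrightarrow> \<exists>a\<in>?F. dist a w < \<eta>"
      using outer_semicontinuous_upper[OF osc lb x \<eta>] by metis
    \<comment> \<open>The closed \<open>\<eta>\<close>-neighbourhood of the value set, written as a
      Minkowski sum: the sum of a closed convex and a compact convex set is closed and convex, as
      the mean value property requires.\<close>
    define Q where "Q = (\<Union>a\<in>?F. \<Union>b\<in>cball 0 \<eta>. {a + b})"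
    have Q: "closed Q" "convex Q"
      unfolding Q_def
      by (rule closed_compact_sums[OF closedF compact_cball], rule convex_sums[OF conv convex_cball])
    \<comment> \<open>For times within \<open>h1\<close> of \<open>t\<close> the Lipschitz bound
      moves the curve by less than \<open>\<rho> / 2\<close>; the other half of
      \<open>\<rho>\<close> is the distance of \<open>\<phi> k t\<close> from its limit. The curve
      then stays where the flow map is \<open>\<eta>\<close>-close to
      \<open>flow_map H (\<psi> t)\<close>.\<close>
    define h1 where "h1 = min h0 (\<rho> / (2 * (\<bar>L\<bar> + 1)))"
    have h1: "h1 > 0" using h0 \<rho>(1) by (simp add: h1_def)
    have quot: "(\<psi> (t + h) - \<psi> t) /\<^sub>R h \<in> Q" if h: "0 < h" "h < h1" for h
    proof (rule Lim_in_closed_set[OF Q(1)])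
      have hh0: "h < h0" using h by (simp add: h1_def)
      show "((\<lambda>k. (\<phi> k (t + h) - \<phi> k t) /\<^sub>R h) \<longlongrightarrow> (\<psi> (t + h) - \<psi> t) /\<^sub>R h) sequentially"
        by (intro tendsto_intros lim) (use h hh0 h0 in auto)
      have Lh: "L * \<bar>s - t\<bar> < \<rho> / 2" if "t < s" "s < t + h" for s
      proof -
        have "L * \<bar>s - t\<bar> \<le> (\<bar>L\<bar> + 1) * \<bar>s - t\<bar>" by (intro mult_right_mono) auto
        also have "\<dots> < (\<bar>L\<bar> + 1) * (\<rho> / (2 * (\<bar>L\<bar> + 1)))"
          using that h by (intro mult_strict_left_mono) (auto simp: h1_def)
        also have "\<dots> = \<rho> / 2" by (simp add: field_simps)
        finally show ?thesis .
      qed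
      have "\<forall>\<^sub>F k in sequentially. dist (\<phi> k t) (\<psi> t) < \<rho> / 2"
        using lim[of t] h0 \<rho>(1) by (intro tendstoD) auto
      then show "\<forall>\<^sub>F k in sequentially. (\<phi> k (t + h) - \<phi> k t) /\<^sub>R h \<in> Q"
        using ac[OF h(1) hh0]
      proof eventually_elim
        case (elim k)
        have near: "dist (\<phi> k s) (\<psi> t) < \<rho>" if s: "t < s" "s < t + h" for s
        proof -
          have "norm (\<phi> k s - \<phi> k t) \<le> L * \<bar>s - t\<bar>" using elim s by simp
          with Lh[OF s] have "dist (\<phi> k s) (\<phi> k t) < \<rho> / 2" by (simp add: dist_norm)
          with elim(1) show ?thesis using dist_triangle[of "\<phi> k s" "\<psi> t" "\<phi> k t"] by linarith
        qed
        have "AE s in lebesgue. t < s \<and> s < t + h \<longrightarrow> \<phi> k s \<in> flow_set H \<and>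
          (\<exists>v\<in>flow_map H (\<phi> k s). (\<phi> k has_vector_derivative v) (at s))" using elim by blast
        then have "AE s in lebesgue. t < s \<and> s < t + h \<longrightarrow> (\<exists>v\<in>Q. (\<phi> k has_vector_derivative v) (at s))"
        proof eventually_elim
          case (elim s)
          show ?case
          proof
            assume s: "t < s \<and> s < t + h"
            with elim obtain v where v: "v \<in> flow_map H (\<phi> k s)" "(\<phi> k has_vector_derivative v) (at s)"
              and C: "\<phi> k s \<in> flow_set H" by blast
            obtain a where a: "a \<in> ?F" "dist a v < \<eta>" using \<rho>(2)[OF C near v(1)] s by blast
            have "v = a + (v - a)" "v - a \<in> cball 0 \<eta>" using a(2) by (simp_all add: dist_norm norm_minus_commute)
            then have "v \<in> Q" using a(1) unfolding Q_def by blast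
            with v(2) show "\<exists>v\<in>Q. (\<phi> k has_vector_derivative v) (at s)" by blast
          qed
        qed
        then have "(\<phi> k (t + h) - \<phi> k t) /\<^sub>R (t + h - t) \<in> Q"
          by (intro ac_mean_value_convex Q) (use elim h in auto)
        then show ?case by simp
      qed
    qed simp
    \<comment> \<open>A two-sided derivative is in particular the limit of forward quotients, which
      are the ones controlled here.\<close>
    have "((\<lambda>h. (\<psi> (t + h) - \<psi> t) /\<^sub>R h) \<longlongrightarrow> v) (at_right 0)"
    proof -
      have "((\<lambda>h. norm (\<psi> (t + h) - \<psi> t - h *\<^sub>R v) / norm h) \<longlongrightarrow> 0) (at 0)"
        using der unfolding has_vector_derivative_def has_derivative_at by simp
      then have "((\<lambda>h. norm (\<psi> (t + h) - \<psi> t - h *\<^sub>R v) / norm h) \<longlongrightarrow> 0) (at_right 0)"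
        by (rule tendsto_mono[OF at_le, rotated]) simp
      moreover have "\<forall>\<^sub>F h in at_right 0. norm (\<psi> (t + h) - \<psi> t - h *\<^sub>R v) / norm h
          = norm ((\<psi> (t + h) - \<psi> t) /\<^sub>R h - v)"
        using eventually_at_right_less[of "0::real"]
      proof eventually_elim
        case (elim h)
        have "(\<psi> (t + h) - \<psi> t) /\<^sub>R h - v = (\<psi> (t + h) - \<psi> t - h *\<^sub>R v) /\<^sub>R h"
          using elim by (simp add: scaleR_diff_right)
        then show ?case using elim by (simp only: norm_scaleR) (simp add: divide_inverse)
      qed
      ultimately have "((\<lambda>h. norm ((\<psi> (t + h) - \<psi> t) /\<^sub>R h - v)) \<longlongrightarrow> 0) (at_right 0)"
        by (rule Lim_transform_eventually)
      then show ?thesis by (simp add: Lim_null[of _ v] tendsto_norm_zero_iff)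
    qed
    then have "v \<in> Q"
    proof (rule Lim_in_closed_set[OF Q(1), rotated 2])
      show "\<forall>\<^sub>F h in at_right 0. (\<psi> (t + h) - \<psi> t) /\<^sub>R h \<in> Q"
        unfolding eventually_at_right_field using quot h1 by auto
    qed simp
    then obtain a b where "v = a + b" "a \<in> ?F" "norm b \<le> \<eta>" unfolding Q_def by auto
    then show ?thesis by (intro bexI[of _ a]) (auto simp: dist_norm)
  qed
  then have "v \<in> closure ?F"
    unfolding closure_approachable by (meson dense le_less_trans)
  then show ?thesis using closedF by simp
qed

text \<open>Graphical convergence of the corresponding arcs.\<close>

definition phases_converge where
  "phases_converge \<tau> \<sigma> \<phi> \<tau>' \<sigma>' \<psi> \<longleftrightarrow> (\<forall>j. (\<lambda>k. \<tau> k j) \<longlonglongrightarrow> \<tau>' j) \<and> (\<forall>j. (\<lambda>k. \<sigma> k j) \<longlonglongrightarrow> \<sigma>' j) \<and>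
     (\<forall>j t u. (\<forall>\<^sub>F k in sequentially. u k \<in> phase (\<tau> k) (\<sigma> k) j) \<longrightarrow> u \<longlonglongrightarrow> t \<longrightarrow>
        (\<lambda>k. \<phi> k j (u k)) \<longlonglongrightarrow> \<psi> j t)"

lemma phases_convergeD:
  assumes "phases_converge \<tau> \<sigma> \<phi> \<tau>' \<sigma>' \<psi>"
  shows "(\<lambda>k. \<tau> k j) \<longlonglongrightarrow> \<tau>' j" "(\<lambda>k. \<sigma> k j) \<longlonglongrightarrow> \<sigma>' j"
    "\<forall>\<^sub>F k in sequentially. u k \<in> phase (\<tau> k) (\<sigma> k) j \<Longrightarrow> u \<longlonglongrightarrow> t \<Longrightarrow> (\<lambda>k. \<phi> k j (u k)) \<longlonglongrightarrow> \<psi> j t"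
  using assms unfolding phases_converge_def by blast+

lemma phases_converge_points:
  assumes "phases_converge \<tau> \<sigma> \<phi> \<tau>' \<sigma>' \<psi>" "\<And>k. phase_times (\<tau> k) (\<sigma> k)" "t \<in> phase \<tau>' \<sigma>' j"
  obtains u where "\<forall>\<^sub>F k in sequentially. u k \<in> phase (\<tau> k) (\<sigma> k) j" "u \<longlonglongrightarrow> t"
    "(\<lambda>k. \<phi> k j (u k)) \<longlonglongrightarrow> \<psi> j t"
proof -
  have t: "\<tau>' j \<le> ereal t" "ereal t \<le> \<sigma>' j" using assms(3) by (simp_all add: phase_def)
  obtain u where u: "\<forall>\<^sub>F k in sequentially. u k \<in> phase (\<tau> k) (\<sigma> k) j" "u \<longlonglongrightarrow> t"
    using phase_points_converge[of \<tau> \<sigma>, OF assms(2) phases_convergeD(1,2)[OF assms(1)] t] by blast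
  from that[OF u phases_convergeD(3)[OF assms(1) u]] show thesis .
qed

text \<open>Sequential compactness of bounded solutions. The flow map is bounded on
  \<open>K \<inter> flow_set H\<close>, which gives one Lipschitz constant for all phases;
  subsequences make curves and phase times converge, and closedness of the data carries the flow and
  jump conditions over to the limit.\<close>

theorem phase_solutions_convergent_subsequence:
  fixes H :: "'a::euclidean_space hybrid_system"
  assumes H: "basic_assumptions H"
    and sol: "\<And>k. phase_solution H (\<tau> k) (\<sigma> k) (\<phi> k)"
    and K: "compact K" "\<And>k j t. t \<in> phase (\<tau> k) (\<sigma> k) j \<Longrightarrow> \<phi> k j t \<in> K"
  obtains r \<tau>' \<sigma>' \<psi> where "strict_mono (r :: nat \<Rightarrow> nat)" "phase_solution H \<tau>' \<sigma>' \<psi>"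
    "phases_converge (\<lambda>k. \<tau> (r k)) (\<lambda>k. \<sigma> (r k)) (\<lambda>k. \<phi> (r k)) \<tau>' \<sigma>' \<psi>"
proof -
  have pt: "phase_times (\<tau> k) (\<sigma> k)" for k using sol[of k] by (simp add: phase_solution_def)
  have C: "closed (flow_set H)" "closed (jump_set H)" and oscG: "outer_semicontinuous (jump_map H)"
    using H by (auto simp: basic_assumptions_def)
  have "bounded (\<Union>x\<in>K \<inter> flow_set H. flow_map H x)"
    by (rule locally_bounded_on_compact[where S = "flow_set H"])
      (use H K(1) C(1) in \<open>auto simp: basic_assumptions_def intro: compact_Int_closed\<close>)
  then obtain M where M: "\<And>x v. x \<in> K \<inter> flow_set H \<Longrightarrow> v \<in> flow_map H x \<Longrightarrow> norm v \<le> M"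
    unfolding bounded_iff by blast
  have lip: "norm (\<phi> k j t - \<phi> k j s) \<le> \<bar>M\<bar> * \<bar>t - s\<bar>"
    if "s \<in> phase (\<tau> k) (\<sigma> k) j" "t \<in> phase (\<tau> k) (\<sigma> k) j" for k j s t
  proof -
    have "norm (\<phi> k j t - \<phi> k j s) \<le> M * \<bar>t - s\<bar>"
      by (rule phase_solution_lipschitz[OF sol M K(2) that])
    also have "\<dots> \<le> \<bar>M\<bar> * \<bar>t - s\<bar>" by (intro mult_right_mono) auto
    finally show ?thesis .
  qed
  \<comment> \<open>The domains of the curves vary with \<open>k\<close>, so each curve is extended
    to the whole line by composing it with the nearest-point projection onto its phase, which does
    not increase distances. Empty phases receive the value 0, whence \<open>insert 0 K\<close>
    below.\<close>
  define \<Phi> where "\<Phi> k j t = (if phase (\<tau> k) (\<sigma> k) j = {} then 0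
      else \<phi> k j (closest_point (phase (\<tau> k) (\<sigma> k) j) t))" for k j t
  have \<Phi>_eq: "\<Phi> k j t = \<phi> k j t" if "t \<in> phase (\<tau> k) (\<sigma> k) j" for k j t
    using that closest_point_self[OF that] by (auto simp: \<Phi>_def)
  have \<Phi>_lip: "norm (\<Phi> k j t - \<Phi> k j s) \<le> \<bar>M\<bar> * \<bar>t - s\<bar>" for k j s t
  proof (cases "phase (\<tau> k) (\<sigma> k) j = {}")
    case False
    let ?c = "closest_point (phase (\<tau> k) (\<sigma> k) j)"
    have mem: "?c u \<in> phase (\<tau> k) (\<sigma> k) j" for u
      by (rule closest_point_in_set[OF closed_convex_phase(1) False])
    have "norm (\<Phi> k j t - \<Phi> k j s) \<le> \<bar>M\<bar> * \<bar>?c t - ?c s\<bar>"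
      using lip[OF mem mem, of t s] False by (simp add: \<Phi>_def)
    also have "\<dots> \<le> \<bar>M\<bar> * \<bar>t - s\<bar>"
      using closest_point_lipschitz[OF closed_convex_phase(2,1) False, of t s]
      by (intro mult_left_mono) (auto simp: dist_real_def)
    finally show ?thesis .
  qed (simp add: \<Phi>_def)
  have \<Phi>_K: "\<Phi> k j t \<in> insert 0 K" for k j t
    using K(2)[OF closest_point_in_set[OF closed_convex_phase(1)]] by (auto simp: \<Phi>_def)
  obtain r1 \<psi> where r1: "strict_mono (r1 :: nat \<Rightarrow> nat)" "\<And>j t. (\<lambda>k. \<Phi> (r1 k) j t) \<longlonglongrightarrow> \<psi> j t"
    using equilipschitz_convergent_subsequence[of \<Phi> "\<bar>M\<bar>" "insert 0 K"] \<Phi>_lip \<Phi>_K K(1) by (metis compact_insert)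
  obtain r2 \<tau>' where r2: "strict_mono (r2 :: nat \<Rightarrow> nat)" "\<And>j. (\<lambda>k. \<tau> (r1 (r2 k)) j) \<longlonglongrightarrow> \<tau>' j"
    using ereal_convergent_subsequence[of "\<lambda>k. \<tau> (r1 k)"] by metis
  obtain r3 \<sigma>' where r3: "strict_mono (r3 :: nat \<Rightarrow> nat)" "\<And>j. (\<lambda>k. \<sigma> (r1 (r2 (r3 k))) j) \<longlonglongrightarrow> \<sigma>' j"
    using ereal_convergent_subsequence[of "\<lambda>k. \<sigma> (r1 (r2 k))"] by metis
  define r where "r = r1 \<circ> (r2 \<circ> r3)"
  have r: "strict_mono r" unfolding r_def by (intro strict_mono_o r1 r2 r3)
  have \<psi>: "(\<lambda>k. \<Phi> (r k) j t) \<longlonglongrightarrow> \<psi> j t" for j t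
    using LIMSEQ_subseq_LIMSEQ[OF r1(2) strict_mono_o[OF r2(1) r3(1)], of j t] by (simp add: r_def comp_def)
  have \<tau>: "(\<lambda>k. \<tau> (r k) j) \<longlonglongrightarrow> \<tau>' j" for j
    using LIMSEQ_subseq_LIMSEQ[OF r2(2) r3(1), of j] by (simp add: r_def comp_def)
  have \<sigma>: "(\<lambda>k. \<sigma> (r k) j) \<longlonglongrightarrow> \<sigma>' j" for j using r3(2) by (simp add: r_def)
  have val: "(\<lambda>k. \<phi> (r k) j (u k)) \<longlonglongrightarrow> \<psi> j t"
    if u: "\<forall>\<^sub>F k in sequentially. u k \<in> phase (\<tau> (r k)) (\<sigma> (r k)) j" "u \<longlonglongrightarrow> t" for j t u
  proof -
    have 0: "(\<lambda>k. \<bar>M\<bar> * \<bar>u k - t\<bar>) \<longlonglongrightarrow> 0"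
      by (rule tendsto_mult_right_zero[OF tendsto_rabs_zero[OF LIM_zero[OF u(2)]]])
    have "(\<lambda>k. \<Phi> (r k) j (u k) - \<Phi> (r k) j t) \<longlonglongrightarrow> 0"
      by (rule Lim_null_comparison[OF always_eventually 0]) (simp add: \<Phi>_lip)
    from tendsto_add[OF this \<psi>[of j t]] have "(\<lambda>k. \<Phi> (r k) j (u k)) \<longlonglongrightarrow> \<psi> j t" by simp
    moreover have "\<forall>\<^sub>F k in sequentially. \<Phi> (r k) j (u k) = \<phi> (r k) j (u k)"
      using u(1) by eventually_elim (rule \<Phi>_eq)
    ultimately show ?thesis by (rule Lim_transform_eventually)
  qed
  have \<psi>_lip: "norm (\<psi> j t - \<psi> j s) \<le> \<bar>M\<bar> * \<bar>t - s\<bar>" for j s t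
  proof (rule LIMSEQ_le_const2)
    show "(\<lambda>k. norm (\<Phi> (r k) j t - \<Phi> (r k) j s)) \<longlonglongrightarrow> norm (\<psi> j t - \<psi> j s)"
      by (rule tendsto_norm[OF tendsto_diff[OF \<psi> \<psi>]])
  qed (simp add: \<Phi>_lip)
  have flow: "\<psi> j t \<in> flow_set H" if t: "\<tau>' j \<le> ereal t" "ereal t < \<sigma>' j" for j t
  proof -
    obtain u where u: "\<forall>\<^sub>F k in sequentially. u k \<in> phase (\<tau> (r k)) (\<sigma> (r k)) j" "u \<longlonglongrightarrow> t"
      "\<forall>\<^sub>F k in sequentially. ereal (u k) < \<sigma> (r k) j"
      using phase_points_converge[of "\<lambda>k. \<tau> (r k)" "\<lambda>k. \<sigma> (r k)",
          OF pt \<tau> \<sigma> t(1) less_imp_le[OF t(2)]] t(2) by blast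
    show ?thesis
    proof (rule Lim_in_closed_set[OF C(1) _ _ val[OF u(1,2)]])
      show "\<forall>\<^sub>F k in sequentially. \<phi> (r k) j (u k) \<in> flow_set H"
        using u(1,3)
      proof eventually_elim
        case (elim k)
        then show ?case using sol[of "r k"] unfolding phase_solution_def phase_def by blast
      qed
    qed simp
  qed
  have "phase_solution H \<tau>' \<sigma>' \<psi>"
    unfolding phase_solution_def
  proof (intro conjI allI impI)
    show "phase_times \<tau>' \<sigma>'"
      unfolding phase_times_def
    proof (intro conjI allI)
      have "(\<lambda>k. \<tau> (r k) 0) = (\<lambda>k. 0)" using pt by (simp add: phase_times_def)
      with \<tau>[of 0] show "\<tau>' 0 = 0" by (simp add: LIMSEQ_const_iff)
      fix j
      show "\<tau>' j \<le> \<sigma>' j"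
        by (rule tendsto_le[OF _ \<sigma> \<tau>]) (use pt in \<open>auto simp: phase_times_def\<close>)
      show "\<tau>' (Suc j) = \<sigma>' j \<or> \<tau>' (Suc j) = \<infinity>"
      proof (rule disjCI)
        assume "\<tau>' (Suc j) \<noteq> \<infinity>"
        then have "\<forall>\<^sub>F k in sequentially. \<tau> (r k) (Suc j) < \<infinity>"
          by (intro order_tendstoD(2)[OF \<tau>]) (simp add: less_top)
        then have "\<forall>\<^sub>F k in sequentially. \<tau> (r k) (Suc j) = \<sigma> (r k) j"
          by eventually_elim (use pt in \<open>auto simp: phase_times_def\<close>)
        from Lim_transform_eventually[OF \<tau> this] show "\<tau>' (Suc j) = \<sigma>' j"
          using \<sigma>[of j] LIMSEQ_unique by blast
      qed
    qed
    fix j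
    show "locally_absolutely_continuous_on (phase \<tau>' \<sigma>' j) (\<psi> j)"
      unfolding locally_absolutely_continuous_on_def
    proof (intro allI impI)
      fix a b
      show "absolutely_continuous_on_interval a b (\<psi> j)"
        by (rule lipschitz_imp_ac[of a b "\<psi> j" "\<bar>M\<bar>"]) (use \<psi>_lip[of j] in \<open>metis abs_of_nonneg diff_ge_0_iff_ge\<close>)
    qed
    show "\<psi> j t \<in> flow_set H" if "\<tau>' j \<le> ereal t \<and> ereal t < \<sigma>' j" for t using flow that by blast
    show "\<psi> j t \<in> jump_set H" "\<psi> (Suc j) t \<in> jump_map H (\<psi> j t)" if t: "\<tau>' (Suc j) = ereal t" for t
    proof -
      define b where "b k = real_of_ereal (\<tau> (r k) (Suc j))" for k
      have lt: "(\<lambda>k. \<tau> (r k) (Suc j)) \<longlonglongrightarrow> ereal t" using \<tau>[of "Suc j"] t by simp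
      then have bt: "b \<longlonglongrightarrow> t" unfolding b_def by (rule lim_real_of_ereal)
      have "\<forall>\<^sub>F k in sequentially. \<tau> (r k) (Suc j) < \<infinity>"
        by (rule order_tendstoD(2)[OF lt]) simp
      then have bk: "\<forall>\<^sub>F k in sequentially. \<tau> (r k) (Suc j) = ereal (b k)"
      proof eventually_elim
        case (elim k)
        then show ?case using phase_times_nonneg[OF pt[of "r k"], of "Suc j"] unfolding b_def
          by (cases "\<tau> (r k) (Suc j)") auto
      qed
      note jump = phase_solution_value_jump[OF sol]
      have v1: "(\<lambda>k. \<phi> (r k) j (b k)) \<longlonglongrightarrow> \<psi> j t"
        by (rule val[OF _ bt]) (use bk in eventually_elim, rule jump)
      have v2: "(\<lambda>k. \<phi> (r k) (Suc j) (b k)) \<longlonglongrightarrow> \<psi> (Suc j) t"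
        by (rule val[OF _ bt]) (use bk in eventually_elim, rule jump)
      show "\<psi> j t \<in> jump_set H"
      proof (rule Lim_in_closed_set[OF C(2) _ _ v1])
        show "\<forall>\<^sub>F k in sequentially. \<phi> (r k) j (b k) \<in> jump_set H"
          using bk by eventually_elim (rule jump)
      qed simp
      show "\<psi> (Suc j) t \<in> jump_map H (\<psi> j t)"
        by (rule outer_semicontinuous_eventually[OF oscG _ v1 v2]) (use bk in eventually_elim, rule jump)
    qed
    have "AE t in lebesgue. \<exists>v. (\<psi> j has_vector_derivative v) (at t)"
      by (rule lipschitz_differentiable_ae) (rule \<psi>_lip)
    then show "AE t in lebesgue. \<tau>' j < ereal t \<and> ereal t < \<sigma>' j \<longrightarrow>
          (\<exists>v\<in>flow_map H (\<psi> j t). (\<psi> j has_vector_derivative v) (at t))"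
    proof eventually_elim
      case (elim t)
      show ?case
      proof
        assume t: "\<tau>' j < ereal t \<and> ereal t < \<sigma>' j"
        from elim obtain v where v: "(\<psi> j has_vector_derivative v) (at t)" by blast
        \<comment> \<open>Room to the right of \<open>t\<close>: for large \<open>k\<close> the
          whole interval from \<open>t\<close> to \<open>c\<close> lies in phase \<open>j\<close> of
          the approximating solution, as the forward quotients require.\<close>
        obtain c where c: "ereal t < ereal c" "ereal c < \<sigma>' j"
          using ereal_dense2[OF conjunct2[OF t]] by blast
        define h0 where "h0 = c - t"
        have h0: "h0 > 0" using c by (simp add: h0_def)
        have ev: "\<forall>\<^sub>F k in sequentially. \<tau> (r k) j < ereal t \<and> ereal c < \<sigma> (r k) j"
          using order_tendstoD(2)[OF \<tau> conjunct1[OF t]] order_tendstoD(1)[OF \<sigma> c(2)] by eventually_elim simp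
        have sub: "s \<in> phase (\<tau> k) (\<sigma> k) j" if "\<tau> k j < ereal t \<and> ereal c < \<sigma> k j" "t \<le> s" "s \<le> c" for k s
        proof -
          have "ereal t \<le> ereal s" "ereal s \<le> ereal c" using that by auto
          then show ?thesis
            using order_trans[OF less_imp_le[OF conjunct1[OF that(1)]], of "ereal s"]
              order_trans[OF _ less_imp_le[OF conjunct2[OF that(1)]], of "ereal s"]
            by (simp add: phase_def)
        qed
        have "v \<in> flow_map H (\<psi> j t)"
        proof (rule limit_derivative_in_flow_map[OF H h0, of t "\<lambda>k. \<phi> (r k) j" "\<bar>M\<bar>" "\<psi> j"])
          show "(\<lambda>k. \<phi> (r k) j s) \<longlonglongrightarrow> \<psi> j s" if s: "t \<le> s" "s < t + h0" for s
          proof (rule val)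
            show "\<forall>\<^sub>F k in sequentially. s \<in> phase (\<tau> (r k)) (\<sigma> (r k)) j"
              using ev by eventually_elim (rule sub, use s in \<open>auto simp: h0_def\<close>)
          qed simp
          show "\<psi> j t \<in> flow_set H" using flow t by (simp add: less_imp_le)
          show "(\<psi> j has_vector_derivative v) (at t)" by (rule v)
          fix h assume h: "0 < h" "h < h0"
          show "\<forall>\<^sub>F k in sequentially. absolutely_continuous_on_interval t (t + h) (\<phi> (r k) j) \<and>
             (AE s in lebesgue. t < s \<and> s < t + h \<longrightarrow> \<phi> (r k) j s \<in> flow_set H \<and>
                (\<exists>v\<in>flow_map H (\<phi> (r k) j s). (\<phi> (r k) j has_vector_derivative v) (at s)))
             \<and> (\<forall>s. t \<le> s \<and> s \<le> t + h \<longrightarrow> norm (\<phi> (r k) j s - \<phi> (r k) j t) \<le> \<bar>M\<bar> * \<bar>s - t\<bar>)"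
            using ev
          proof eventually_elim
            case (elim k)
            have th: "s \<in> phase (\<tau> (r k)) (\<sigma> (r k)) j" if "t \<le> s" "s \<le> t + h" for s
              using sub[OF elim, of s] that h by (simp add: h0_def)
            have "{t..t + h} \<subseteq> phase (\<tau> (r k)) (\<sigma> (r k)) j" using th by auto
            then have "absolutely_continuous_on_interval t (t + h) (\<phi> (r k) j)"
              using sol[of "r k"] h unfolding phase_solution_def locally_absolutely_continuous_on_def by simp
            moreover have "AE s in lebesgue. \<tau> (r k) j < ereal s \<and> ereal s < \<sigma> (r k) j \<longrightarrow>
                (\<exists>v\<in>flow_map H (\<phi> (r k) j s). (\<phi> (r k) j has_vector_derivative v) (at s))"
              using sol[of "r k"] unfolding phase_solution_def by blast
            then have "AE s in lebesgue. t < s \<and> s < t + h \<longrightarrow> \<phi> (r k) j s \<in> flow_set H \<and>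
                (\<exists>v\<in>flow_map H (\<phi> (r k) j s). (\<phi> (r k) j has_vector_derivative v) (at s))"
            proof eventually_elim
              case (elim s)
              show ?case
              proof
                assume s: "t < s \<and> s < t + h"
                then have "ereal t < ereal s" "ereal s < ereal c" using h by (auto simp: h0_def)
                then have i: "\<tau> (r k) j < ereal s \<and> ereal s < \<sigma> (r k) j"
                  using \<open>\<tau> (r k) j < ereal t \<and> ereal c < \<sigma> (r k) j\<close>
                    less_trans[of "\<tau> (r k) j" "ereal t" "ereal s"]
                    less_trans[of "ereal s" "ereal c" "\<sigma> (r k) j"] by simp
                moreover from i have "\<phi> (r k) j s \<in> flow_set H"
                  using sol[of "r k"] unfolding phase_solution_def by (simp add: less_imp_le)
                ultimately show "\<phi> (r k) j s \<in> flow_set H \<and>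
                   (\<exists>v\<in>flow_map H (\<phi> (r k) j s). (\<phi> (r k) j has_vector_derivative v) (at s))"
                  using elim by blast
              qed
            qed
            moreover have "\<forall>s. t \<le> s \<and> s \<le> t + h \<longrightarrow> norm (\<phi> (r k) j s - \<phi> (r k) j t) \<le> \<bar>M\<bar> * \<bar>s - t\<bar>"
            proof (intro allI impI)
              fix s assume "t \<le> s \<and> s \<le> t + h"
              then show "norm (\<phi> (r k) j s - \<phi> (r k) j t) \<le> \<bar>M\<bar> * \<bar>s - t\<bar>"
                by (intro lip th) (use h in auto)
            qed
            ultimately show ?case by blast
          qed
        qed
        with v show "\<exists>v\<in>flow_map H (\<psi> j t). (\<psi> j has_vector_derivative v) (at t)" by blast
      qed
    qed
  qed
  moreover have "phases_converge (\<lambda>k. \<tau> (r k)) (\<lambda>k. \<sigma> (r k)) (\<lambda>k. \<phi> (r k)) \<tau>' \<sigma>' \<psi>"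
    unfolding phases_converge_def using \<tau> \<sigma> val by blast
  ultimately show thesis by (rule that[OF r])
qed

section \<open>Completeness of limit arcs\<close>

lemma phase_times_order:
  assumes pt: "phase_times \<tau> \<sigma>" and t: "t \<in> phase \<tau> \<sigma> j" and i: "i < j"
  shows "\<tau> (Suc i) = \<sigma> i" "\<sigma> i \<le> ereal t"
proof -
  have *: "\<tau> (Suc i) = \<sigma> i \<and> \<sigma> i \<le> \<tau> j" if "i < j" "\<tau> j < \<infinity>" for i j
    using that
  proof (induction j)
    case (Suc j)
    then have s: "\<tau> (Suc j) = \<sigma> j" "\<tau> j \<le> \<sigma> j" using pt by (auto simp: phase_times_def)
    show ?case
    proof (cases "i = j")
      case False
      then have "i < j" "\<tau> j < \<infinity>" using Suc.prems s by auto
      then show ?thesis using Suc.IH s by auto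
    qed (use s in auto)
  qed simp
  have "\<tau> j \<le> ereal t" using t by (simp add: phase_def)
  moreover from this have "\<tau> j < \<infinity>" by (rule le_less_trans) simp
  ultimately show "\<tau> (Suc i) = \<sigma> i" "\<sigma> i \<le> ereal t" using *[OF i] by (auto intro: order_trans)
qed

lemma phase_start:
  assumes "phase_times \<tau> \<sigma>" "\<tau> j \<noteq> \<infinity>"
  shows "ereal (real_of_ereal (\<tau> j)) = \<tau> j" "real_of_ereal (\<tau> j) \<in> phase \<tau> \<sigma> j"
proof -
  show *: "ereal (real_of_ereal (\<tau> j)) = \<tau> j"
    using phase_times_nonneg[OF assms(1), of j] assms(2) by (cases "\<tau> j") auto
  have "\<tau> j \<le> \<sigma> j" using assms(1) by (simp add: phase_times_def)
  then show "real_of_ereal (\<tau> j) \<in> phase \<tau> \<sigma> j" by (simp add: phase_def *)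
qed

text \<open>Were the limit domain bounded by \<open>B\<close>, it would have a last phase
  \<open>j\<close>, ending at most at \<open>B\<close>. For large \<open>k\<close> phase
  \<open>j\<close> then ends before \<open>B + 1\<close> while the start of phase
  \<open>Suc j\<close> lies beyond \<open>B + 1\<close>, so the approximating arc has no phase after
  \<open>j\<close>, and \<open>T k + real (J k)\<close> stays bounded.\<close>

lemma limit_phase_arc_complete:
  assumes pt: "\<And>k. phase_times (\<tau> k) (\<sigma> k)" "phase_times \<tau>' \<sigma>'"
    and lim: "\<And>j. (\<lambda>k. \<tau> k j) \<longlonglongrightarrow> \<tau>' j" "\<And>j. (\<lambda>k. \<sigma> k j) \<longlonglongrightarrow> \<sigma>' j"
    and long: "\<And>k. T k \<in> phase (\<tau> k) (\<sigma> k) (J k)" "filterlim (\<lambda>k. T k + real (J k)) at_top sequentially"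
  shows "complete_arc (phase_arc \<tau>' \<sigma>' \<psi>)"
  unfolding complete_arc_def
proof
  assume "bounded ((\<lambda>(t, j). (t, real j)) ` dom (phase_arc \<tau>' \<sigma>' \<psi>))"
  then obtain B where "\<And>p. p \<in> dom (phase_arc \<tau>' \<sigma>' \<psi>) \<Longrightarrow> norm ((\<lambda>(t, j). (t, real j)) p) \<le> B"
    unfolding bounded_iff by blast
  note bnd = this
  have B: "\<bar>t\<bar> \<le> B" "real j \<le> B" if "t \<in> phase \<tau>' \<sigma>' j" for t j
  proof -
    have "norm (t, real j) \<le> B" using bnd[of "(t, j)"] that by (simp add: mem_dom_phase_arc)
    with norm_fst_le[of t "real j"] norm_snd_le[of "real j" t] show "\<bar>t\<bar> \<le> B" "real j \<le> B" by simp_all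
  qed
  note mem = phase_start(2)[OF pt(2)]
  have "\<exists>j. \<tau>' (Suc j) = \<infinity>"
  proof (rule ccontr)
    assume "\<not> ?thesis"
    then have le: "real (Suc j) \<le> B" for j using B(2)[OF mem] by blast
    obtain n where "B < real n" using reals_Archimedean2 by blast
    with le[of n] show False by simp
  qed
  define j where "j = (LEAST j. \<tau>' (Suc j) = \<infinity>)"
  have j: "\<tau>' (Suc j) = \<infinity>" unfolding j_def by (rule LeastI_ex) fact
  have j': "\<tau>' j \<noteq> \<infinity>"
  proof (cases j)
    case 0 then show ?thesis using pt(2) by (simp add: phase_times_def)
  next
    case (Suc i) then show ?thesis using not_less_Least[of i "\<lambda>j. \<tau>' (Suc j) = \<infinity>"] by (simp add: j_def)
  qed
  have "\<sigma>' j \<le> ereal B"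
  proof (rule ccontr)
    assume "\<not> \<sigma>' j \<le> ereal B"
    then obtain c where c: "ereal B < ereal c" "ereal c < \<sigma>' j" using ereal_dense2[of "ereal B" "\<sigma>' j"] by (meson not_le)
    have "ereal (real_of_ereal (\<tau>' j)) = \<tau>' j" by (rule phase_start(1)[OF pt(2) j'])
    moreover have "\<bar>real_of_ereal (\<tau>' j)\<bar> \<le> B" by (rule B(1)[OF mem[OF j']])
    ultimately have "\<tau>' j \<le> ereal B" by (metis abs_le_D1 ereal_less_eq(3))
    then have "c \<in> phase \<tau>' \<sigma>' j"
      using order_trans[OF _ less_imp_le[OF c(1)], of "\<tau>' j"] less_imp_le[OF c(2)] by (simp add: phase_def)
    from B(1)[OF this] c show False by simp
  qed
  then have s: "\<sigma>' j < ereal (B + 1)" by (rule le_less_trans) simp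
  have "ereal (B + 1) < \<tau>' (Suc j)" using j by simp
  from order_tendstoD(1)[OF lim(1) this] order_tendstoD(2)[OF lim(2) s]
  have "\<forall>\<^sub>F k in sequentially. T k + real (J k) \<le> B + 1 + real j"
  proof eventually_elim
    case (elim k)
    then have ne: "\<tau> k (Suc j) \<noteq> \<sigma> k j" by auto
    have "J k \<le> j" using phase_times_order(1)[OF pt(1) long(1)[of k], of j] ne by (meson not_le)
    have "ereal (T k) \<le> \<sigma> k (J k)" using long(1)[of k] by (simp add: phase_def)
    also have "\<dots> \<le> \<sigma> k j"
    proof (cases "J k = j")
      case False
      have fin: "\<tau> k j \<le> \<sigma> k j" using pt(1)[of k] by (simp add: phase_times_def)
      with elim have "\<tau> k j < ereal (B + 1)" by auto
      then have "\<tau> k j \<noteq> \<infinity>" by auto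
      note start = phase_start[OF pt(1) this]
      have "\<sigma> k (J k) \<le> \<tau> k j"
        using phase_times_order(2)[OF pt(1) start(2), of "J k"] False \<open>J k \<le> j\<close> by (simp add: start(1))
      with fin show ?thesis by (rule order_trans[rotated])
    qed simp
    also have "\<dots> \<le> ereal (B + 1)" using elim by simp
    finally show ?case using \<open>J k \<le> j\<close> by simp
  qed
  moreover have "\<forall>\<^sub>F k in sequentially. T k + real (J k) > B + 1 + real j"
    using long(2) by (simp add: filterlim_at_top_dense)
  ultimately have "\<forall>\<^sub>F k in sequentially. False" by eventually_elim simp
  then show False by simp
qed

section \<open>Exit and visit times\<close>

lemma local_time_domain_mono:
  assumes E: "local_time_domain E" and s: "(s, i) \<in> E"
  shows "(t, j) \<in> E \<Longrightarrow> i < j \<Longrightarrow> s \<le> t"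
proof (induction j arbitrary: t)
  case (Suc j)
  from local_time_domainD(4)[OF E Suc.prems(1)] obtain b
    where b: "(b, j) \<in> E" "\<And>s. (s, j) \<in> E \<Longrightarrow> s \<le> b" "\<And>s. (s, Suc j) \<in> E \<Longrightarrow> b \<le> s" by blast
  have "s \<le> b" using b(2)[of s] Suc.IH[OF b(1)] s Suc.prems(2) by (cases "i = j") auto
  also have "b \<le> t" by (rule b(3)[OF Suc.prems(1)])
  finally show ?case .
qed simp

lemma local_time_domain_total:
  assumes E: "local_time_domain E" and "(s, i) \<in> E" "(t, j) \<in> E" "s + real i \<le> t + real j"
  shows "s \<le> t" "i \<le> j"
proof -
  have "s \<le> t \<and> i \<le> j"
    using local_time_domain_mono[OF E assms(2,3)] local_time_domain_mono[OF E assms(3,2)] assms(4)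
    by (cases i j rule: linorder_cases) auto
  then show "s \<le> t" "i \<le> j" by auto
qed

lemma local_time_domain_nonneg:
  assumes "local_time_domain E" "(t, j) \<in> E"
  shows "0 \<le> t"
  using local_time_domain_mono[OF assms(1) local_time_domainD(1)[OF assms(1)] assms(2)]
    local_time_domainD(2)[OF assms(1), of t] assms(2) by (cases j) auto

lemma local_time_domain_min:
  assumes E: "local_time_domain E" and t: "(t, j) \<in> E"
  obtains a where "(a, j) \<in> E" "\<And>s. (s, j) \<in> E \<Longrightarrow> a \<le> s"
proof (cases j)
  case 0
  then show thesis using that[of 0] local_time_domainD(1,2)[OF E] by auto
next
  case (Suc i)
  with t local_time_domainD(4)[OF E, of t i] show thesis using that by blast
qed

text \<open>Truncation at a time of the domain makes every level compact, even if the last one is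
  half-open or unbounded. This is what makes first and last times in closed sets attained.\<close>

lemma local_time_domain_truncated_level:
  assumes E: "local_time_domain E" and t: "(t, j) \<in> E" and i: "i \<le> j"
  obtains a b where "a \<le> b" "\<And>s. (s, i) \<in> E \<and> s \<le> t \<longleftrightarrow> a \<le> s \<and> s \<le> b"
proof -
  have "\<exists>b. (b, i) \<in> E \<and> b \<le> t \<and> (\<forall>s. (s, i) \<in> E \<and> s \<le> t \<longrightarrow> s \<le> b)"
  proof (cases "i = j")
    case True then show ?thesis using t by blast
  next
    case False
    then have "Suc i \<le> j" using i by simp
    then obtain u where "(u, Suc i) \<in> E" using local_time_domain_levels[OF E t] by blast
    from local_time_domainD(4)[OF E this] obtain b where b: "(b, i) \<in> E" "\<And>s. (s, i) \<in> E \<Longrightarrow> s \<le> b" by blast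
    have "b \<le> t" using local_time_domain_mono[OF E b(1) t] False i by simp
    with b show ?thesis by blast
  qed
  then obtain b where b: "(b, i) \<in> E" "b \<le> t" "\<And>s. (s, i) \<in> E \<Longrightarrow> s \<le> t \<Longrightarrow> s \<le> b" by blast
  obtain a where a: "(a, i) \<in> E" "\<And>s. (s, i) \<in> E \<Longrightarrow> a \<le> s" using local_time_domain_min[OF E b(1)] by blast
  show thesis
  proof (rule that[of a b])
    show "a \<le> b" by (rule a(2)[OF b(1)])
    show "(s, i) \<in> E \<and> s \<le> t \<longleftrightarrow> a \<le> s \<and> s \<le> b" for s
      using a(2)[of s] b(2) b(3)[of s] local_time_domainD(3)[OF E a(1) b(1), of s] by auto
  qed
qed

lemma solution_continuous_on:
  assumes "solution H x" "\<And>s. a \<le> s \<Longrightarrow> s \<le> b \<Longrightarrow> (s, j) \<in> dom x"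
  shows "continuous_on {a..b} (arc_val x j)"
proof (cases "a \<le> b")
  case True
  have "{a..b} \<subseteq> arc_interval x j" using assms(2) unfolding arc_interval_def by (intro subsetI) simp
  with True solutionD(2)[OF assms(1), of j] show ?thesis
    unfolding locally_absolutely_continuous_on_def by (intro ac_imp_continuous_on) blast
qed simp

lemma compact_interval_preimage:
  fixes f :: "real \<Rightarrow> 'a::topological_space"
  assumes "continuous_on {a..b} f" "closed T"
  shows "compact ({a..b} \<inter> f -` T)"
proof -
  have "closed ({a..b} \<inter> f -` T)" using assms by (simp add: continuous_closed_preimage)
  moreover have "bounded ({a..b} \<inter> f -` T)" by (rule bounded_subset[of "{a..b}"]) auto
  ultimately show ?thesis by (simp add: compact_eq_bounded_closed)
qed

text \<open>The exit is taken at the least level, and there at the least time, which exists by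
  compactness. The last conclusion records how the exit happens: by flow it is a limit of points of
  \<open>U\<close>, by a jump it is an image of a point of \<open>U\<close>. In either case it stays
  in a controlled set.\<close>

lemma first_exit_time:
  assumes sol: "solution H x" and p: "x (0, 0) = Some p" "p \<in> U" and U: "open U"
    and q: "q \<in> ran x" "q \<notin> U"
  obtains t j where "(t, j) \<in> dom x" "arc_val x j t \<notin> U"
    "\<And>s i. (s, i) \<in> dom x \<Longrightarrow> s \<le> t \<Longrightarrow> i \<le> j \<Longrightarrow> (s, i) \<noteq> (t, j) \<Longrightarrow> arc_val x i s \<in> U"
    "arc_val x j t \<in> closure U \<union> (\<Union>z\<in>U \<inter> jump_set H. jump_map H z)"
proof -
  have loc: "local_time_domain (dom x)"
    by (rule solution_local_time_domain[OF sol]) (use p in auto)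
  let ?bad = "\<lambda>t j. (t, j) \<in> dom x \<and> arc_val x j t \<notin> U"
  define j where "j = (LEAST j. \<exists>t. ?bad t j)"
  have "\<exists>j t. ?bad t j"
  proof -
    obtain tj where "x tj = Some q" using q(1) by (auto simp: ran_def)
    then have "?bad (fst tj) (snd tj)" using q(2) by auto
    then show ?thesis by blast
  qed
  then have "\<exists>t. ?bad t j" unfolding j_def by (rule LeastI_ex)
  then obtain t0 where t0: "?bad t0 j" by blast
  have below: "arc_val x i s \<in> U" if "(s, i) \<in> dom x" "i < j" for s i
    using not_less_Least[of i "\<lambda>j. \<exists>t. ?bad t j"] that unfolding j_def by blast
  obtain a b where ab: "a \<le> b" "\<And>s. (s, j) \<in> dom x \<and> s \<le> t0 \<longleftrightarrow> a \<le> s \<and> s \<le> b"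
    using local_time_domain_truncated_level[OF loc conjunct1[OF t0] order_refl] by metis
  have cont: "continuous_on {a..b} (arc_val x j)"
    by (rule solution_continuous_on[OF sol]) (use ab(2) in blast)
  define S where "S = {a..b} \<inter> arc_val x j -` (- U)"
  have "compact S" unfolding S_def by (rule compact_interval_preimage[OF cont closed_Compl[OF U]])
  moreover have "t0 \<in> S" using t0 ab(2)[of t0] by (auto simp: S_def)
  ultimately obtain t where t: "t \<in> S" "\<And>s. s \<in> S \<Longrightarrow> t \<le> s"
    using compact_attains_inf[of S] by blast
  have tj: "(t, j) \<in> dom x" "arc_val x j t \<notin> U" using t(1) ab(2)[of t] by (auto simp: S_def)
  have before: "arc_val x i s \<in> U" if s: "(s, i) \<in> dom x" "s \<le> t" "i \<le> j" "(s, i) \<noteq> (t, j)" for s i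
  proof (cases "i = j")
    case True
    have "a \<le> s \<and> s \<le> b" using ab(2)[of s] ab(2)[of t] s t(1) True by (auto simp: S_def)
    moreover have "s < t" using s True by auto
    ultimately show ?thesis using t(2)[of s] True by (auto simp: S_def)
  qed (use below s in auto)
  have "arc_val x j t \<in> closure U \<union> (\<Union>z\<in>U \<inter> jump_set H. jump_map H z)"
  proof (cases "a < t")
    case True
    have "arc_val x j ` closure {a..<t} \<subseteq> closure U"
    proof (rule image_closure_subset)
      show "continuous_on (closure {a..<t}) (arc_val x j)"
        by (rule continuous_on_subset[OF cont]) (use True t(1) in \<open>auto simp: S_def\<close>)
      show "arc_val x j ` {a..<t} \<subseteq> closure U"
      proof safe
        fix s assume s: "s \<in> {a..<t}"
        then have "(s, j) \<in> dom x" using ab(2)[of s] t(1) by (auto simp: S_def)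
        then have "arc_val x j s \<in> U" using before[of s j] s by auto
        then show "arc_val x j s \<in> closure U" using closure_subset by blast
      qed
    qed simp
    moreover have "t \<in> closure {a..<t}" using True by simp
    ultimately show ?thesis by blast
  next
    case False
    \<comment> \<open>An exit at the start of its level must come from a jump: level 0 starts at the
      initial point, which lies in \<open>U\<close>.\<close>
    then have ta: "t = a" using t(1) by (auto simp: S_def)
    show ?thesis
    proof (cases j)
      case 0
      have "(0, 0) \<in> dom x" using p by auto
      moreover have "0 \<le> t0" using local_time_domain_nonneg[OF loc conjunct1[OF t0]] .
      ultimately have "a \<le> 0" using ab(2)[of 0] 0 by blast
      moreover have "0 \<le> t" using local_time_domain_nonneg[OF loc tj(1)] .
      ultimately have "t = 0" using ta by simp
      then show ?thesis using tj(2) p 0 by simp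
    next
      case (Suc i)
      from local_time_domainD(4)[OF loc tj(1)[unfolded Suc]] obtain c
        where c: "(c, i) \<in> dom x" "(c, Suc i) \<in> dom x" "\<And>s. (s, Suc i) \<in> dom x \<Longrightarrow> c \<le> s" by blast
      have "c \<le> t0" using c(3) t0 Suc by blast
      then have "a \<le> c" using ab(2)[of c] c(2) Suc by blast
      moreover have "c \<le> t" using c(3) tj(1) Suc by blast
      ultimately have ct: "c = t" using ta by simp
      have "arc_val x i t \<in> U \<inter> jump_set H" 
        using below[of t i] solutionD(5)[OF sol c(1,2)] c ct Suc by auto
      moreover have "arc_val x j t \<in> jump_map H (arc_val x i t)"
        using solutionD(6)[OF sol c(1,2)] ct Suc by simp
      ultimately show ?thesis by blast
    qed
  qed
  with that[OF tj before] show thesis by blast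
qed

text \<open>The mirror image of the first exit: the greatest level meeting \<open>A\<close> up to
  \<open>(t, j)\<close>, and there the latest time, attained because \<open>A\<close> is closed. The
  initial point in \<open>A\<close> guarantees that there is a visit at all.\<close>

lemma last_visit_time:
  assumes sol: "solution H x" and p: "x (0, 0) = Some p" "p \<in> A" and A: "closed A"
    and tj: "(t, j) \<in> dom x"
  obtains s i where "(s, i) \<in> dom x" "s \<le> t" "i \<le> j" "arc_val x i s \<in> A"
    "\<And>u k. (u, k) \<in> dom x \<Longrightarrow> s \<le> u \<Longrightarrow> u \<le> t \<Longrightarrow> i \<le> k \<Longrightarrow> k \<le> j \<Longrightarrow> (u, k) \<noteq> (s, i) \<Longrightarrow> arc_val x k u \<notin> A"
proof -
  have loc: "local_time_domain (dom x)"
    by (rule solution_local_time_domain[OF sol]) (use p in auto)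
  let ?good = "\<lambda>s i. (s, i) \<in> dom x \<and> s \<le> t \<and> i \<le> j \<and> arc_val x i s \<in> A"
  have "?good 0 0" using p local_time_domain_nonneg[OF loc tj] by auto
  then have ex: "\<exists>i s. ?good s i" by blast
  define i where "i = (GREATEST i. \<exists>s. ?good s i)"
  have "\<exists>s. ?good s i" unfolding i_def by (rule GreatestI_ex_nat[OF ex, of j]) blast
  then obtain s0 where s0: "?good s0 i" by blast
  have above: "\<not> ?good s k" if "i < k" for s k
    using Greatest_le_nat[of "\<lambda>i. \<exists>s. ?good s i" k j] that unfolding i_def by (meson not_le)
  obtain a b where ab: "a \<le> b" "\<And>s. (s, i) \<in> dom x \<and> s \<le> t \<longleftrightarrow> a \<le> s \<and> s \<le> b"
    using local_time_domain_truncated_level[OF loc tj, of i] s0 by metis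
  have cont: "continuous_on {a..b} (arc_val x i)"
    by (rule solution_continuous_on[OF sol]) (use ab(2) in blast)
  define S where "S = {a..b} \<inter> arc_val x i -` A"
  have "compact S" unfolding S_def by (rule compact_interval_preimage[OF cont A])
  moreover have "s0 \<in> S" using s0 ab(2)[of s0] by (auto simp: S_def)
  ultimately obtain s where s: "s \<in> S" "\<And>u. u \<in> S \<Longrightarrow> u \<le> s"
    using compact_attains_sup[of S] by blast
  show thesis
  proof (rule that[of s i])
    show "(s, i) \<in> dom x" "s \<le> t" "arc_val x i s \<in> A" "i \<le> j"
      using s(1) ab(2)[of s] s0 by (auto simp: S_def)
    fix u k assume u: "(u, k) \<in> dom x" "s \<le> u" "u \<le> t" "i \<le> k" "k \<le> j" "(u, k) \<noteq> (s, i)"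
    show "arc_val x k u \<notin> A"
    proof (cases "k = i")
      case True
      then show ?thesis using s(2)[of u] ab(2)[of u] u by (auto simp: S_def)
    next
      case False
      then show ?thesis using above[of k u] u by auto
    qed
  qed
qed

section \<open>Neighbourhoods, convergence and restriction\<close>

lemma set_ball_iff: "x \<in> set_ball c \<Gamma> \<longleftrightarrow> (\<exists>y\<in>\<Gamma>. dist x y < c)"
  by (simp add: set_ball_def set_distance_def INF_less_iff)

lemma set_ball_Union: "set_ball c \<Gamma> = (\<Union>y\<in>\<Gamma>. ball y c)"
  by (auto simp: set_ball_iff dist_commute)

lemma open_set_ball: "open (set_ball c \<Gamma>)"
  by (auto simp: set_ball_Union)

lemma set_ball_mono: "c \<le> d \<Longrightarrow> \<Gamma> \<subseteq> \<Gamma>' \<Longrightarrow> set_ball c \<Gamma> \<subseteq> set_ball d \<Gamma>'"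
  by (force simp: set_ball_iff)

lemma subset_set_ball: "c > 0 \<Longrightarrow> \<Gamma> \<subseteq> set_ball c \<Gamma>"
  by (force simp: set_ball_iff)

lemma bounded_set_ball:
  assumes "bounded \<Gamma>"
  shows "bounded (set_ball c \<Gamma>)"
proof -
  obtain a r where "\<Gamma> \<subseteq> cball a r" using assms bounded_subset_cball by blast
  then have "set_ball c \<Gamma> \<subseteq> ball a (r + c)"
    unfolding set_ball_Union by (auto simp: subset_iff) (smt (verit) dist_triangle)
  then show ?thesis using bounded_ball bounded_subset by blast
qed

lemma closure_set_ball_subset:
  assumes "c < d"
  shows "closure (set_ball c \<Gamma>) \<subseteq> set_ball d \<Gamma>"
proof
  fix q assume "q \<in> closure (set_ball c \<Gamma>)"
  then obtain s where s: "s \<in> set_ball c \<Gamma>" "dist s q < d - c"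
    using assms closure_approachable[of q "set_ball c \<Gamma>"] by (metis diff_gt_0_iff_gt)
  then obtain y where y: "y \<in> \<Gamma>" "dist s y < c" by (auto simp: set_ball_iff)
  have "dist q y < d" using dist_triangle[of q y s] s(2) y(2) by (simp add: dist_commute)
  with y(1) show "q \<in> set_ball d \<Gamma>" by (auto simp: set_ball_iff)
qed

lemma compact_set_ball_neighbourhood:
  fixes \<Gamma> :: "'a::euclidean_space set"
  assumes "compact \<Gamma>" "open U" "\<Gamma> \<subseteq> U"
  obtains c where "c > 0" "set_ball c \<Gamma> \<subseteq> U"
  using compact_subset_open_imp_ball_epsilon_subset[OF assms] unfolding set_ball_Union by metis

lemma set_ball_limit:
  assumes "closed \<Gamma>" "\<eta> \<longlonglongrightarrow> 0" "\<forall>\<^sub>F k in sequentially. q k \<in> set_ball (\<eta> k) \<Gamma>" "q \<longlonglongrightarrow> p"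
  shows "p \<in> \<Gamma>"
proof -
  have "p \<in> closure \<Gamma>"
    unfolding closure_approachable
  proof (intro allI impI)
    fix e :: real assume e: "e > 0"
    have "\<forall>\<^sub>F k in sequentially. \<eta> k < e / 2" "\<forall>\<^sub>F k in sequentially. dist (q k) p < e / 2"
      using order_tendstoD(2)[OF assms(2), of "e/2"] tendstoD[OF assms(4), of "e/2"] e by auto
    with assms(3) have "\<forall>\<^sub>F k in sequentially. \<exists>y\<in>\<Gamma>. dist y p < e"
    proof eventually_elim
      case (elim k)
      then obtain y where "y \<in> \<Gamma>" "dist (q k) y < \<eta> k" by (auto simp: set_ball_iff)
      with elim dist_triangle[of y p "q k"] show ?case by (intro bexI[of _ y]) (auto simp: dist_commute)
    qed
    then show "\<exists>y\<in>\<Gamma>. dist y p < e" by simp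
  qed
  with assms(1) show ?thesis by simp
qed

lemma complete_arc_unbounded:
  assumes loc: "local_time_domain (dom x)" and c: "complete_arc x"
  obtains t j where "(t, j) \<in> dom x" "N \<le> t + real j"
proof -
  have "\<exists>p\<in>dom x. N \<le> fst p + real (snd p)"
  proof (rule ccontr)
    assume neg: "\<not> ?thesis"
    have "norm ((\<lambda>(t, j). (t, real j)) p) \<le> N" if p: "p \<in> dom x" for p
    proof -
      have "0 \<le> fst p" using local_time_domain_nonneg[OF loc, of "fst p" "snd p"] p by simp
      moreover have "fst p + real (snd p) < N" using neg p by (meson not_le)
      ultimately show ?thesis using norm_Pair_le[of "fst p" "real (snd p)"] by (simp add: case_prod_unfold)
    qed
    then have "bounded ((\<lambda>(t, j). (t, real j)) ` dom x)" unfolding bounded_iff by blast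
    with c show False by (simp add: complete_arc_def)
  qed
  then obtain p where "p \<in> dom x" "N \<le> fst p + real (snd p)" by blast
  then show thesis using that[of "fst p" "snd p"] by simp
qed

lemma complete_arc_mono: "complete_arc x \<Longrightarrow> x \<subseteq>\<^sub>m y \<Longrightarrow> complete_arc y"
  unfolding complete_arc_def by (meson bounded_subset image_mono map_le_implies_dom_le)

lemma converges_to_set_eventually:
  assumes "converges_to_set x \<Gamma>" "\<epsilon> > 0"
  obtains N where "\<And>t j. (t, j) \<in> dom x \<Longrightarrow> N \<le> t + real j \<Longrightarrow> the (x (t, j)) \<in> set_ball \<epsilon> \<Gamma>"
proof -
  have "\<forall>\<^sub>F p in inf (filtercomap (\<lambda>(t, j). t + real j) at_top) (principal (dom x)).
     set_distance \<Gamma> (the (x p)) < ereal \<epsilon>"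
    using assms unfolding converges_to_set_def by (intro order_tendstoD(2)) auto
  then obtain Q where Q: "eventually Q at_top" "\<And>p. Q (case p of (t, j) \<Rightarrow> t + real j) \<Longrightarrow> p \<in> dom x \<Longrightarrow>
      set_distance \<Gamma> (the (x p)) < ereal \<epsilon>"
    unfolding eventually_inf_principal eventually_filtercomap by blast
  obtain N where "\<And>n. N \<le> n \<Longrightarrow> Q n" using Q(1) unfolding eventually_at_top_linorder by blast
  with Q(2) show thesis by (intro that[of N]) (fastforce simp: set_ball_def)
qed

lemma converges_to_setI:
  assumes "\<And>\<epsilon>. \<epsilon> > 0 \<Longrightarrow> \<exists>N. \<forall>t j. (t, j) \<in> dom x \<and> N \<le> t + real j \<longrightarrow> the (x (t, j)) \<in> set_ball \<epsilon> \<Gamma>"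
  shows "converges_to_set x \<Gamma>"
  unfolding converges_to_set_def
proof (rule order_tendstoI)
  fix a :: ereal assume "a < 0"
  moreover have "0 \<le> set_distance \<Gamma> q" for q
    unfolding set_distance_def by (rule INF_greatest) simp
  ultimately show "\<forall>\<^sub>F p in inf (filtercomap (\<lambda>(t, j). t + real j) at_top) (principal (dom x)). a < set_distance \<Gamma> (the (x p))"
    by (intro always_eventually) (meson less_le_trans)
next
  fix a :: ereal assume "0 < a"
  then obtain e where e: "0 < ereal e" "ereal e < a" using ereal_dense2 by blast
  then obtain N where N: "\<forall>t j. (t, j) \<in> dom x \<and> N \<le> t + real j \<longrightarrow> the (x (t, j)) \<in> set_ball e \<Gamma>"
    using assms[of e] by auto
  show "\<forall>\<^sub>F p in inf (filtercomap (\<lambda>(t, j). t + real j) at_top) (principal (dom x)). set_distance \<Gamma> (the (x p)) < a"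
    unfolding eventually_inf_principal eventually_filtercomap
  proof (intro exI[of _ "\<lambda>n. N \<le> n"] conjI allI impI)
    show "eventually (\<lambda>n. N \<le> n) at_top" by (rule eventually_ge_at_top)
    fix p :: "real \<times> nat" assume "N \<le> (case p of (t, j) \<Rightarrow> t + real j)" "p \<in> dom x"
    then have "the (x p) \<in> set_ball e \<Gamma>" using N by (cases p) auto
    then show "set_distance \<Gamma> (the (x p)) < a" using e(2) unfolding set_ball_def by auto
  qed
qed

section \<open>Maximal solutions, reachability and restriction\<close>

lemma max_solutions_fromD:
  assumes "x \<in> max_solutions_from H U"
  shows "solution H x" "local_time_domain (dom x)" "(0, 0) \<in> dom x" "\<exists>p\<in>U. x (0, 0) = Some p"
proof -
  show s: "solution H x" and "\<exists>p\<in>U. x (0, 0) = Some p"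
    using assms by (auto simp: max_solutions_from_def maximal_solution_def)
  then show d: "(0, 0) \<in> dom x" by auto
  show "local_time_domain (dom x)" by (rule solution_local_time_domain[OF s]) (use d in blast)
qed

lemma solution_in_max_solutions_from:
  assumes "solution H x" "x (0, 0) = Some p" "p \<in> U"
  obtains y where "y \<in> max_solutions_from H U" "x \<subseteq>\<^sub>m y"
proof -
  have p: "(0, 0) \<in> dom x" using assms(2) by (rule domI)
  then have "dom x \<noteq> {}" by blast
  then obtain y where y: "maximal_solution H y" "x \<subseteq>\<^sub>m y"
    by (rule solution_extends_to_maximal[OF assms(1)])
  have "y (0, 0) = Some p" using bspec[OF y(2)[unfolded map_le_def] p] assms(2) by simp
  then have "y \<in> max_solutions_from H U" using y(1) assms(3) unfolding max_solutions_from_def by blast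
  then show thesis using y(2) by (rule that)
qed

text \<open>Reachability bounds speak of maximal solutions; a phase arc inherits them from a maximal
  extension, which takes the same values on its domain.\<close>

lemma reachable_range_phase:
  assumes reach: "reachable_range H U \<subseteq> V" and sol: "phase_solution H \<tau> \<sigma> \<phi>"
    and start: "\<phi> 0 0 \<in> U" and t: "t \<in> phase \<tau> \<sigma> j"
  shows "\<phi> j t \<in> V"
proof -
  have "phase_times \<tau> \<sigma>" using sol by (simp add: phase_solution_def)
  then have "0 \<in> phase \<tau> \<sigma> 0"
    using local_time_domainD(1)[OF phase_arc_local_time_domain[of \<tau> \<sigma> \<phi>]]
    unfolding mem_dom_phase_arc by simp
  then have "phase_arc \<tau> \<sigma> \<phi> (0, 0) = Some (\<phi> 0 0)" by (rule phase_arc_val)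
  then obtain y where y: "y \<in> max_solutions_from H U" "phase_arc \<tau> \<sigma> \<phi> \<subseteq>\<^sub>m y"
    by (rule solution_in_max_solutions_from[OF phase_solution_imp_solution[OF sol] _ start])
  have "y (t, j) = Some (\<phi> j t)"
    using bspec[OF y(2)[unfolded map_le_def], of "(t, j)"] phase_arc_val[OF t, of \<phi>] t
    by (simp add: mem_dom_phase_arc)
  then have "\<phi> j t \<in> reachable_range H U" using y(1) unfolding reachable_range_def by (auto intro: ranI)
  with reach show ?thesis by blast
qed

text \<open>By time invariance the solution may be restarted at \<open>(s, i)\<close>, so a bound
  for solutions starting in \<open>U\<close> applies from any visit to \<open>U\<close>
  onwards.\<close>

lemma reachable_range_later:
  assumes reach: "reachable_range H U \<subseteq> V" and sol: "solution H x"
    and st: "(s, i) \<in> dom x" "(t, j) \<in> dom x" "s \<le> t" "i \<le> j" and U: "the (x (s, i)) \<in> U"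
  shows "the (x (t, j)) \<in> V"
proof -
  obtain \<tau> \<sigma> \<phi> where P: "phase_solution H \<tau> \<sigma> \<phi>"
    "\<And>m r. r \<in> phase \<tau> \<sigma> m \<Longrightarrow> x (s + r, i + m) = Some (\<phi> m r) \<and> 0 \<le> r \<and> s + r \<le> t \<and> i + m \<le> j"
    "0 \<in> phase \<tau> \<sigma> 0" "t - s \<in> phase \<tau> \<sigma> (j - i)"
    using solution_segment_phases[OF sol st] by metis
  have "\<phi> 0 0 \<in> U" using P(2)[OF P(3)] U by simp
  from reachable_range_phase[OF reach P(1) this P(4)] show ?thesis using P(2)[OF P(4)] st by simp
qed

lemma restrict_system_simps [simp]:
  "flow_set (restrict_system H A) = flow_set H \<inter> A" "flow_map (restrict_system H A) = flow_map H"
  "jump_set (restrict_system H A) = jump_set H \<inter> A" "jump_map (restrict_system H A) = jump_map H"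
  by (simp_all add: restrict_system_def)

lemma restrict_system_UNIV: "restrict_system H UNIV = H"
  by (simp add: restrict_system_def)

lemma restrict_restrict_system: "B \<subseteq> A \<Longrightarrow> restrict_system (restrict_system H A) B = restrict_system H B"
  by (simp add: restrict_system_def Int_absorb1 Int_assoc)

lemma locally_bounded_on_subset:
  assumes "locally_bounded_on S M" "T \<subseteq> S"
  shows "locally_bounded_on T M"
  unfolding locally_bounded_on_def
proof
  fix x assume "x \<in> T"
  with assms obtain U where U: "open U" "x \<in> U" "bounded (\<Union>y\<in>U \<inter> S. M y)"
    unfolding locally_bounded_on_def by blast
  have "bounded (\<Union>y\<in>U \<inter> T. M y)" by (rule bounded_subset[OF U(3)]) (use assms(2) in blast)
  with U show "\<exists>U. open U \<and> x \<in> U \<and> bounded (\<Union>y\<in>U \<inter> T. M y)" by blast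
qed

lemma basic_assumptions_restrict:
  assumes "basic_assumptions H" "closed A"
  shows "basic_assumptions (restrict_system H A)"
  using assms by (auto simp: basic_assumptions_def intro: locally_bounded_on_subset)

lemma solution_restrict_imp:
  assumes "solution (restrict_system H A) x"
  shows "solution H x"
  using assms unfolding solution_def Let_def by auto

lemma phase_solution_restrict:
  assumes sol: "phase_solution H \<tau> \<sigma> \<phi>" and A: "\<And>j t. t \<in> phase \<tau> \<sigma> j \<Longrightarrow> \<phi> j t \<in> A"
  shows "phase_solution (restrict_system H A) \<tau> \<sigma> \<phi>"
proof -
  have "\<phi> j t \<in> A" if "\<tau> j \<le> ereal t \<and> ereal t < \<sigma> j" for j t
    using A[of t j] that by (simp add: phase_def less_imp_le)
  moreover have "\<phi> j t \<in> A" if "\<tau> (Suc j) = ereal t" for j t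
    by (rule A[OF phase_solution_value_jump(1)[OF sol that]])
  ultimately show ?thesis using sol unfolding phase_solution_def by simp
qed

text \<open>Since the radii \<open>\<eta> k\<close> shrink to zero and \<open>\<Gamma>\<close> is
  closed, the limit lies in \<open>\<Gamma>\<close>. Restriction only intersects the flow and jump
  sets with \<open>\<Gamma>\<close>, so the limit solves the restricted system.\<close>

lemma phase_solutions_convergent_subsequence_restrict:
  fixes H :: "'a::euclidean_space hybrid_system"
  assumes H: "basic_assumptions H" and \<Gamma>: "closed \<Gamma>"
    and sol: "\<And>k. phase_solution H (\<tau> k) (\<sigma> k) (\<phi> k)"
    and K: "bounded K" "\<And>k j t. t \<in> phase (\<tau> k) (\<sigma> k) j \<Longrightarrow> \<phi> k j t \<in> K"
    and \<eta>: "\<eta> \<longlonglongrightarrow> 0" "\<And>k j t. t \<in> phase (\<tau> k) (\<sigma> k) j \<Longrightarrow> \<phi> k j t \<in> set_ball (\<eta> k) \<Gamma>"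
  obtains r \<tau>' \<sigma>' \<psi> where "strict_mono (r :: nat \<Rightarrow> nat)" "phase_solution (restrict_system H \<Gamma>) \<tau>' \<sigma>' \<psi>"
    "phases_converge (\<lambda>k. \<tau> (r k)) (\<lambda>k. \<sigma> (r k)) (\<lambda>k. \<phi> (r k)) \<tau>' \<sigma>' \<psi>"
proof -
  have K': "compact (closure K)" using K(1) by simp
  have K2: "\<phi> k j t \<in> closure K" if "t \<in> phase (\<tau> k) (\<sigma> k) j" for k j t
    using K(2)[OF that] closure_subset by blast
  obtain r \<tau>' \<sigma>' \<psi> where r: "strict_mono (r :: nat \<Rightarrow> nat)" and ps: "phase_solution H \<tau>' \<sigma>' \<psi>"
    and pc: "phases_converge (\<lambda>k. \<tau> (r k)) (\<lambda>k. \<sigma> (r k)) (\<lambda>k. \<phi> (r k)) \<tau>' \<sigma>' \<psi>"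
    by (rule phase_solutions_convergent_subsequence[where \<tau> = \<tau> and \<sigma> = \<sigma> and \<phi> = \<phi>, OF H sol K' K2])
  have pt: "phase_times (\<tau> k) (\<sigma> k)" for k using sol[of k] by (simp add: phase_solution_def)
  have "\<psi> j t \<in> \<Gamma>" if t: "t \<in> phase \<tau>' \<sigma>' j" for j t
  proof -
    obtain u where u: "\<forall>\<^sub>F k in sequentially. u k \<in> phase (\<tau> (r k)) (\<sigma> (r k)) j"
      "(\<lambda>k. \<phi> (r k) j (u k)) \<longlonglongrightarrow> \<psi> j t"
      by (rule phases_converge_points[OF pc pt t])
    show ?thesis
    proof (rule set_ball_limit[OF \<Gamma> _ _ u(2)])
      show "(\<lambda>k. \<eta> (r k)) \<longlonglongrightarrow> 0" using LIMSEQ_subseq_LIMSEQ[OF \<eta>(1) r] by (simp add: comp_def)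
      show "\<forall>\<^sub>F k in sequentially. \<phi> (r k) j (u k) \<in> set_ball (\<eta> (r k)) \<Gamma>"
        using u(1) by eventually_elim (rule \<eta>(2))
    qed
  qed
  from that[OF r phase_solution_restrict[OF ps this] pc] show thesis .
qed

section \<open>Reduction theorems\<close>

text \<open>A maximal extension of a complete arc is complete and hence convergent; its late values
  are already values of the arc itself. The bound \<open>N\<close> allows a visit to be requested
  away from the initial point.\<close>

lemma complete_phase_arc_meets_attractor:
  assumes ps: "phase_solution H \<tau> \<sigma> \<psi>" and comp: "complete_arc (phase_arc \<tau> \<sigma> \<psi>)"
    and attr: "\<forall>y\<in>max_solutions_from H {\<psi> 0 0}. complete_arc y \<longrightarrow> converges_to_set y \<Gamma>"
    and \<epsilon>: "\<epsilon> > 0"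
  obtains t j where "t \<in> phase \<tau> \<sigma> j" "N \<le> t + real j" "\<psi> j t \<in> set_ball \<epsilon> \<Gamma>"
proof -
  let ?x = "phase_arc \<tau> \<sigma> \<psi>"
  have pt: "phase_times \<tau> \<sigma>" using ps by (simp add: phase_solution_def)
  have loc: "local_time_domain (dom ?x)" by (rule phase_arc_local_time_domain[OF pt])
  have "0 \<in> phase \<tau> \<sigma> 0" using local_time_domainD(1)[OF loc] unfolding mem_dom_phase_arc .
  then have "?x (0, 0) = Some (\<psi> 0 0)" by (rule phase_arc_val)
  then obtain y where y: "y \<in> max_solutions_from H {\<psi> 0 0}" "?x \<subseteq>\<^sub>m y"
    by (rule solution_in_max_solutions_from[OF phase_solution_imp_solution[OF ps] _ singletonI])
  have "complete_arc y" by (rule complete_arc_mono[OF comp y(2)])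
  with attr y(1) have "converges_to_set y \<Gamma>" by blast
  then obtain N' where N': "\<And>t j. (t, j) \<in> dom y \<Longrightarrow> N' \<le> t + real j \<Longrightarrow> the (y (t, j)) \<in> set_ball \<epsilon> \<Gamma>"
    using converges_to_set_eventually \<epsilon> by blast
  obtain t j where tj: "(t, j) \<in> dom ?x" "max N N' \<le> t + real j"
    using complete_arc_unbounded[OF loc comp] by blast
  then have t: "t \<in> phase \<tau> \<sigma> j" by (simp add: mem_dom_phase_arc)
  have "y (t, j) = Some (\<psi> j t)"
    using bspec[OF y(2)[unfolded map_le_def] tj(1)] phase_arc_val[OF t, of \<psi>] by simp
  then have "\<psi> j t \<in> set_ball \<epsilon> \<Gamma>" using N'[of t j] tj(2) by auto
  with that t tj(2) show thesis by simp
qed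

text \<open>If the hybrid lengths do not diverge, infinitely many of them lie below some bound; the
  pigeonhole principle then fixes the jump count, and Bolzano-Weierstrass makes the times converge.
  The two cases lead to a limit exit time and to a complete limit, respectively.\<close>

lemma bounded_or_divergent_subsequence:
  fixes T :: "nat \<Rightarrow> real" and J :: "nat \<Rightarrow> nat"
  assumes T: "\<And>n. 0 \<le> T n"
  obtains (bounded) q T' j where "strict_mono (q :: nat \<Rightarrow> nat)" "(\<lambda>n. T (q n)) \<longlonglongrightarrow> T'" "\<And>n. J (q n) = j"
    | (divergent) "filterlim (\<lambda>n. T n + real (J n)) at_top sequentially"
proof (cases "filterlim (\<lambda>n. T n + real (J n)) at_top sequentially")
  case True then show thesis by (rule divergent)
next
  case False
  then obtain Z where "\<not> (\<forall>\<^sub>F n in sequentially. Z \<le> T n + real (J n))"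
    unfolding filterlim_at_top by blast
  then have inf: "infinite {n. T n + real (J n) < Z}"
    unfolding eventually_sequentially infinite_nat_iff_unbounded_le by (auto simp: not_le)
  have fin: "finite (J ` {n. T n + real (J n) < Z})"
  proof (rule finite_subset)
    show "J ` {n. T n + real (J n) < Z} \<subseteq> {..nat \<lceil>Z\<rceil>}"
    proof (rule image_subsetI)
      fix n assume "n \<in> {n. T n + real (J n) < Z}"
      then have "real (J n) \<le> Z" using T[of n] by simp
      then show "J n \<in> {..nat \<lceil>Z\<rceil>}" unfolding atMost_iff by linarith
    qed
  qed simp
  obtain n0 where n0: "infinite {n \<in> {n. T n + real (J n) < Z}. J n = J n0}"
    using pigeonhole_infinite[OF inf fin] by auto
  define S where "S = {n \<in> {n. T n + real (J n) < Z}. J n = J n0}"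
  define e where "e = enumerate S"
  have e: "strict_mono e" "\<And>n. e n \<in> S"
    using n0 unfolding e_def S_def[symmetric] by (auto intro: strict_mono_enumerate enumerate_in_set)
  have "bounded (range (\<lambda>n. T (e n)))"
    unfolding bounded_iff
  proof (intro exI[of _ Z] ballI)
    fix v assume "v \<in> range (\<lambda>n. T (e n))"
    then obtain n where "v = T (e n)" by blast
    then show "norm v \<le> Z" using T[of "e n"] e(2)[of n] by (auto simp: S_def)
  qed
  then obtain T' s where s: "strict_mono (s :: nat \<Rightarrow> nat)" "((\<lambda>n. T (e n)) \<circ> s) \<longlonglongrightarrow> T'"
    using bounded_imp_convergent_subsequence by blast
  show thesis
  proof (rule bounded)
    show "strict_mono (e \<circ> s)" by (rule strict_mono_o[OF e(1) s(1)])
    show "(\<lambda>n. T ((e \<circ> s) n)) \<longlonglongrightarrow> T'" using s(2) by (simp add: comp_def)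
    show "J ((e \<circ> s) n) = J n0" for n using e(2)[of "s n"] by (simp add: S_def)
  qed
qed

lemma bounded_jump_image:
  fixes H :: "'a::euclidean_space hybrid_system"
  assumes "basic_assumptions H" "bounded S"
  shows "bounded (\<Union>z\<in>S \<inter> jump_set H. jump_map H z)"
proof -
  have "bounded (\<Union>z\<in>closure S \<inter> jump_set H. jump_map H z)"
    by (rule locally_bounded_on_compact[where S = "jump_set H"])
      (use assms in \<open>auto simp: basic_assumptions_def intro: compact_Int_closed\<close>)
  then show ?thesis by (rule bounded_subset) (use closure_subset in blast)
qed

text \<open>If stability failed, cut solutions starting ever closer to \<open>\<Gamma>\<^sub>1\<close> down to the piece between
  the last visit to a small neighbourhood \<open>A\<close> of \<open>\<Gamma>\<^sub>1\<close> and the first exit from a larger one. A limit of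
  these pieces is a solution in \<open>\<Gamma>\<close>: it either violates stability of \<open>\<Gamma>\<^sub>1\<close> relative to \<open>\<Gamma>\<close>
  (bounded durations) or is complete and avoids \<open>\<Gamma>\<^sub>1\<close>, against attractivity.\<close>

theorem relative_stability_reduction:
  fixes H :: "'a::euclidean_space hybrid_system"
  assumes H: "basic_assumptions H" and \<Gamma>1: "compact \<Gamma>\<^sub>1" and \<Gamma>: "closed \<Gamma>"
    and S1: "\<And>\<epsilon>. \<epsilon> > 0 \<Longrightarrow> \<exists>\<delta>>0. reachable_range (restrict_system H \<Gamma>) (set_ball \<delta> \<Gamma>\<^sub>1) \<subseteq> set_ball \<epsilon> \<Gamma>\<^sub>1"
    and A1: "\<epsilon>0 > 0" "\<forall>y\<in>max_solutions_from (restrict_system H \<Gamma>) (set_ball \<epsilon>0 \<Gamma>\<^sub>1).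
        complete_arc y \<longrightarrow> converges_to_set y \<Gamma>\<^sub>1"
    and S2: "\<And>\<epsilon>. \<epsilon> > 0 \<Longrightarrow> \<exists>\<delta>>0. reachable_range H (set_ball \<delta> \<Gamma>\<^sub>1) \<subseteq> set_ball \<epsilon> \<Gamma>"
  shows "stable_compact H \<Gamma>\<^sub>1"
proof (rule ccontr)
  let ?H = "restrict_system H \<Gamma>"
  assume "\<not> stable_compact H \<Gamma>\<^sub>1"
  then obtain \<epsilon> where \<epsilon>: "\<epsilon> > 0"
    and unst: "\<And>\<delta>. \<delta> > 0 \<Longrightarrow> \<not> reachable_range H (set_ball \<delta> \<Gamma>\<^sub>1) \<subseteq> set_ball \<epsilon> \<Gamma>\<^sub>1"
    unfolding stable_compact_def by blast
  \<comment> \<open>Leaving the \<open>\<epsilon>\<close>-ball entails leaving the smaller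
    \<open>U\<close>, and within the \<open>\<epsilon>0\<close>-ball relative attractivity is
    available. Below, \<open>\<delta>2\<close> is half of a minimum so that even the closure
    \<open>A\<close> stays inside the \<open>\<delta>1\<close>-ball and inside
    \<open>U\<close>.\<close>
  define \<epsilon>1 where "\<epsilon>1 = min \<epsilon> \<epsilon>0"
  have \<epsilon>1: "\<epsilon>1 > 0" using \<epsilon> A1(1) by (simp add: \<epsilon>1_def)
  obtain \<delta>1 where \<delta>1: "\<delta>1 > 0" "reachable_range ?H (set_ball \<delta>1 \<Gamma>\<^sub>1) \<subseteq> set_ball \<epsilon>1 \<Gamma>\<^sub>1"
    using S1[OF \<epsilon>1] by blast
  define \<delta>2 where "\<delta>2 = min \<delta>1 \<epsilon>1 / 2"
  have \<delta>2: "\<delta>2 > 0" "\<delta>2 < \<delta>1" "\<delta>2 < \<epsilon>1" using \<delta>1(1) \<epsilon>1 by (auto simp: \<delta>2_def min_def)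
  define A where "A = closure (set_ball \<delta>2 \<Gamma>\<^sub>1)"
  define U where "U = set_ball \<epsilon>1 \<Gamma>\<^sub>1"
  have A: "closed A" "set_ball \<delta>2 \<Gamma>\<^sub>1 \<subseteq> A" "A \<subseteq> set_ball \<delta>1 \<Gamma>\<^sub>1" "A \<subseteq> U"
    unfolding A_def U_def by (rule closed_closure closure_subset closure_set_ball_subset \<delta>2)+
  have U: "open U" "bounded U"
    using open_set_ball bounded_set_ball[OF compact_imp_bounded[OF \<Gamma>1]] by (auto simp: U_def)
  \<comment> \<open>A bounded set that also contains the exit point, which may lie outside
    \<open>closure U\<close> when it is reached by a jump.\<close>
  define K where "K = closure U \<union> (\<Union>z\<in>U \<inter> jump_set H. jump_map H z)"
  have K: "bounded K" unfolding K_def using bounded_closure[OF U(2)] bounded_jump_image[OF H U(2)] by simp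
  define \<eta> where "\<eta> n = inverse (real (Suc n))" for n
  have \<eta>: "\<eta> \<longlonglongrightarrow> 0" unfolding \<eta>_def by (rule LIMSEQ_inverse_real_of_nat)
  have "\<exists>\<tau> \<sigma> \<phi> T J. phase_solution H \<tau> \<sigma> \<phi> \<and> T \<in> phase \<tau> \<sigma> J \<and> \<phi> J T \<notin> U \<and> \<phi> 0 0 \<in> A \<and>
      (\<forall>j t. t \<in> phase \<tau> \<sigma> j \<longrightarrow> \<phi> j t \<in> K \<and> \<phi> j t \<in> set_ball (\<eta> n) \<Gamma> \<and> ((t, j) \<noteq> (0, 0) \<longrightarrow> \<phi> j t \<notin> A))" for n
  proof -
    have "\<eta> n > 0" by (simp add: \<eta>_def)
    then obtain \<delta> where \<delta>: "\<delta> > 0" "reachable_range H (set_ball \<delta> \<Gamma>\<^sub>1) \<subseteq> set_ball (\<eta> n) \<Gamma>"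
      using S2 by blast
    \<comment> \<open>Starting in the \<open>\<delta>\<close>-ball keeps the whole solution within
      \<open>\<eta> n\<close> of \<open>\<Gamma>\<close>; starting in the
      \<open>\<delta>2\<close>-ball puts the initial point into \<open>A\<close>, so that a last
      visit to \<open>A\<close> exists.\<close>
    have "\<not> reachable_range H (set_ball (min \<delta> \<delta>2) \<Gamma>\<^sub>1) \<subseteq> set_ball \<epsilon> \<Gamma>\<^sub>1"
      using \<delta>(1) \<delta>2(1) by (intro unst) simp
    then obtain q x where x: "x \<in> max_solutions_from H (set_ball (min \<delta> \<delta>2) \<Gamma>\<^sub>1)" "q \<in> ran x" "q \<notin> set_ball \<epsilon> \<Gamma>\<^sub>1"
      unfolding reachable_range_def by blast
    note sol = max_solutions_fromD(1)[OF x(1)] and loc = max_solutions_fromD(2)[OF x(1)]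
    from max_solutions_fromD(4)[OF x(1)] obtain p
      where p: "p \<in> set_ball (min \<delta> \<delta>2) \<Gamma>\<^sub>1" "x (0, 0) = Some p" by blast
    have pA: "p \<in> A" and p\<delta>: "p \<in> set_ball \<delta> \<Gamma>\<^sub>1"
      using p(1) A(2) set_ball_mono[of "min \<delta> \<delta>2" \<delta>2 \<Gamma>\<^sub>1 \<Gamma>\<^sub>1] set_ball_mono[of "min \<delta> \<delta>2" \<delta> \<Gamma>\<^sub>1 \<Gamma>\<^sub>1] by auto
    have pU: "p \<in> U" using pA A(4) by blast
    have qU: "q \<notin> U" using x(3) set_ball_mono[of \<epsilon>1 \<epsilon> \<Gamma>\<^sub>1 \<Gamma>\<^sub>1] by (auto simp: U_def \<epsilon>1_def)
    obtain t j where tj: "(t, j) \<in> dom x" "arc_val x j t \<notin> U"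
      and before: "\<And>s i. (s, i) \<in> dom x \<Longrightarrow> s \<le> t \<Longrightarrow> i \<le> j \<Longrightarrow> (s, i) \<noteq> (t, j) \<Longrightarrow> arc_val x i s \<in> U"
      and exit: "arc_val x j t \<in> closure U \<union> (\<Union>z\<in>U \<inter> jump_set H. jump_map H z)"
      using first_exit_time[OF sol p(2) pU U(1) x(2) qU] by metis
    obtain s i where si: "(s, i) \<in> dom x" "s \<le> t" "i \<le> j" "arc_val x i s \<in> A"
      and after: "\<And>u k. (u, k) \<in> dom x \<Longrightarrow> s \<le> u \<Longrightarrow> u \<le> t \<Longrightarrow> i \<le> k \<Longrightarrow> k \<le> j \<Longrightarrow> (u, k) \<noteq> (s, i) \<Longrightarrow> arc_val x k u \<notin> A"
      using last_visit_time[OF sol p(2) pA A(1) tj(1)] by metis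
    obtain \<tau> \<sigma> \<phi> where P: "phase_solution H \<tau> \<sigma> \<phi>"
      "\<And>m r. r \<in> phase \<tau> \<sigma> m \<Longrightarrow> x (s + r, i + m) = Some (\<phi> m r) \<and> 0 \<le> r \<and> s + r \<le> t \<and> i + m \<le> j"
      "0 \<in> phase \<tau> \<sigma> 0" "t - s \<in> phase \<tau> \<sigma> (j - i)"
      using solution_segment_phases[OF sol si(1) tj(1) si(2,3)] by metis
    have "\<phi> m r \<in> K \<and> \<phi> m r \<in> set_ball (\<eta> n) \<Gamma> \<and> ((r, m) \<noteq> (0, 0) \<longrightarrow> \<phi> m r \<notin> A)" if r: "r \<in> phase \<tau> \<sigma> m" for m r
    proof -
      have d: "(s + r, i + m) \<in> dom x" "arc_val x (i + m) (s + r) = \<phi> m r" "0 \<le> r" "s + r \<le> t" "i + m \<le> j"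
        using P(2)[OF r] by auto
      have "\<phi> m r \<in> K"
      proof (cases "(s + r, i + m) = (t, j)")
        case True then show ?thesis using exit d(2) unfolding K_def by simp
      next
        case False
        then have "\<phi> m r \<in> U" using before[OF d(1,4,5)] d(2) by simp
        then show ?thesis using closure_subset[of U] unfolding K_def by blast
      qed
      moreover have "\<phi> m r \<in> reachable_range H (set_ball \<delta> \<Gamma>\<^sub>1)"
      proof -
        have "x \<in> max_solutions_from H (set_ball \<delta> \<Gamma>\<^sub>1)"
          using x(1) p p\<delta> unfolding max_solutions_from_def by blast
        then show ?thesis using P(2)[OF r] unfolding reachable_range_def by (blast intro: ranI)
      qed
      moreover have "\<phi> m r \<notin> A" if "(r, m) \<noteq> (0, 0)"
        using after[OF d(1) _ d(4) _ d(5)] d(2,3) that by auto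
      ultimately show ?thesis using \<delta>(2) by blast
    qed
    moreover have "\<phi> (j - i) (t - s) \<notin> U" using P(2)[OF P(4)] tj(2) si(2,3) by simp
    moreover have "\<phi> 0 0 \<in> A" using P(2)[OF P(3)] si(4) by simp
    ultimately show ?thesis using P(1,4) by blast
  qed
  then obtain \<tau> \<sigma> \<phi> T J where ps: "\<And>n. phase_solution H (\<tau> n) (\<sigma> n) (\<phi> n)"
    and TJ: "\<And>n. T n \<in> phase (\<tau> n) (\<sigma> n) (J n)" "\<And>n. \<phi> n (J n) (T n) \<notin> U" 
    and start: "\<And>n. \<phi> n 0 0 \<in> A"
    and inK: "\<And>n j t. t \<in> phase (\<tau> n) (\<sigma> n) j \<Longrightarrow> \<phi> n j t \<in> K"
    and in\<Gamma>: "\<And>n j t. t \<in> phase (\<tau> n) (\<sigma> n) j \<Longrightarrow> \<phi> n j t \<in> set_ball (\<eta> n) \<Gamma>"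
    and notA: "\<And>n j t. t \<in> phase (\<tau> n) (\<sigma> n) j \<Longrightarrow> (t, j) \<noteq> (0, 0) \<Longrightarrow> \<phi> n j t \<notin> A"
    by metis
  have pt: "phase_times (\<tau> n) (\<sigma> n)" for n using ps[of n] by (simp add: phase_solution_def)
  have zero: "0 \<in> phase (\<tau> n) (\<sigma> n) 0" for n
    using local_time_domainD(1)[OF phase_arc_local_time_domain[OF pt[of n], of "\<phi> n"]] unfolding mem_dom_phase_arc .
  have nonneg: "0 \<le> t" if "t \<in> phase (\<tau> n) (\<sigma> n) j" for n t j
    using phase_times_nonneg[OF pt[of n], of j] that unfolding phase_def
    by (metis (no_types, lifting) ereal_less_eq(3) mem_Collect_eq order_trans zero_ereal_def)
  have T0: "0 \<le> T n" for n by (rule nonneg[OF TJ(1)])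
  from T0 show False
  proof (cases rule: bounded_or_divergent_subsequence[of T J])
    case (bounded q T' j)
    have \<eta>q: "(\<lambda>n. \<eta> (q n)) \<longlonglongrightarrow> 0" using LIMSEQ_subseq_LIMSEQ[OF \<eta> bounded(1)] by (simp add: comp_def)
    obtain r \<tau>' \<sigma>' \<psi> where r: "strict_mono (r :: nat \<Rightarrow> nat)" and ps': "phase_solution ?H \<tau>' \<sigma>' \<psi>"
      and pc: "phases_converge (\<lambda>k. \<tau> (q (r k))) (\<lambda>k. \<sigma> (q (r k))) (\<lambda>k. \<phi> (q (r k))) \<tau>' \<sigma>' \<psi>"
      by (rule phase_solutions_convergent_subsequence_restrict[where \<tau> = "\<lambda>n. \<tau> (q n)" and \<sigma> = "\<lambda>n. \<sigma> (q n)"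
            and \<phi> = "\<lambda>n. \<phi> (q n)", OF H \<Gamma> ps K inK \<eta>q in\<Gamma>])
    note lim = phases_convergeD(1,2)[OF pc] and val = phases_convergeD(3)[OF pc]
    have Tr: "(\<lambda>k. T (q (r k))) \<longlonglongrightarrow> T'" using LIMSEQ_subseq_LIMSEQ[OF bounded(2) r] by (simp add: comp_def)
    have Tmem: "T (q (r k)) \<in> phase (\<tau> (q (r k))) (\<sigma> (q (r k))) j" for k
      using TJ(1)[of "q (r k)"] bounded(3) by simp
    have "\<psi> 0 0 \<in> A"
      by (rule Lim_in_closed_set[OF A(1) _ _ val[of "\<lambda>_. 0" 0 0]]) (use start zero in auto)
    then have "\<psi> 0 0 \<in> set_ball \<delta>1 \<Gamma>\<^sub>1" using A(3) by blast
    moreover have "T' \<in> phase \<tau>' \<sigma>' j"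
    proof -
      have eT: "(\<lambda>k. ereal (T (q (r k)))) \<longlonglongrightarrow> ereal T'" using Tr by simp
      have "\<tau>' j \<le> ereal T'" by (rule tendsto_le[OF _ eT lim(1)]) (use Tmem in \<open>auto simp: phase_def\<close>)
      moreover have "ereal T' \<le> \<sigma>' j" by (rule tendsto_le[OF _ lim(2) eT]) (use Tmem in \<open>auto simp: phase_def\<close>)
      ultimately show ?thesis by (simp add: phase_def)
    qed
    ultimately have "\<psi> j T' \<in> U"
      using reachable_range_phase[OF \<delta>1(2) ps'] unfolding U_def by blast
    moreover have "\<psi> j T' \<in> - U"
    proof (rule Lim_in_closed_set[OF closed_Compl[OF U(1)] _ _ val[OF _ Tr]])
      show "\<forall>\<^sub>F k in sequentially. \<phi> (q (r k)) j (T (q (r k))) \<in> - U"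
        using TJ(2)[of "q (r _)"] bounded(3) by (auto intro!: always_eventually)
    qed (use Tmem in auto)
    ultimately show False by blast
  next
    case divergent
    obtain r \<tau>' \<sigma>' \<psi> where r: "strict_mono (r :: nat \<Rightarrow> nat)" and ps': "phase_solution ?H \<tau>' \<sigma>' \<psi>"
      and pc: "phases_converge (\<lambda>k. \<tau> (r k)) (\<lambda>k. \<sigma> (r k)) (\<lambda>k. \<phi> (r k)) \<tau>' \<sigma>' \<psi>"
      by (rule phase_solutions_convergent_subsequence_restrict[where \<tau> = \<tau> and \<sigma> = \<sigma>
            and \<phi> = \<phi>, OF H \<Gamma> ps K inK \<eta> in\<Gamma>])
    note lim = phases_convergeD(1,2)[OF pc] and val = phases_convergeD(3)[OF pc]
    have pt': "phase_times \<tau>' \<sigma>'" using ps' by (simp add: phase_solution_def)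
    have comp: "complete_arc (phase_arc \<tau>' \<sigma>' \<psi>)"
    proof (rule limit_phase_arc_complete[where \<tau> = "\<lambda>k. \<tau> (r k)" and \<sigma> = "\<lambda>k. \<sigma> (r k)", OF pt pt' lim TJ(1)])
      show "filterlim (\<lambda>k. T (r k) + real (J (r k))) at_top sequentially"
        using filterlim_compose[OF divergent filterlim_subseq[OF r]] by simp
    qed
    have "\<psi> 0 0 \<in> A"
      by (rule Lim_in_closed_set[OF A(1) _ _ val[of "\<lambda>_. 0" 0 0]]) (use start zero in auto)
    then have "\<psi> 0 0 \<in> set_ball \<epsilon>0 \<Gamma>\<^sub>1"
      using A(4) set_ball_mono[of \<epsilon>1 \<epsilon>0 \<Gamma>\<^sub>1 \<Gamma>\<^sub>1] by (auto simp: U_def \<epsilon>1_def)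
    then have "\<forall>y\<in>max_solutions_from ?H {\<psi> 0 0}. complete_arc y \<longrightarrow> converges_to_set y \<Gamma>\<^sub>1"
      using A1(2) unfolding max_solutions_from_def by blast
    \<comment> \<open>The bound 1 asks for a visit after the start: the pieces begin in
      \<open>A\<close> and avoid it at every hybrid time except \<open>(0, 0)\<close>, so a visit at
      \<open>(0, 0)\<close> would be no contradiction.\<close>
    then obtain t j where t: "t \<in> phase \<tau>' \<sigma>' j" "1 \<le> t + real j" "\<psi> j t \<in> set_ball \<delta>2 \<Gamma>\<^sub>1"
      using complete_phase_arc_meets_attractor[OF ps' comp _ \<delta>2(1)] by blast
    obtain u where u: "\<forall>\<^sub>F k in sequentially. u k \<in> phase (\<tau> (r k)) (\<sigma> (r k)) j" "u \<longlonglongrightarrow> t"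
      "(\<lambda>k. \<phi> (r k) j (u k)) \<longlonglongrightarrow> \<psi> j t"
      by (rule phases_converge_points[OF pc pt t(1)])
    have ne: "\<forall>\<^sub>F k in sequentially. (u k, j) \<noteq> (0, 0)"
    proof (cases "j = 0")
      case True
      then have "\<forall>\<^sub>F k in sequentially. 0 < u k" using t(2) by (intro order_tendstoD(1)[OF u(2)]) simp
      then show ?thesis by eventually_elim simp
    qed simp
    have "\<psi> j t \<in> - set_ball \<delta>2 \<Gamma>\<^sub>1"
    proof (rule Lim_in_closed_set[OF closed_Compl[OF open_set_ball] _ _ u(3)])
      show "\<forall>\<^sub>F k in sequentially. \<phi> (r k) j (u k) \<in> - set_ball \<delta>2 \<Gamma>\<^sub>1"
        using u(1) ne by eventually_elim (use notA A(2) in blast)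
    qed simp
    with t(3) show False by blast
  qed
qed

text \<open>A complete solution that never enters a neighbourhood of \<open>\<Gamma>\<^sub>1\<close> has, as a limit of its tails, a complete
  solution in \<open>\<Gamma>\<close> that avoids this neighbourhood as well.\<close>

theorem relative_attraction_reduction:
  fixes H :: "'a::euclidean_space hybrid_system"
  assumes H: "basic_assumptions H" and \<Gamma>: "closed \<Gamma>" and stab: "stable_compact H \<Gamma>\<^sub>1"
    and x: "x \<in> max_solutions_from H U" and comp: "complete_arc x"
    and conv: "converges_to_set x \<Gamma>" and bdd: "bounded (ran x)"
    and A1: "\<forall>y\<in>max_solutions_from (restrict_system H \<Gamma>) (closure (ran x)).
        complete_arc y \<longrightarrow> converges_to_set y \<Gamma>\<^sub>1"
  shows "converges_to_set x \<Gamma>\<^sub>1"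
proof (rule converges_to_setI)
  let ?H = "restrict_system H \<Gamma>"
  note sol = max_solutions_fromD(1)[OF x] and loc = max_solutions_fromD(2)[OF x]
  fix \<epsilon> :: real assume "\<epsilon> > 0"
  with stab obtain \<delta> where \<delta>: "\<delta> > 0" "reachable_range H (set_ball \<delta> \<Gamma>\<^sub>1) \<subseteq> set_ball \<epsilon> \<Gamma>\<^sub>1"
    unfolding stable_compact_def by blast
  \<comment> \<open>A single visit to the \<open>\<delta>\<close>-ball suffices, since stability
    keeps the solution in the \<open>\<epsilon>\<close>-ball from then on.\<close>
  have "\<exists>s i. (s, i) \<in> dom x \<and> the (x (s, i)) \<in> set_ball \<delta> \<Gamma>\<^sub>1"
  proof (rule ccontr)
    assume never: "\<not> ?thesis"
    define \<eta> where "\<eta> n = inverse (real (Suc n))" for n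
    have \<eta>: "\<eta> \<longlonglongrightarrow> 0" unfolding \<eta>_def by (rule LIMSEQ_inverse_real_of_nat)
    \<comment> \<open>The \<open>n\<close>-th segment starts so late that it stays within
      \<open>\<eta> n\<close> of \<open>\<Gamma>\<close>, and it lasts at least \<open>n\<close> in
      hybrid time, which makes the limit complete.\<close>
    have "\<exists>\<tau> \<sigma> \<phi> T J. phase_solution H \<tau> \<sigma> \<phi> \<and> T \<in> phase \<tau> \<sigma> J \<and> real n \<le> T + real J \<and>
        (\<forall>j t. t \<in> phase \<tau> \<sigma> j \<longrightarrow> \<phi> j t \<in> ran x \<and> \<phi> j t \<in> set_ball (\<eta> n) \<Gamma> \<and> \<phi> j t \<notin> set_ball \<delta> \<Gamma>\<^sub>1)" for n
    proof -
      have "\<eta> n > 0" by (simp add: \<eta>_def)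
      then obtain N where N: "\<And>t j. (t, j) \<in> dom x \<Longrightarrow> N \<le> t + real j \<Longrightarrow> the (x (t, j)) \<in> set_ball (\<eta> n) \<Gamma>"
        using converges_to_set_eventually[OF conv] by blast
      obtain s i where si: "(s, i) \<in> dom x" "N \<le> s + real i" using complete_arc_unbounded[OF loc comp] by blast
      obtain t j where tj: "(t, j) \<in> dom x" "s + real i + real n \<le> t + real j"
        using complete_arc_unbounded[OF loc comp] by blast
      have "s + real i \<le> t + real j" using tj(2) by simp
      note le = local_time_domain_total[OF loc si(1) tj(1) this]
      obtain \<tau> \<sigma> \<phi> where P: "phase_solution H \<tau> \<sigma> \<phi>"
        "\<And>m r. r \<in> phase \<tau> \<sigma> m \<Longrightarrow> x (s + r, i + m) = Some (\<phi> m r) \<and> 0 \<le> r \<and> s + r \<le> t \<and> i + m \<le> j"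
        "0 \<in> phase \<tau> \<sigma> 0" "t - s \<in> phase \<tau> \<sigma> (j - i)"
        using solution_segment_phases[OF sol si(1) tj(1) le] by metis
      have "\<phi> m r \<in> ran x \<and> \<phi> m r \<in> set_ball (\<eta> n) \<Gamma> \<and> \<phi> m r \<notin> set_ball \<delta> \<Gamma>\<^sub>1" if r: "r \<in> phase \<tau> \<sigma> m" for m r
      proof -
        have d: "(s + r, i + m) \<in> dom x" "the (x (s + r, i + m)) = \<phi> m r" "N \<le> s + r + real (i + m)"
          using P(2)[OF r] si(2) by auto
        have "the (x (s + r, i + m)) \<notin> set_ball \<delta> \<Gamma>\<^sub>1" using never d(1) by blast
        moreover have "\<phi> m r \<in> ran x" using P(2)[OF r] by (blast intro: ranI)
        ultimately show ?thesis using N[OF d(1,3)] d(2) by simp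
      qed
      moreover have "real n \<le> (t - s) + real (j - i)" using tj(2) le by simp
      ultimately show ?thesis using P(1,4) by blast
    qed
    then obtain \<tau> \<sigma> \<phi> T J where ps: "\<And>n. phase_solution H (\<tau> n) (\<sigma> n) (\<phi> n)"
      and TJ: "\<And>n. T n \<in> phase (\<tau> n) (\<sigma> n) (J n)" "\<And>n. real n \<le> T n + real (J n)"
      and inK: "\<And>n j t. t \<in> phase (\<tau> n) (\<sigma> n) j \<Longrightarrow> \<phi> n j t \<in> ran x"
      and in\<Gamma>: "\<And>n j t. t \<in> phase (\<tau> n) (\<sigma> n) j \<Longrightarrow> \<phi> n j t \<in> set_ball (\<eta> n) \<Gamma>"
      and notA: "\<And>n j t. t \<in> phase (\<tau> n) (\<sigma> n) j \<Longrightarrow> \<phi> n j t \<notin> set_ball \<delta> \<Gamma>\<^sub>1"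
      by metis
    have pt: "phase_times (\<tau> n) (\<sigma> n)" for n using ps[of n] by (simp add: phase_solution_def)
    have zero: "0 \<in> phase (\<tau> n) (\<sigma> n) 0" for n
      using local_time_domainD(1)[OF phase_arc_local_time_domain[OF pt[of n], of "\<phi> n"]] unfolding mem_dom_phase_arc .
    obtain r \<tau>' \<sigma>' \<psi> where r: "strict_mono (r :: nat \<Rightarrow> nat)" and ps': "phase_solution ?H \<tau>' \<sigma>' \<psi>"
      and pc: "phases_converge (\<lambda>k. \<tau> (r k)) (\<lambda>k. \<sigma> (r k)) (\<lambda>k. \<phi> (r k)) \<tau>' \<sigma>' \<psi>"
      by (rule phase_solutions_convergent_subsequence_restrict[where \<tau> = \<tau> and \<sigma> = \<sigma>
            and \<phi> = \<phi>, OF H \<Gamma> ps bdd inK \<eta> in\<Gamma>])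
    note lim = phases_convergeD(1,2)[OF pc] and val = phases_convergeD(3)[OF pc]
    have pt': "phase_times \<tau>' \<sigma>'" using ps' by (simp add: phase_solution_def)
    have comp': "complete_arc (phase_arc \<tau>' \<sigma>' \<psi>)"
    proof (rule limit_phase_arc_complete[where \<tau> = "\<lambda>k. \<tau> (r k)" and \<sigma> = "\<lambda>k. \<sigma> (r k)", OF pt pt' lim TJ(1)])
      have "filterlim (\<lambda>n. T n + real (J n)) at_top sequentially"
        by (rule filterlim_at_top_mono[OF filterlim_real_sequentially]) (use TJ(2) in simp)
      then show "filterlim (\<lambda>k. T (r k) + real (J (r k))) at_top sequentially"
        using filterlim_compose[OF _ filterlim_subseq[OF r]] by fast
    qed
    \<comment> \<open>The limit starts at a limit of points of the range of \<open>x\<close>; this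
      is why relative attractivity is required on the closure of the range.\<close>
    have "\<psi> 0 0 \<in> closure (ran x)"
    proof (rule Lim_in_closed_set[OF closed_closure _ _ val[of "\<lambda>_. 0" 0 0]])
      show "\<forall>\<^sub>F k in sequentially. \<phi> (r k) 0 0 \<in> closure (ran x)"
        using inK[OF zero] closure_subset by (intro always_eventually allI) blast
    qed (use zero in auto)
    then have "\<forall>y\<in>max_solutions_from ?H {\<psi> 0 0}. complete_arc y \<longrightarrow> converges_to_set y \<Gamma>\<^sub>1"
      using A1 unfolding max_solutions_from_def by blast
    then obtain t j where t: "t \<in> phase \<tau>' \<sigma>' j" "\<psi> j t \<in> set_ball \<delta> \<Gamma>\<^sub>1"
      using complete_phase_arc_meets_attractor[OF ps' comp' _ \<delta>(1)] by blast
    obtain u where u: "\<forall>\<^sub>F k in sequentially. u k \<in> phase (\<tau> (r k)) (\<sigma> (r k)) j" "u \<longlonglongrightarrow> t"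
      "(\<lambda>k. \<phi> (r k) j (u k)) \<longlonglongrightarrow> \<psi> j t"
      by (rule phases_converge_points[OF pc pt t(1)])
    have "\<psi> j t \<in> - set_ball \<delta> \<Gamma>\<^sub>1"
    proof (rule Lim_in_closed_set[OF closed_Compl[OF open_set_ball] _ _ u(3)])
      show "\<forall>\<^sub>F k in sequentially. \<phi> (r k) j (u k) \<in> - set_ball \<delta> \<Gamma>\<^sub>1"
        using u(1) by eventually_elim (use notA in blast)
    qed simp
    with t(2) show False by blast
  qed
  then obtain s i where si: "(s, i) \<in> dom x" "the (x (s, i)) \<in> set_ball \<delta> \<Gamma>\<^sub>1" by blast
  show "\<exists>N. \<forall>t j. (t, j) \<in> dom x \<and> N \<le> t + real j \<longrightarrow> the (x (t, j)) \<in> set_ball \<epsilon> \<Gamma>\<^sub>1"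
  proof (intro exI[of _ "s + real i"] allI impI)
    fix t j assume tj: "(t, j) \<in> dom x \<and> s + real i \<le> t + real j"
    note le = local_time_domain_total[OF loc si(1) conjunct1[OF tj] conjunct2[OF tj]]
    show "the (x (t, j)) \<in> set_ball \<epsilon> \<Gamma>\<^sub>1"
      by (rule reachable_range_later[OF \<delta>(2) sol si(1) conjunct1[OF tj] le si(2)])
  qed
qed

text \<open>Brings both notions of stability into the one form that the reduction needs. For a
  noncompact \<open>\<Gamma>\<close> the neighbourhood \<open>U\<close> may become arbitrarily thin
  far away, but around the compact subset it contains a ball of uniform radius.\<close>

lemma stable_set_near_subset:
  assumes "stable_set H \<Gamma>" "compact \<Gamma>\<^sub>1" "\<Gamma>\<^sub>1 \<subseteq> \<Gamma>" "\<epsilon> > 0"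
  shows "\<exists>\<delta>>0. reachable_range H (set_ball \<delta> \<Gamma>\<^sub>1) \<subseteq> set_ball \<epsilon> \<Gamma>"
proof -
  obtain U where U: "open U" "\<Gamma> \<subseteq> U" "reachable_range H U \<subseteq> set_ball \<epsilon> \<Gamma>"
  proof (cases "compact \<Gamma>")
    case True
    then obtain \<delta> where "\<delta> > 0" "reachable_range H (set_ball \<delta> \<Gamma>) \<subseteq> set_ball \<epsilon> \<Gamma>"
      using assms(1,4) unfolding stable_set_def stable_compact_def by auto
    then show thesis using that[OF open_set_ball subset_set_ball] by blast
  next
    case False
    then show thesis using that assms(1,4) unfolding stable_set_def stable_closed_def by auto
  qed
  have "\<Gamma>\<^sub>1 \<subseteq> U" using assms(3) U(2) by blast
  then obtain \<delta> where \<delta>: "\<delta> > 0" "set_ball \<delta> \<Gamma>\<^sub>1 \<subseteq> U"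
    using compact_set_ball_neighbourhood[OF assms(2) U(1)] by blast
  have "max_solutions_from H (set_ball \<delta> \<Gamma>\<^sub>1) \<subseteq> max_solutions_from H U"
    using \<delta>(2) unfolding max_solutions_from_def by blast
  then have "reachable_range H (set_ball \<delta> \<Gamma>\<^sub>1) \<subseteq> set_ball \<epsilon> \<Gamma>"
    using U(3) unfolding reachable_range_def by blast
  with \<delta>(1) show ?thesis by blast
qed

lemma basin_of_attraction_converges:
  assumes "x \<in> max_solutions_from H U" "U \<subseteq> basin_of_attraction H \<Gamma>" "complete_arc x"
  shows "converges_to_set x \<Gamma>"
proof -
  obtain p where p: "p \<in> U" "x \<in> max_solutions_from H {p}"
    using assms(1) unfolding max_solutions_from_def by blast
  with assms(2) have "p \<in> basin_of_attraction H \<Gamma>" by blast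
  with p(2) assms(3) show ?thesis
    unfolding basin_of_attraction_def basin_compact_def basin_closed_def by (auto split: if_splits)
qed

lemma ran_subset_reachable_range:
  "x \<in> max_solutions_from H U \<Longrightarrow> ran x \<subseteq> reachable_range H U"
  unfolding reachable_range_def by blast

text \<open>Besides the two reductions, only radii have to be matched: stability of
  \<open>\<Gamma>\<^sub>1\<close> keeps nearby solutions bounded, a start in the basin of
  \<open>\<Gamma>\<close> gives convergence to \<open>\<Gamma>\<close>, and the closure of the range
  must lie in the relative basin of \<open>\<Gamma>\<^sub>1\<close>.\<close>

theorem asymptotically_stable_reduction:
  fixes H :: "'a::euclidean_space hybrid_system"
  assumes H: "basic_assumptions H" and \<Gamma>1: "compact \<Gamma>\<^sub>1" "\<Gamma>\<^sub>1 \<subseteq> \<Gamma>" and \<Gamma>: "closed \<Gamma>"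
    and rel: "asymptotically_stable (restrict_system H \<Gamma>) \<Gamma>\<^sub>1"
    and outer: "asymptotically_stable H \<Gamma>"
  shows "asymptotically_stable H \<Gamma>\<^sub>1"
proof -
  let ?H = "restrict_system H \<Gamma>"
  have s: "stable_compact ?H \<Gamma>\<^sub>1" "stable_set H \<Gamma>"
    using rel outer \<Gamma>1(1) by (auto simp: asymptotically_stable_def stable_set_def)
  have "\<Gamma>\<^sub>1 \<subseteq> interior (basin_of_attraction ?H \<Gamma>\<^sub>1)"
    using rel by (auto simp: asymptotically_stable_def attractive_def)
  then obtain a where a: "a > 0" "set_ball a \<Gamma>\<^sub>1 \<subseteq> interior (basin_of_attraction ?H \<Gamma>\<^sub>1)"
    using compact_set_ball_neighbourhood[OF \<Gamma>1(1) open_interior] by blast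
  then have aB: "set_ball a \<Gamma>\<^sub>1 \<subseteq> basin_of_attraction ?H \<Gamma>\<^sub>1" using interior_subset by blast
  have "\<Gamma>\<^sub>1 \<subseteq> interior (basin_of_attraction H \<Gamma>)"
    using outer \<Gamma>1(2) by (auto simp: asymptotically_stable_def attractive_def)
  then obtain b where b: "b > 0" "set_ball b \<Gamma>\<^sub>1 \<subseteq> interior (basin_of_attraction H \<Gamma>)"
    using compact_set_ball_neighbourhood[OF \<Gamma>1(1) open_interior] by blast
  then have bB: "set_ball b \<Gamma>\<^sub>1 \<subseteq> basin_of_attraction H \<Gamma>" using interior_subset by blast
  have stab: "stable_compact H \<Gamma>\<^sub>1"
  proof (rule relative_stability_reduction[OF H \<Gamma>1(1) \<Gamma> _ a(1)])
    show "\<exists>\<delta>>0. reachable_range ?H (set_ball \<delta> \<Gamma>\<^sub>1) \<subseteq> set_ball \<epsilon> \<Gamma>\<^sub>1" if "\<epsilon> > 0" for \<epsilon>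
      using s(1) that unfolding stable_compact_def by blast
    show "\<forall>y\<in>max_solutions_from ?H (set_ball a \<Gamma>\<^sub>1). complete_arc y \<longrightarrow> converges_to_set y \<Gamma>\<^sub>1"
      using basin_of_attraction_converges[OF _ aB] by blast
    show "\<exists>\<delta>>0. reachable_range H (set_ball \<delta> \<Gamma>\<^sub>1) \<subseteq> set_ball \<epsilon> \<Gamma>" if "\<epsilon> > 0" for \<epsilon>
      by (rule stable_set_near_subset[OF s(2) \<Gamma>1 that])
  qed
  \<comment> \<open>Half of \<open>a\<close>, so that even the closure of the range lies in the ball
    of radius \<open>a\<close> and hence in the relative basin.\<close>
  obtain \<delta> where \<delta>: "\<delta> > 0" "reachable_range H (set_ball \<delta> \<Gamma>\<^sub>1) \<subseteq> set_ball (a / 2) \<Gamma>\<^sub>1"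
    using stab a(1) unfolding stable_compact_def by (meson half_gt_zero)
  let ?V = "set_ball (min b \<delta>) \<Gamma>\<^sub>1"
  have "?V \<subseteq> basin_compact H \<Gamma>\<^sub>1"
    unfolding basin_compact_def
  proof (intro subsetI CollectI ballI conjI impI)
    fix p x assume p: "p \<in> ?V" and x: "x \<in> max_solutions_from H {p}"
    have "p \<in> set_ball \<delta> \<Gamma>\<^sub>1" using p set_ball_mono[of "min b \<delta>" \<delta> \<Gamma>\<^sub>1 \<Gamma>\<^sub>1] by auto
    then have "x \<in> max_solutions_from H (set_ball \<delta> \<Gamma>\<^sub>1)" using x unfolding max_solutions_from_def by blast
    then have ran: "ran x \<subseteq> set_ball (a / 2) \<Gamma>\<^sub>1" using ran_subset_reachable_range \<delta>(2) by blast
    then have bdd: "bounded (ran x)"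
      using bounded_set_ball[OF compact_imp_bounded[OF \<Gamma>1(1)]] bounded_subset by blast
    then show "bounded_arc x" by (simp add: bounded_arc_def)
    assume comp: "complete_arc x"
    have pb: "p \<in> set_ball b \<Gamma>\<^sub>1" using p set_ball_mono[of "min b \<delta>" b \<Gamma>\<^sub>1 \<Gamma>\<^sub>1] by auto
    have cl: "closure (ran x) \<subseteq> basin_of_attraction ?H \<Gamma>\<^sub>1"
      using closure_mono[OF ran] closure_set_ball_subset[of "a / 2" a \<Gamma>\<^sub>1] a(1) aB by auto
    show "converges_to_set x \<Gamma>\<^sub>1"
    proof (rule relative_attraction_reduction[OF H \<Gamma> stab x comp _ bdd])
      show "converges_to_set x \<Gamma>"
        by (rule basin_of_attraction_converges[OF x _ comp]) (use pb bB in blast)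
      show "\<forall>y\<in>max_solutions_from ?H (closure (ran x)). complete_arc y \<longrightarrow> converges_to_set y \<Gamma>\<^sub>1"
        using basin_of_attraction_converges[OF _ cl] by blast
    qed
  qed
  moreover have "\<Gamma>\<^sub>1 \<subseteq> ?V" using b(1) \<delta>(1) by (intro subset_set_ball) simp
  ultimately have "\<Gamma>\<^sub>1 \<subseteq> interior (basin_compact H \<Gamma>\<^sub>1)"
    using interior_maximal[OF _ open_set_ball] by blast
  with stab show ?thesis
    using \<Gamma>1(1) by (simp add: asymptotically_stable_def stable_set_def attractive_def basin_of_attraction_def)
qed

lemma globally_asymptotically_stable_imp_asymptotically_stable:
  "globally_asymptotically_stable H \<Gamma> \<Longrightarrow> asymptotically_stable H \<Gamma>"
  by (simp add: globally_asymptotically_stable_def asymptotically_stable_def globally_attractive_def attractive_def)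

text \<open>Stability is a local matter and comes from the previous theorem. Boundedness, which
  follows from stability for solutions starting near \<open>\<Gamma>\<^sub>1\<close>, is taken from
  the hypothesis for arbitrary initial points.\<close>

theorem globally_asymptotically_stable_reduction:
  fixes H :: "'a::euclidean_space hybrid_system"
  assumes H: "basic_assumptions H" and \<Gamma>1: "compact \<Gamma>\<^sub>1" "\<Gamma>\<^sub>1 \<subseteq> \<Gamma>" and \<Gamma>: "closed \<Gamma>"
    and rel: "globally_asymptotically_stable (restrict_system H \<Gamma>) \<Gamma>\<^sub>1"
    and outer: "globally_asymptotically_stable H \<Gamma>"
    and bdd: "\<forall>x\<in>max_solutions_from H UNIV. bounded_arc x"
  shows "globally_asymptotically_stable H \<Gamma>\<^sub>1"
proof -
  let ?H = "restrict_system H \<Gamma>"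
  have "asymptotically_stable H \<Gamma>\<^sub>1"
    by (rule asymptotically_stable_reduction[OF H \<Gamma>1 \<Gamma>])
      (rule rel[THEN globally_asymptotically_stable_imp_asymptotically_stable],
       rule outer[THEN globally_asymptotically_stable_imp_asymptotically_stable])
  then have stab: "stable_compact H \<Gamma>\<^sub>1"
    using \<Gamma>1(1) by (simp add: asymptotically_stable_def stable_set_def)
  have "p \<in> basin_compact H \<Gamma>\<^sub>1" for p
    unfolding basin_compact_def
  proof (intro CollectI ballI conjI impI)
    fix x assume x: "x \<in> max_solutions_from H {p}"
    then have "x \<in> max_solutions_from H UNIV" unfolding max_solutions_from_def by blast
    with bdd show b: "bounded_arc x" by blast
    assume comp: "complete_arc x"
    show "converges_to_set x \<Gamma>\<^sub>1"
    proof (rule relative_attraction_reduction[OF H \<Gamma> stab x comp])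
      show "converges_to_set x \<Gamma>"
        by (rule basin_of_attraction_converges[OF x _ comp])
          (use outer in \<open>simp add: globally_asymptotically_stable_def globally_attractive_def\<close>)
      show "bounded (ran x)" using b by (simp add: bounded_arc_def)
      have "closure (ran x) \<subseteq> basin_of_attraction ?H \<Gamma>\<^sub>1"
        using rel by (simp add: globally_asymptotically_stable_def globally_attractive_def)
      then show "\<forall>y\<in>max_solutions_from ?H (closure (ran x)). complete_arc y \<longrightarrow> converges_to_set y \<Gamma>\<^sub>1"
        using basin_of_attraction_converges by blast
    qed
  qed
  with stab show ?thesis
    using \<Gamma>1(1) by (auto simp: globally_asymptotically_stable_def stable_set_def globally_attractive_def
        basin_of_attraction_def)
qed

text \<open>The induction applies the global reduction to intermediate restricted systems. A
  solution maximal for the restriction need not be maximal for \<open>H\<close>, but it is part of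
  one that is, and the larger range is bounded.\<close>

lemma bounded_arcs_restrict:
  assumes "\<forall>x\<in>max_solutions_from H UNIV. bounded_arc x"
  shows "\<forall>x\<in>max_solutions_from (restrict_system H A) UNIV. bounded_arc x"
proof
  fix x assume x: "x \<in> max_solutions_from (restrict_system H A) UNIV"
  obtain p where p: "x (0, 0) = Some p" using max_solutions_fromD(4)[OF x] by blast
  obtain y where y: "y \<in> max_solutions_from H UNIV" "x \<subseteq>\<^sub>m y"
    by (rule solution_in_max_solutions_from[OF solution_restrict_imp[OF max_solutions_fromD(1)[OF x]] p UNIV_I])
  have "ran x \<subseteq> ran y"
  proof
    fix v assume "v \<in> ran x"
    then obtain a where a: "x a = Some v" by (auto simp: ran_def)
    then have "y a = Some v" using bspec[OF y(2)[unfolded map_le_def] domI[of x a v]] by simp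
    then show "v \<in> ran y" by (rule ranI)
  qed
  then show "bounded_arc x" using assms y(1) bounded_subset unfolding bounded_arc_def by blast
qed

theorem mainTheorem4:
  fixes H :: "(real ^ 'n) hybrid_system"
    and \<Gamma> :: "nat \<Rightarrow> (real ^ 'n) set"
    and l :: nat
  assumes "basic_assumptions H"
    and "1 \<le> l"
    and "\<forall>i\<in>{1..l}. \<Gamma> i \<subseteq> \<Gamma> (i + 1)"
    and "\<Gamma> (l + 1) = UNIV"
    and "compact (\<Gamma> 1)"
    and "\<forall>i\<in>{1..l}. closed (\<Gamma> i)"
  shows "((\<forall>i\<in>{1..l}. asymptotically_stable_relative H (\<Gamma> i) (\<Gamma> (i + 1)))
            \<longrightarrow> asymptotically_stable H (\<Gamma> 1))
       \<and> ((\<forall>i\<in>{1..l}. globally_asymptotically_stable_relative H (\<Gamma> i) (\<Gamma> (i + 1)))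
            \<and> (\<forall>x\<in>max_solutions_from H UNIV. bounded_arc x)
            \<longrightarrow> globally_asymptotically_stable H (\<Gamma> 1))"
proof -
  have cl: "closed (\<Gamma> i)" if "1 \<le> i" "i \<le> l + 1" for i
    using that assms(4,6) by (cases "i = l + 1") auto
  have incl: "\<Gamma> i \<subseteq> \<Gamma> (Suc i)" if "1 \<le> i" "i \<le> l" for i using that assms(3) by auto
  have sub: "\<Gamma> 1 \<subseteq> \<Gamma> i" if "1 \<le> i" "i \<le> l + 1" for i
    using that
  proof (induction i rule: dec_induct)
    case (step n)
    then show ?case using incl[of n] by auto
  qed simp
  have basic: "basic_assumptions (restrict_system H (\<Gamma> i))" if "1 \<le> i" "i \<le> l + 1" for i
    by (rule basic_assumptions_restrict[OF assms(1) cl[OF that]])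
  have top: "restrict_system H (\<Gamma> (Suc l)) = H" using assms(4) by (simp add: restrict_system_UNIV)
  \<comment> \<open>One induction for both notions of stability, with \<open>P\<close> as the
    notion. The invariant is property \<open>P\<close> of \<open>\<Gamma> 1\<close> relative to
    \<open>\<Gamma> (Suc i)\<close>, starting from the hypothesis for \<open>i = 1\<close>;
    restricting a restriction to a smaller set collapses, and at \<open>i = l\<close> the
    restriction is to the whole space.\<close>
  have induct: "P H (\<Gamma> 1)"
    if hyp: "\<And>i. i \<in> {1..l} \<Longrightarrow> P (restrict_system H (\<Gamma> (i + 1))) (\<Gamma> i)"
      and reduce: "\<And>i. Suc i \<in> {1..l} \<Longrightarrow> 1 \<le> i \<Longrightarrow>
        P (restrict_system (restrict_system H (\<Gamma> (i + 2))) (\<Gamma> (i + 1))) (\<Gamma> 1) \<Longrightarrow>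
        P (restrict_system H (\<Gamma> (i + 2))) (\<Gamma> (i + 1)) \<Longrightarrow> P (restrict_system H (\<Gamma> (i + 2))) (\<Gamma> 1)" for P
  proof -
    have "P (restrict_system H (\<Gamma> (Suc i))) (\<Gamma> 1)" if "1 \<le> i" "i \<le> l" for i
      using that
    proof (induction i rule: dec_induct)
      case base then show ?case using hyp[of 1] by simp
    next
      case (step n)
      then show ?case
        using reduce[of n] hyp[of "Suc n"] incl[of "Suc n"] by (simp add: restrict_restrict_system)
    qed
    from this[OF assms(2) order_refl] show ?thesis by (simp only: top)
  qed
  have "asymptotically_stable H (\<Gamma> 1)"
    if as: "\<forall>i\<in>{1..l}. asymptotically_stable_relative H (\<Gamma> i) (\<Gamma> (i + 1))"
  proof (rule induct)
    show "asymptotically_stable (restrict_system H (\<Gamma> (i + 1))) (\<Gamma> i)" if "i \<in> {1..l}" for i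
      using as that unfolding asymptotically_stable_relative_def by blast
    fix i assume i: "Suc i \<in> {1..l}" "1 \<le> i"
      "asymptotically_stable (restrict_system (restrict_system H (\<Gamma> (i + 2))) (\<Gamma> (i + 1))) (\<Gamma> 1)"
      "asymptotically_stable (restrict_system H (\<Gamma> (i + 2))) (\<Gamma> (i + 1))"
    show "asymptotically_stable (restrict_system H (\<Gamma> (i + 2))) (\<Gamma> 1)"
      by (rule asymptotically_stable_reduction[OF basic assms(5) sub cl i(3,4)]) (use i in auto)
  qed
  moreover have "globally_asymptotically_stable H (\<Gamma> 1)"
    if as: "\<forall>i\<in>{1..l}. globally_asymptotically_stable_relative H (\<Gamma> i) (\<Gamma> (i + 1))"
      and bdd: "\<forall>x\<in>max_solutions_from H UNIV. bounded_arc x"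
  proof (rule induct)
    show "globally_asymptotically_stable (restrict_system H (\<Gamma> (i + 1))) (\<Gamma> i)" if "i \<in> {1..l}" for i
      using as that unfolding globally_asymptotically_stable_relative_def by blast
    fix i assume i: "Suc i \<in> {1..l}" "1 \<le> i"
      "globally_asymptotically_stable (restrict_system (restrict_system H (\<Gamma> (i + 2))) (\<Gamma> (i + 1))) (\<Gamma> 1)"
      "globally_asymptotically_stable (restrict_system H (\<Gamma> (i + 2))) (\<Gamma> (i + 1))"
    show "globally_asymptotically_stable (restrict_system H (\<Gamma> (i + 2))) (\<Gamma> 1)"
      by (rule globally_asymptotically_stable_reduction[OF basic assms(5) sub cl i(3,4)
            bounded_arcs_restrict[OF bdd]]) (use i in auto)
  qed
  ultimately show ?thesis by blast
qed

end
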